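(* Let $n,m\ge 1$, let $\mathbf f:\mathbb R^n\times\mathbb R^m\to\mathbb R^n$, $C:\mathbb R^n\to\mathbb R$, $\mathbf x_0\in\mathbb R^n$, and consider the control problem $$\text{minimize } C(\mathbf x(1))\ \text{ subject to } \dot{\mathbf x}(t)=\mathbf f(\mathbf x(t),\mathbf u(t)),\ t\in[-1,1],\quad \mathbf x(-1)=\mathbf x_0. \qquad (\mathrm P)$$ Let $(\mathbf x^*,\mathbf u^* )\in\mathcal C^1([-1,1];\mathbb R^n)\times\mathcal C^0([-1,1];\mathbb R^m)$ be a local minimizer of (P). Assume there exist an open set $\Omega\subset\mathbb R^{n+m}$ and $\rho>0$ such that the closed Euclidean ball of radius $\rho$ centered at $(\mathbf x^*(t),\mathbf u^*(t))$ lies in $\Omega$ for all $t\in[-1,1]$, the first two derivatives of $\mathbf f$ are continuous on the closure of $\Omega$, and the first two derivatives of $C$ are continuous on the closed ball of radius $\rho$ about $\mathbf x^*(1)$. Let $H(\mathbf x,\mathbf u,\boldsymbol\lambda)=\boldsymbol\lambda^{\mathsf T}\mathbf f(\mathbf x,\mathbf u)$, let $\boldsymbol\lambda^*$ solve $\dot{\boldsymbol\lambda}^*(t)=-\nabla_xH(\mathbf x^*(t),\mathbf u^*(t),\boldsymbol\lambda^*(t))$, $\boldsymbol\lambda^*(1)=\nabla C(\mathbf x^*(1))$, and suppose $\nabla_uH(\mathbf x^*(t),\mathbf u^*(t),\boldsymbol\lambda^*(t))=\mathbf 0$ for all $t\in[-1,1]$. Assume: (A1) $\mathbf x^*,\boldsymbol\lambda^*\in\mathcal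 C^{\eta+1}$ for some integer $\eta\ge3$; (A2) for some $\alpha>0$, the smallest eigenvalues of $\nabla^2C(\mathbf x^*(1))$ and of $\nabla^2_{(x,u)}H(\mathbf x^*(t),\mathbf u^*(t),\boldsymbol\lambda^*(t))$ are greater than $\alpha$, uniformly for $t\in[-1,1]$; (A3) $\|\nabla_x\mathbf f(\mathbf x^*(t),\mathbf u^*(t))\|_\infty\le 1/4$ and $\|\nabla_x\mathbf f(\mathbf x^*(t),\mathbf u^*(t))^{\mathsf T}\|_\infty\le1/4$ for all $t\in[-1,1]$; and suppose that for every $N$ the Gauss differentiation matrices satisfy: (P1) $\mathbf D_{1:N}$ is invertible and $\|\mathbf D_{1:N}^{-1}\|_\infty\le 2$; (P2) every row of $[\mathbf W^{1/2}\mathbf D_{1:N}]^{-1}$ has Euclidean norm at most $\sqrt2$. Then there is a constant $c$ independent of $N$ such that for all $N$ sufficiently large with $N>\eta+1$, the discrete problem $$\text{minimize } C(\mathbf x(1))\ \text{ subject to } \dot{\mathbf x}(\tau_i)=\mathbf f(\mathbf x(\tau_i),\mathbf u_i),\ 1\le i\le N,\quad \mathbf x(-1)=\mathbf x_0,\ \mathbf x\in\mathcal P_N^n \qquad(\mathrm D)$$ has a local minimizer $(\mathbf x^N;\mathbf u_1,\dots,\mathbf u_N)$, and there is an associated discrete costate $\boldsymbol\lambda^N\in\mathcal P_N^n$ satisfying $\dot{\boldsymbol\lambda}^N(\tau_i)=-\nabla_xH(\mathbf x^N(\tau_i),\mathbf u_i,\boldsymbol\lambda^N(\tau_i))$, $1\le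 i\le N$, $\boldsymbol\lambda^N(1)=\nabla C(\mathbf x^N(1))$, and $\mathbf 0=\nabla_uH(\mathbf x^N(\tau_i),\mathbf u_i,\boldsymbol\lambda^N(\tau_i))$, $1\le i\le N$, such that $$\max\{\|\mathbf X^N-\mathbf X^*\|_\infty,\ \|\mathbf U^N-\mathbf U^*\|_\infty,\ \|\boldsymbol\Lambda^N-\boldsymbol\Lambda^*\|_\infty\}\le cN^{2-\eta}.$$
   Context: $\mathcal P_N$ is the space of real polynomials of degree at most $N$ on $[-1,1]$ and $\mathcal P_N^n$ its $n$-fold Cartesian product. For a given $N$, $-1<\tau_1<\dots<\tau_N<1$ are the $N$ Gauss quadrature abscissas (roots of the degree-$N$ Legendre polynomial), $\omega_1,\dots,\omega_N>0$ the corresponding Gauss quadrature weights, and $\tau_0=-1$, $\tau_{N+1}=1$. For $1\le i\le N$, $0\le j\le N$, $D_{ij}=\dot L_j(\tau_i)$ with $L_j(\tau)=\prod_{k=0,k\ne j}^N\frac{\tau-\tau_k}{\tau_j-\tau_k}$; $\mathbf D_{1:N}$ is the $N\times N$ matrix $(D_{ij})_{1\le i,j\le N}$ (the trailing $N$ columns of $\mathbf D$), and $\mathbf W=\mathrm{diag}(\omega_1,\dots,\omega_N)$. For a matrix, $\|\cdot\|_\infty$ is the largest absolute row sum; $\nabla_x\mathbf f$ is the $n\times n$ Jacobian whose $i$-th row is $(\nabla_xf_i)^{\mathsf T}$. The discrete vectors are $\mathbf X^N=[\mathbf x^N(\tau_0),\mathbf x^N(\tau_1),\dots,\mathbf x^N(\tau_N),\mathbf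 x^N(\tau_{N+1})]$, $\mathbf X^*=[\mathbf x^*(\tau_0),\dots,\mathbf x^*(\tau_{N+1})]$, $\mathbf U^N=[\mathbf u_1,\dots,\mathbf u_N]$, $\mathbf U^*=[\mathbf u^*(\tau_1),\dots,\mathbf u^*(\tau_N)]$, $\boldsymbol\Lambda^N=[\boldsymbol\lambda^N(\tau_0),\dots,\boldsymbol\lambda^N(\tau_{N+1})]$, $\boldsymbol\Lambda^*=[\boldsymbol\lambda^*(\tau_0),\dots,\boldsymbol\lambda^*(\tau_{N+1})]$; for such a vector of blocks $\mathbf V_i$, $\|\mathbf V\|_\infty=\max_i|\mathbf V_i|$ with $|\cdot|$ the Euclidean norm. A local minimizer of (D) is meant as a local minimizer of this finite-dimensional optimization problem in the unknowns $\mathbf x\in\mathcal P_N^n$ and $\mathbf u_1,\dots,\mathbf u_N\in\mathbb R^m$. *)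

theory Defs
  imports "HOL-Analysis.Analysis" "HOL-Computational_Algebra.Polynomial"
begin

fun legendre :: "nat \<Rightarrow> real poly" where
  "legendre 0 = 1"
| "legendre (Suc 0) = [:0, 1:]"
| "legendre (Suc (Suc n)) =
     smult (1 / (real n + 2))
       (smult (2 * real n + 3) ([:0, 1:] * legendre (Suc n)) - smult (real n + 1) (legendre n))"

definition gauss_node :: "nat \<Rightarrow> nat \<Rightarrow> real" where
  "gauss_node N i =
     (if i = 0 then -1
      else if i = N + 1 then 1
      else sorted_list_of_set {x. poly (legendre N) x = 0} ! (i - 1))"

definition gauss_weight :: "nat \<Rightarrow> nat \<Rightarrow> real" where
  "gauss_weight N i =
     integral {-1..1}
       (\<lambda>t. \<Prod>k\<in>{1..N} - {i}. (t - gauss_node N k) / (gauss_node N i - gauss_node N k))"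

definition lagr :: "nat \<Rightarrow> nat \<Rightarrow> real poly" where
  "lagr N j = (\<Prod>k\<in>{0..N} - {j}.
                 smult (1 / (gauss_node N j - gauss_node N k)) [:- gauss_node N k, 1:])"

text \<open>D_ij = derivative of L_j at tau_i (1 <= i <= N, 0 <= j <= N).\<close>
definition Dmat :: "nat \<Rightarrow> nat \<Rightarrow> nat \<Rightarrow> real" where
  "Dmat N i j = poly (pderiv (lagr N j)) (gauss_node N i)"

definition is_inverse_N :: "nat \<Rightarrow> (nat \<Rightarrow> nat \<Rightarrow> real) \<Rightarrow> (nat \<Rightarrow> nat \<Rightarrow> real) \<Rightarrow> bool" where
  "is_inverse_N N A B \<longleftrightarrow>
     (\<forall>i\<in>{1..N}. \<forall>j\<in>{1..N}.
        (\<Sum>k=1..N. A i k * B k j) = (if i = j then 1 else 0) \<and>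
        (\<Sum>k=1..N. B i k * A k j) = (if i = j then 1 else 0))"

definition row_sum_norm_N :: "nat \<Rightarrow> (nat \<Rightarrow> nat \<Rightarrow> real) \<Rightarrow> real" where
  "row_sum_norm_N N A = Max ((\<lambda>i. \<Sum>j=1..N. \<bar>A i j\<bar>) ` {1..N})"

definition WhalfD :: "nat \<Rightarrow> nat \<Rightarrow> nat \<Rightarrow> real" where
  "WhalfD N i j = sqrt (gauss_weight N i) * Dmat N i j"

definition Ck_on :: "nat \<Rightarrow> real set \<Rightarrow> (real \<Rightarrow> 'a::real_normed_vector) \<Rightarrow> bool" where
  "Ck_on k S g \<longleftrightarrow>
     (\<exists>D :: nat \<Rightarrow> real \<Rightarrow> 'a.
        (\<forall>t\<in>S. D 0 t = g t) \<and>
        (\<forall>j<k. \<forall>t\<in>S. (D j has_vector_derivative D (Suc j) t) (at t within S)) \<and>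
        continuous_on S (D k))"

definition polyvec :: "nat \<Rightarrow> (real \<Rightarrow> real^'n) \<Rightarrow> bool" where
  "polyvec N x \<longleftrightarrow> (\<forall>k. \<exists>p :: real poly. degree p \<le> N \<and> (\<forall>t. x t $ k = poly p t))"

definition pack :: "real^'n \<Rightarrow> real^'m \<Rightarrow> real^('n + 'm)" where
  "pack x u = (\<chi> k. case k of Inl i \<Rightarrow> x $ i | Inr j \<Rightarrow> u $ j)"

text \<open>Jacobians of f w.r.t. x and u (row i = gradient of f_i), from the
  Frechet derivative Df of (x,u) |-> f x u.\<close>
definition Jx :: "(real^('n+'m) \<Rightarrow> ((real^('n+'m)) \<Rightarrow>\<^sub>L (real^'n))) \<Rightarrow> real^'n \<Rightarrow> real^'m \<Rightarrow> real^'n^'n" where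
  "Jx Df x u = (\<chi> i j. blinfun_apply (Df (pack x u)) (axis (Inl j) 1) $ i)"

definition Ju :: "(real^('n+'m) \<Rightarrow> ((real^('n+'m)) \<Rightarrow>\<^sub>L (real^'n))) \<Rightarrow> real^'n \<Rightarrow> real^'m \<Rightarrow> real^'m^'n" where
  "Ju Df x u = (\<chi> i j. blinfun_apply (Df (pack x u)) (axis (Inr j) 1) $ i)"

text \<open>H(x,u,lambda) = lambda^T f(x,u)\<close>
definition gradxH :: "(real^('n+'m) \<Rightarrow> ((real^('n+'m)) \<Rightarrow>\<^sub>L (real^'n))) \<Rightarrow> real^'n \<Rightarrow> real^'m \<Rightarrow> real^'n \<Rightarrow> real^'n" where
  "gradxH Df x u l = transpose (Jx Df x u) *v l"

definition graduH :: "(real^('n+'m) \<Rightarrow> ((real^('n+'m)) \<Rightarrow>\<^sub>L (real^'n))) \<Rightarrow> real^'n \<Rightarrow> real^'m \<Rightarrow> real^'n \<Rightarrow> real^'m" where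
  "graduH Df x u l = transpose (Ju Df x u) *v l"

definition hessH :: "(real^('n+'m) \<Rightarrow> ((real^('n+'m)) \<Rightarrow>\<^sub>L ((real^('n+'m)) \<Rightarrow>\<^sub>L (real^'n))))
     \<Rightarrow> real^'n \<Rightarrow> real^'m \<Rightarrow> real^'n \<Rightarrow> real^('n+'m)^('n+'m)" where
  "hessH D2f x u l =
     (\<chi> k k'. l \<bullet> blinfun_apply (blinfun_apply (D2f (pack x u)) (axis k 1)) (axis k' 1))"

definition gradC :: "(real^'n \<Rightarrow> ((real^'n) \<Rightarrow>\<^sub>L real)) \<Rightarrow> real^'n \<Rightarrow> real^'n" where
  "gradC DC x = (\<chi> k. blinfun_apply (DC x) (axis k 1))"

definition hessC :: "(real^'n \<Rightarrow> ((real^'n) \<Rightarrow>\<^sub>L ((real^'n) \<Rightarrow>\<^sub>L real))) \<Rightarrow> real^'n \<Rightarrow> real^'n^'n" where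
  "hessC D2C x = (\<chi> k k'. blinfun_apply (blinfun_apply (D2C x) (axis k 1)) (axis k' 1))"

definition min_eigenvalue :: "real^'k^'k \<Rightarrow> real" where
  "min_eigenvalue A = Min {e. \<exists>v. v \<noteq> 0 \<and> A *v v = e *s v}"

definition mat_inf_norm :: "real^'k^'l \<Rightarrow> real" where
  "mat_inf_norm A = Max (range (\<lambda>i. \<Sum>j\<in>UNIV. \<bar>A $ i $ j\<bar>))"

definition feasible_P :: "(real^'n \<Rightarrow> real^'m \<Rightarrow> real^'n) \<Rightarrow> real^'n
    \<Rightarrow> (real \<Rightarrow> real^'n) \<Rightarrow> (real \<Rightarrow> real^'m) \<Rightarrow> bool" where
  "feasible_P f x0 x u \<longleftrightarrow>
     Ck_on 1 {-1..1} x \<and> continuous_on {-1..1} u \<and> x (-1) = x0 \<and>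
     (\<forall>t\<in>{-1..1}. (x has_vector_derivative f (x t) (u t)) (at t within {-1..1}))"

definition local_min_P :: "(real^'n \<Rightarrow> real^'m \<Rightarrow> real^'n) \<Rightarrow> (real^'n \<Rightarrow> real) \<Rightarrow> real^'n
    \<Rightarrow> (real \<Rightarrow> real^'n) \<Rightarrow> (real \<Rightarrow> real^'m) \<Rightarrow> bool" where
  "local_min_P f C x0 xs us \<longleftrightarrow>
     feasible_P f x0 xs us \<and>
     (\<exists>\<epsilon>>0. \<forall>x u. feasible_P f x0 x u \<and>
         (\<forall>t\<in>{-1..1}. norm (x t - xs t) < \<epsilon> \<and> norm (u t - us t) < \<epsilon>)
         \<longrightarrow> C (xs 1) \<le> C (x 1))"

definition feasible_D :: "(real^'n \<Rightarrow> real^'m \<Rightarrow> real^'n) \<Rightarrow> real^'n \<Rightarrow> nat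
    \<Rightarrow> (real \<Rightarrow> real^'n) \<Rightarrow> (nat \<Rightarrow> real^'m) \<Rightarrow> bool" where
  "feasible_D f x0 N x u \<longleftrightarrow>
     polyvec N x \<and> x (-1) = x0 \<and>
     (\<forall>i\<in>{1..N}. (x has_vector_derivative f (x (gauss_node N i)) (u i)) (at (gauss_node N i)))"

text \<open>local minimizer of the finite-dimensional problem (D) in the unknowns
  x \<in> P_N^n and u_1..u_N (the sup norm on [-1,1] is a norm on P_N^n)\<close>
definition local_min_D :: "(real^'n \<Rightarrow> real^'m \<Rightarrow> real^'n) \<Rightarrow> (real^'n \<Rightarrow> real) \<Rightarrow> real^'n \<Rightarrow> nat
    \<Rightarrow> (real \<Rightarrow> real^'n) \<Rightarrow> (nat \<Rightarrow> real^'m) \<Rightarrow> bool" where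
  "local_min_D f C x0 N x u \<longleftrightarrow>
     feasible_D f x0 N x u \<and>
     (\<exists>\<epsilon>>0. \<forall>y v. feasible_D f x0 N y v \<and>
         (\<forall>t\<in>{-1..1}. norm (y t - x t) < \<epsilon>) \<and> (\<forall>i\<in>{1..N}. norm (v i - u i) < \<epsilon>)
         \<longrightarrow> C (x 1) \<le> C (y 1))"

end

theory Submission
  imports Defs
begin

text \<open>
  The unknowns of (D) are the derivatives of the state and of the costate and the controls at the
  Gauss nodes; state and costate are recovered by integrating the interpolating polynomial from the
  left and from the right end. By exactness of Gauss quadrature in degree \<open>2 N - 1\<close> these two
  integration operators are adjoint to each other for the weighted inner product and bounded from
  the weighted \<open>l\<^sup>2\<close> norm to the sup norm by \<open>sqrt 2\<close>, for all \<open>N\<close>.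

  For the optimality system linearized at the continuous solution, testing with the solution gives a
  weighted \<open>l\<^sup>2\<close> bound by coercivity of the two Hessians and by (A3), and the equations turn it into
  a sup-norm bound; both are uniform in \<open>N\<close>. Newton's method with the frozen linearization then
  produces a discrete solution at a distance proportional to the residual of the continuous one.
  The residual is the error of collocating the derivatives of the state and costate; by expansion in
  Legendre polynomials (eigenfunctions of \<open>p \<mapsto> - ((1 - x\<^sup>2) p')'\<close>) it is \<open>O(N powr (1 - \<eta>))\<close>.

  Near the solution \<open>C\<close> and \<open>(x, u) \<mapsto> H(x, u, \<lambda>)\<close> are convex for the discrete multipliers, and
  summation by parts makes the discrete stationary point a local minimizer.
\<close>

subsection \<open>Integrals of polynomials over [-1, 1]\<close>

text \<open>Every constant has to be independent of \<open>N\<close> although the number of unknowns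
  grows with \<open>N\<close>. A weighted \<open>l2\<close> bound controls no single node uniformly,
  because individual weights tend to 0. This is why the unknowns are derivatives: passing to
  trajectories applies an integration operator, which lands in the sup norm, and only the remaining
  nodal quantities have to be recovered from the equations. The weights sum to 2, so each
  integration operator has norm at most sqrt 2 * sqrt 2 = 2 in the weighted norm; with the bound 1/4
  of (A3) the feedback of the multiplier on itself has factor 1/2 and is absorbed. State and control
  are merged into one vector \<open>w\<close>. The adjoint of \<open>Df w\<close> then yields both
  gradients of H, costate equation and stationarity become one equation, and the Hessian in (x,u)
  enters as one coercive form. Exponent of the residual: the state has \<eta> + 1 derivatives, its
  derivative has \<eta>, and one more is spent on passing from L2 to sup bounds.\<close>

definition poly_primitive :: "real poly \<Rightarrow> real poly" where
  "poly_primitive p = (\<Sum>i\<le>degree p. monom (coeff p i / real (Suc i)) (Suc i))"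

lemma pderiv_sum_real:
  fixes f :: "'b \<Rightarrow> real poly"
  shows "pderiv (\<Sum>i\<in>A. f i) = (\<Sum>i\<in>A. pderiv (f i))"
  by (induction A rule: infinite_finite_induct) (auto simp: pderiv_add)

lemma pderiv_poly_primitive [simp]: "pderiv (poly_primitive p) = p"
proof -
  have "pderiv (poly_primitive p) = (\<Sum>i\<le>degree p. monom (coeff p i) i)"
    unfolding poly_primitive_def
    by (simp add: pderiv_sum_real pderiv_monom del: of_nat_Suc)
  thus ?thesis by (simp add: poly_as_sum_of_monoms)
qed

lemma degree_poly_primitive: "degree (poly_primitive p) \<le> Suc (degree p)"
  unfolding poly_primitive_def
  by (rule degree_sum_le) (auto intro: order_trans[OF degree_monom_le])

lemma poly_FTC:
  fixes a b :: real
  assumes "a \<le> b"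
  shows "((\<lambda>x. poly (pderiv p) x) has_integral poly p b - poly p a) {a..b}"
  by (rule fundamental_theorem_of_calculus[OF assms])
     (auto intro: DERIV_subset poly_DERIV simp: has_real_derivative_iff_has_vector_derivative[symmetric])

lemma has_integral_poly:
  "a \<le> b \<Longrightarrow> (poly p has_integral poly (poly_primitive p) b - poly (poly_primitive p) a) {a..b}"
  using poly_FTC[of a b "poly_primitive p"] by simp

lemma poly_integrable: "poly p integrable_on {a..b::real}"
  by (intro integrable_continuous_interval continuous_intros)

definition pI :: "real poly \<Rightarrow> real" where "pI p = integral {-1..1} (poly p)"

lemma poly_fun:
  fixes p q :: "real poly"
  shows "poly (p + q) = (\<lambda>x. poly p x + poly q x)" "poly (p - q) = (\<lambda>x. poly p x - poly q x)"
  "poly (smult c p) = (\<lambda>x. c * poly p x)"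
  by (auto simp: fun_eq_iff)

lemma pI_add: "pI (p + q) = pI p + pI q"
  unfolding pI_def poly_fun by (simp add: integral_add[symmetric] poly_integrable)

lemma pI_diff: "pI (p - q) = pI p - pI q"
  unfolding pI_def poly_fun by (simp add: integral_diff[symmetric] poly_integrable)

lemma pI_smult: "pI (smult c p) = c * pI p"
  unfolding pI_def poly_fun by simp

lemma pI_0 [simp]: "pI 0 = 0" using pI_smult[of 0 0] by simp

lemma pI_sum: "pI (\<Sum>i\<in>A. f i) = (\<Sum>i\<in>A. pI (f i))"
  by (induction A rule: infinite_finite_induct) (auto simp: pI_add)

lemma pI_pderiv: "pI (pderiv p) = poly p 1 - poly p (-1)"
  unfolding pI_def by (intro integral_unique poly_FTC) auto

lemma pI_monom: "pI (monom 1 k) = (1 - (-1) ^ Suc k) / real (Suc k)"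
proof -
  have "monom (1::real) k = pderiv (monom (1 / real (Suc k)) (Suc k))"
    by (simp add: pderiv_monom del: of_nat_Suc)
  hence "pI (monom 1 k) = poly (monom (1 / real (Suc k)) (Suc k)) 1 - poly (monom (1 / real (Suc k)) (Suc k)) (-1)"
    using pI_pderiv by metis
  thus ?thesis by (simp add: poly_monom diff_divide_distrib add_divide_distrib)
qed

lemma pI_nonneg: "(\<And>x. -1 \<le> x \<Longrightarrow> x \<le> 1 \<Longrightarrow> 0 \<le> poly p x) \<Longrightarrow> 0 \<le> pI p"
  unfolding pI_def by (intro integral_nonneg poly_integrable) auto

text \<open>A nonnegative continuous integrand with zero integral vanishes on the whole interval,
  which gives more roots than a nonzero polynomial can have.\<close>

lemma pI_eq_0_nonneg:
  assumes nn: "\<And>x. -1 \<le> x \<Longrightarrow> x \<le> 1 \<Longrightarrow> 0 \<le> poly p x" and z: "pI p = 0"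
  shows "p = 0"
proof -
  have "(poly p has_integral 0) {-1..1}"
    using z poly_integrable[of p] unfolding pI_def by (metis has_integral_integral)
  hence 0: "poly p x = 0" if "x \<in> {-1..1}" for x
  proof -
    have "continuous_on {-1..1} (poly p)" by (intro continuous_intros)
    thus ?thesis using has_integral_0_cbox_imp_0[of "-1" 1 "poly p" x] that nn \<open>(poly p has_integral 0) {-1..1}\<close>
      by (auto simp: box_real)
  qed
  show ?thesis
  proof (rule ccontr)
    assume "p \<noteq> 0"
    hence "finite {x. poly p x = 0}" by (rule poly_roots_finite)
    moreover have "{-1..1} \<subseteq> {x. poly p x = 0}" using 0 by auto
    ultimately have "finite {-1..1::real}" by (rule finite_subset[rotated])
    thus False using infinite_Icc[of "-1" "1::real"] by simp
  qed
qed

lemma pI_square_eq_0: "pI (p * p) = 0 \<Longrightarrow> p = 0"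
  using pI_eq_0_nonneg[of "p * p"] by auto

subsection \<open>Legendre polynomials\<close>

text \<open>The subtracted term has degree two less, so the leading term cannot cancel. The sign of
  the leading coefficient is carried along because degree 0 alone would not exclude the zero
  polynomial.\<close>

lemma degree_legendre_coeff: "degree (legendre n) = n \<and> lead_coeff (legendre n) > 0"
proof (induction n rule: legendre.induct)
  case (3 n)
  let ?p = "smult (2 * real n + 3) ([:0, 1:] * legendre (Suc n))"
  let ?q = "smult (real n + 1) (legendre n)"
  have ne: "legendre (Suc n) \<noteq> 0" using 3 by auto
  have "degree ([:0, 1:] * legendre (Suc n)) = Suc (Suc n)"
    using ne 3(1)[THEN conjunct1] by (simp del: legendre.simps)
  moreover have "2 * real n + 3 \<noteq> 0" by linarith
  ultimately have dp: "degree ?p = Suc (Suc n)" unfolding degree_smult_eq by presburger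
  have lp: "lead_coeff ?p > 0" 
  proof -
    have "0 < 2 * real n + 3" by linarith
    moreover have "lead_coeff ([:0,1:] * legendre (Suc n)) = lead_coeff (legendre (Suc n))"
      by (simp only: lead_coeff_mult) simp
    ultimately show ?thesis using 3(1)[THEN conjunct2] unfolding lead_coeff_smult by (metis mult_pos_pos)
  qed
  have dq: "degree ?q = n" using 3 by simp
  have "?p - ?q = ?p + - ?q" by simp
  have d: "degree (?p - ?q) = Suc (Suc n)"
    using degree_add_eq_left[of "- ?q" ?p] dp dq by (simp del: legendre.simps mult_pCons_left)
  moreover have "coeff ?q (Suc (Suc n)) = 0" using dq by (intro coeff_eq_0) simp
  hence "lead_coeff (?p - ?q) = lead_coeff ?p" unfolding d dp by simp
  ultimately show ?case using lp by (simp del: mult_pCons_left)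
qed auto

lemma degree_legendre [simp]: "degree (legendre n) = n"
  using degree_legendre_coeff by blast

lemma legendre_neq_0 [simp]: "legendre n \<noteq> 0"
  using degree_legendre_coeff[of n] by force

text \<open>Only the three-term recurrence is given, so orthogonality is proved through moments
  against monomials: multiplication by x shifts \<open>k\<close>, and the recurrence becomes one
  between numbers.\<close>

definition legM :: "nat \<Rightarrow> nat \<Rightarrow> real" where "legM n k = pI (monom 1 k * legendre n)"

lemma legM_rec:
  "(real n + 2) * legM (Suc (Suc n)) k = (2 * real n + 3) * legM (Suc n) (Suc k) - (real n + 1) * legM n k"
proof -
  have "monom 1 k * legendre (Suc (Suc n)) =
     smult (1 / (real n + 2)) (smult (2 * real n + 3) (monom 1 (Suc k) * legendre (Suc n))
       - smult (real n + 1) (monom 1 k * legendre n))"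
    by (simp add: algebra_simps monom_Suc)
  hence "legM (Suc (Suc n)) k = 1 / (real n + 2) * ((2 * real n + 3) * legM (Suc n) (Suc k) - (real n + 1) * legM n k)"
    unfolding legM_def by (simp only: pI_smult pI_diff)
  moreover have "real n + 2 > 0" by simp
  ultimately show ?thesis by simp
qed

lemma legM_0: "legM 0 k = (1 - (-1) ^ Suc k) / real (Suc k)"
  by (simp add: legM_def pI_monom del: power_Suc)

lemma legM_1: "legM (Suc 0) k = legM 0 (Suc k)"
  by (simp add: legM_def monom_Suc)

text \<open>Two first-order relations among the moments \<^term>\<open>legM n k\<close>; together they encode the closed
  form \<open>k! / ((k - n)!! (k + n + 1)!!)\<close> (times 2, for \<open>k - n\<close> even), and they are stable under the
  three-term recurrence.\<close>

lemma legM_relations: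
  "(\<forall>k. (real k + real n + 3) * legM (Suc n) (Suc k) = (real k + 1) * legM n k) \<and>
   (\<forall>k. (real k + 1 - real n) * legM n (Suc k) = (real k + 1) * legM (Suc n) k)"
proof (induction n)
  case 0
  show ?case by (auto simp: legM_1 legM_0 field_simps)
next
  case (Suc n)
  \<comment> \<open>Eliminating \<open>legM (Suc n) (Suc k)\<close> between the recurrence and the
    first relation links the degrees \<open>n\<close> and \<open>n + 2\<close> at the same moment;
    both relations for \<open>Suc n\<close> follow from it.\<close>
  have two: "(real k + real n + 3) * legM (Suc (Suc n)) k = (real k - real n) * legM n k" for k
  proof -
    have s: "(real k + real n + 3) * legM (Suc n) (Suc k) = (real k + 1) * legM n k"
      using Suc by blast
    have "(real n + 2) * ((real k + real n + 3) * legM (Suc (Suc n)) k) =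
       (real k + real n + 3) * ((real n + 2) * legM (Suc (Suc n)) k)" by simp
    also have "\<dots> = (2 * real n + 3) * ((real k + real n + 3) * legM (Suc n) (Suc k))
        - (real k + real n + 3) * (real n + 1) * legM n k"
      unfolding legM_rec by (simp add: algebra_simps)
    also have "\<dots> = (real n + 2) * ((real k - real n) * legM n k)"
      unfolding s by (simp add: algebra_simps)
    finally show ?thesis by simp
  qed
  show ?case
  proof (intro conjI allI)
    fix k
    have "(real (Suc k) + real n + 3) * legM (Suc (Suc n)) (Suc k) = (real (Suc k) - real n) * legM n (Suc k)"
      by (rule two)
    also have "\<dots> = (real k + 1) * legM (Suc n) k"
      using Suc by (auto simp: algebra_simps)
    finally show "(real k + real (Suc n) + 3) * legM (Suc (Suc n)) (Suc k) = (real k + 1) * legM (Suc n) k"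
      by (simp add: algebra_simps)
    have s: "(real k + real n + 3) * legM (Suc n) (Suc k) = (real k + 1) * legM n k"
      using Suc by blast
    \<comment> \<open>Multiplied by a positive factor that \<open>s\<close> and \<open>two\<close>
      can consume and that is cancelled at the end.\<close>
    have "(real k + real n + 3) * ((real k - real n) * legM (Suc n) (Suc k)) =
        (real k - real n) * ((real k + real n + 3) * legM (Suc n) (Suc k))" by simp
    also have "\<dots> = (real k + 1) * ((real k - real n) * legM n k)" unfolding s by simp
    also have "\<dots> = (real k + real n + 3) * ((real k + 1) * legM (Suc (Suc n)) k)"
      unfolding two[symmetric] by simp
    finally have "(real k - real n) * legM (Suc n) (Suc k) = (real k + 1) * legM (Suc (Suc n)) k"
      by (simp add: add_nonneg_pos)
    thus "(real k + 1 - real (Suc n)) * legM (Suc n) (Suc k) = (real k + 1) * legM (Suc (Suc n)) k"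
      by simp
  qed
qed

text \<open>A parity fact; here it runs along the diagonal by the first of
  \<open>legM_relations\<close>, down to \<open>legM 0 1 = 0\<close>.\<close>

lemma legM_Suc_eq_0: "legM n (Suc n) = 0"
proof (induction n)
  case 0 show ?case by (simp add: legM_0)
next
  case (Suc n)
  have "(real (Suc n) + real n + 3) * legM (Suc n) (Suc (Suc n)) = (real (Suc n) + 1) * legM n (Suc n)"
    using legM_relations by blast
  with Suc show ?case by simp
qed

lemma legM_eq_0: "k < n \<Longrightarrow> legM n k = 0"
proof (induction n arbitrary: k)
  case (Suc n)
  have r: "(real k + 1 - real n) * legM n (Suc k) = (real k + 1) * legM (Suc n) k"
    using legM_relations by blast
  \<comment> \<open>For \<open>k = n\<close> the moment is \<open>legM n (Suc n)\<close>, for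
    \<open>Suc k = n\<close> the factor \<open>real k + 1 - real n\<close> vanishes, and otherwise
    the induction hypothesis applies.\<close>
  consider "k = n" | "Suc k = n" | "Suc k < n" using Suc.prems by linarith
  hence "(real k + 1 - real n) * legM n (Suc k) = 0"
    by cases (use Suc.IH legM_Suc_eq_0 in auto)
  with r show ?case by simp
qed simp

lemma legendre_orthogonal:
  assumes "degree q < n" shows "pI (q * legendre n) = 0"
proof -
  have "q * legendre n = (\<Sum>i\<le>degree q. smult (coeff q i) (monom 1 i * legendre n))"
    by (subst poly_as_sum_of_monoms[of q, symmetric])
       (simp add: sum_distrib_right smult_monom flip: mult_smult_left)
  hence "pI (q * legendre n) = (\<Sum>i\<le>degree q. coeff q i * legM n i)"
    by (simp add: pI_sum pI_smult legM_def)
  also have "\<dots> = 0" using assms by (intro sum.neutral) (auto simp: legM_eq_0)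
  finally show ?thesis .
qed

text \<open>The witness \<open>S\<close> consists of the roots of odd multiplicity in the open
  interval. Splitting off one root \<open>s\<close> changes the parity of its multiplicity and hence
  toggles its membership in \<open>S\<close>.\<close>

lemma sign_change_set:
  fixes p :: "real poly"
  assumes "p \<noteq> 0"
  shows "\<exists>S. finite S \<and> S \<subseteq> {-1<..<1} \<and> S \<subseteq> {x. poly p x = 0} \<and> (\<exists>s\<in>{1,-1}. \<forall>x\<in>{-1<..<1}. 0 \<le> s * poly (p * (\<Prod>r\<in>S. [:-r,1:])) x)"
  using assms
proof (induction "degree p" arbitrary: p rule: less_induct)
  case less
  show ?case
  proof (cases "\<exists>s\<in>{-1<..<1}. poly p s = 0")
    case False
    have "\<exists>s\<in>{1,-1}. \<forall>x\<in>{-1<..<1}. 0 \<le> s * poly p x"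
    proof (rule ccontr)
      assume "\<not> ?thesis"
      then obtain x y where xy: "x \<in> {-1<..<1}" "y \<in> {-1<..<1}" "poly p x < 0" "poly p y > 0"
        by (auto simp: not_le)
      have "connected {-1<..<1::real}" by simp
      hence c: "connected (poly p ` {-1<..<1})"
        by (intro connected_continuous_image continuous_intros)
      have "0 \<in> poly p ` {-1<..<1}"
        using connectedD_interval[OF c, of "poly p x" "poly p y" 0] xy by auto
      thus False using False by auto
    qed
    thus ?thesis by (intro exI[of _ "{}"]) auto
  next
    case True
    then obtain s where s: "s \<in> {-1<..<1}" "poly p s = 0" by blast
    then obtain q where q: "p = [:-s,1:] * q" by (metis dvdE poly_eq_0_iff_dvd)
    have "q \<noteq> 0" using q less by auto
    hence "degree q < degree p" unfolding q by (simp add: degree_mult_eq del: mult_pCons_left)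
    from less.hyps[OF this \<open>q \<noteq> 0\<close>] obtain S \<sigma> where S: "finite S" "S \<subseteq> {-1<..<1}" "S \<subseteq> {x. poly q x = 0}"
      "\<sigma> \<in> {1,-1}" "\<And>x. x \<in> {-1<..<1} \<Longrightarrow> 0 \<le> \<sigma> * poly (q * (\<Prod>r\<in>S. [:-r,1:])) x"
      by blast
    show ?thesis
    \<comment> \<open>If \<open>s\<close> is already in the set of the quotient, dropping it leaves
      the product polynomial unchanged; otherwise inserting it multiplies the product by a square.
      The sign survives either way.\<close>
    proof (cases "s \<in> S")
      case True
      have "q * (\<Prod>r\<in>S. [:-r,1:]) = p * (\<Prod>r\<in>S-{s}. [:-r,1:])"
        unfolding q by (subst prod.remove[OF S(1) True]) (simp add: algebra_simps)
      thus ?thesis using S by (intro exI[of _ "S - {s}"]) (auto simp: q)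
    next
      case False
      have e: "p * (\<Prod>r\<in>insert s S. [:-r,1:]) = [:-s,1:]^2 * (q * (\<Prod>r\<in>S. [:-r,1:]))"
        unfolding q prod.insert[OF S(1) False] power2_eq_square by (simp only: mult_ac)
      have "0 \<le> \<sigma> * poly (p * (\<Prod>r\<in>insert s S. [:-r,1:])) x" if "x \<in> {-1<..<1}" for x
      proof -
        have "0 \<le> (poly [:-s,1:] x)^2 * (\<sigma> * poly (q * (\<Prod>r\<in>S. [:-r,1:])) x)"
          by (rule mult_nonneg_nonneg[OF zero_le_power2 S(5)[OF that]])
        also have "\<dots> = \<sigma> * poly (p * (\<Prod>r\<in>insert s S. [:-r,1:])) x"
          unfolding e by (simp only: poly_mult poly_power mult_ac)
        finally show ?thesis .
      qed
      thus ?thesis using S s by (intro exI[of _ "insert s S"] conjI bexI[of _ \<sigma>]) (auto simp: q)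
    qed
  qed
qed

text \<open>With fewer than \<open>n\<close> sign changes, the product of the linear factors at
  these points would have degree below \<open>n\<close> and be orthogonal to
  \<open>legendre n\<close>, while its product with \<open>legendre n\<close> has one sign and would
  therefore vanish. So at least \<open>n\<close> interior roots exist, and the degree allows no
  other.\<close>

lemma legendre_roots:
  "finite {x. poly (legendre n) x = 0} \<and> card {x. poly (legendre n) x = 0} = n \<and>
   {x. poly (legendre n) x = 0} \<subseteq> {-1<..<1}"
proof -
  let ?R = "{x. poly (legendre n) x = 0}"
  obtain S \<sigma> where S: "finite S" "S \<subseteq> {-1<..<1}" "S \<subseteq> ?R"
      "\<sigma> \<in> {1,-1::real}" "\<And>x. x \<in> {-1<..<1} \<Longrightarrow> 0 \<le> \<sigma> * poly (legendre n * (\<Prod>r\<in>S. [:-r,1:])) x"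
    using sign_change_set[OF legendre_neq_0[of n]] by blast
  let ?q = "\<Prod>r\<in>S. [:-r,1:]"
  have dq: "degree ?q = card S" by (subst degree_prod_eq_sum_degree) auto
  have q0: "?q \<noteq> 0" using S(1) by (subst prod_zero_iff) auto
  have "n \<le> card S"
  proof (rule ccontr)
    assume "\<not> n \<le> card S"
    hence "pI (?q * legendre n) = 0" by (intro legendre_orthogonal) (simp add: dq)
    hence z: "pI (smult \<sigma> (legendre n * ?q)) = 0" by (simp add: pI_smult mult.commute)
    \<comment> \<open>The sign is known on the open interval only; the endpoints are reached by
      continuity.\<close>
    have nn: "0 \<le> poly (smult \<sigma> (legendre n * ?q)) x" if "-1 \<le> x" "x \<le> 1" for x
    proof -
      have "x \<in> closure {-1<..<1::real}" using that by simp
      thus ?thesis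
        by (rule continuous_ge_on_closure[rotated])
           (use S(5) in \<open>auto simp del: poly_smult poly_mult intro!: continuous_intros simp: poly_smult[symmetric]\<close>)
    qed
    have "smult \<sigma> (legendre n * ?q) = 0" using nn z by (rule pI_eq_0_nonneg)
    thus False using q0 S(4) by auto
  qed
  moreover have fin: "finite ?R" by (rule poly_roots_finite) simp
  moreover have "card ?R \<le> n" using card_poly_roots_bound[of "legendre n"] by simp
  moreover have "card S \<le> card ?R" using S fin by (intro card_mono) auto
  ultimately have "S = ?R" "card ?R = n" using card_subset_eq[OF fin S(3)] by auto
  thus ?thesis using S fin by auto
qed

subsection \<open>Gauss quadrature\<close>

lemma bij_gauss_node: "bij_betw (gauss_node N) {1..N} {x. poly (legendre N) x = 0}"
proof -
  let ?R = "{x. poly (legendre N) x = 0}"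
  let ?l = "sorted_list_of_set ?R"
  have R: "finite ?R" "card ?R = N" using legendre_roots by auto
  have l: "distinct ?l" "set ?l = ?R" "length ?l = N" using R by auto
  have "bij_betw (nth ?l) {..<N} ?R" using bij_betw_nth[OF l(1)] l by auto
  moreover have "bij_betw (\<lambda>i. i - 1) {1..N} {..<N}"
    by (rule bij_betw_byWitness[where f'=Suc]) auto
  ultimately have "bij_betw (nth ?l \<circ> (\<lambda>i. i - 1)) {1..N} ?R" by (rule bij_betw_trans[rotated])
  thus ?thesis by (rule bij_betw_cong[THEN iffD1, rotated]) (auto simp: gauss_node_def)
qed

lemma gauss_node_root: "i \<in> {1..N} \<Longrightarrow> poly (legendre N) (gauss_node N i) = 0"
  using bij_gauss_node[of N] by (auto simp: bij_betw_def)

lemma gauss_node_bounds: "i \<in> {1..N} \<Longrightarrow> -1 < gauss_node N i \<and> gauss_node N i < 1"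
  using gauss_node_root[of i N] legendre_roots[of N] by auto

lemma gauss_node_Icc: "N \<ge> 1 \<Longrightarrow> i \<in> {0..N+1} \<Longrightarrow> gauss_node N i \<in> {-1..1}"
  using gauss_node_bounds[of i N] by (cases "i = 0 \<or> i = N + 1") (auto simp: gauss_node_def)

lemma gauss_node_inj: "inj_on (gauss_node N) {1..N}"
  using bij_gauss_node[of N] by (auto simp: bij_betw_def)

text \<open>Unlike \<^const>\<open>lagr\<close>, the Lagrange basis without the node \<open>-1\<close>: it interpolates derivatives.\<close>

definition glag :: "nat \<Rightarrow> nat \<Rightarrow> real poly" where
  "glag N i = (\<Prod>k\<in>{1..N} - {i}. smult (1 / (gauss_node N i - gauss_node N k)) [:- gauss_node N k, 1:])"

lemma poly_glag: "poly (glag N i) t = (\<Prod>k\<in>{1..N} - {i}. (t - gauss_node N k) / (gauss_node N i - gauss_node N k))"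
  unfolding glag_def poly_prod by (auto intro!: prod.cong simp: diff_divide_distrib)

lemma gauss_weight_eq: "gauss_weight N i = pI (glag N i)"
  unfolding gauss_weight_def pI_def using poly_glag[of N i] by presburger

lemma degree_glag: "i \<in> {1..N} \<Longrightarrow> degree (glag N i) < N"
proof -
  assume i: "i \<in> {1..N}"
  have "degree (glag N i) \<le> (\<Sum>k\<in>{1..N} - {i}. degree (smult (1 / (gauss_node N i - gauss_node N k)) [:- gauss_node N k, 1:]))"
    unfolding glag_def by (rule degree_prod_sum_le[OF _, simplified o_def]) simp
  also have "\<dots> \<le> (\<Sum>k\<in>{1..N} - {i}. 1)" by (rule sum_mono) simp
  also have "\<dots> = N - 1" using i by (simp add: card_Diff_singleton)
  finally show ?thesis using i by auto
qed

lemma glag_node: 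
  assumes "i \<in> {1..N}" "j \<in> {1..N}"
  shows "poly (glag N i) (gauss_node N j) = (if i = j then 1 else 0)"
proof (cases "i = j")
  case True
  have "gauss_node N i - gauss_node N k \<noteq> 0" if "k \<in> {1..N} - {i}" for k
    using inj_on_eq_iff[OF gauss_node_inj[of N] assms(1), of k] that by simp
  thus ?thesis using True by (simp add: poly_glag)
next
  case False
  hence "\<exists>k\<in>{1..N} - {i}. (gauss_node N j - gauss_node N k) / (gauss_node N i - gauss_node N k) = 0"
    using assms by (intro bexI[of _ j]) auto
  thus ?thesis using False unfolding poly_glag by (simp add: prod_zero)
qed

lemma poly_eq_if_eq_at_nodes:
  assumes "degree p < N" "degree q < N" "\<And>i. i \<in> {1..N} \<Longrightarrow> poly p (gauss_node N i) = poly q (gauss_node N i)"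
  shows "p = q"
proof (rule poly_eqI_degree[where A="{x. poly (legendre N) x = 0}"])
  fix x assume "x \<in> {x. poly (legendre N) x = 0}"
  then obtain i where "i \<in> {1..N}" "x = gauss_node N i"
    using bij_gauss_node[of N] unfolding bij_betw_def by blast
  thus "poly p x = poly q x" using assms by auto
qed (use assms legendre_roots[of N] in auto)

lemma glag_interpolation:
  assumes "degree p < N"
  shows "p = (\<Sum>i=1..N. smult (poly p (gauss_node N i)) (glag N i))"
proof (rule poly_eq_if_eq_at_nodes[OF assms])
  have "N > 0" using assms by simp
  thus "degree (\<Sum>i=1..N. smult (poly p (gauss_node N i)) (glag N i)) < N"
    by (intro degree_sum_less) (auto simp: degree_glag)
  fix j assume j: "j \<in> {1..N}"
  have "poly (\<Sum>i=1..N. smult (poly p (gauss_node N i)) (glag N i)) (gauss_node N j)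
    = (\<Sum>i=1..N. if i = j then poly p (gauss_node N j) else 0)"
    unfolding poly_sum by (rule sum.cong) (use j in \<open>auto simp: glag_node\<close>)
  also have "\<dots> = poly p (gauss_node N j)" using j by simp
  finally show "poly p (gauss_node N j) = poly (\<Sum>i=1..N. smult (poly p (gauss_node N i)) (glag N i)) (gauss_node N j)" ..
qed

text \<open>Division by the Legendre polynomial: the cofactor of \<open>legendre N\<close> has
  degree below \<open>N\<close>, so this part integrates to 0 by orthogonality and also vanishes at
  the nodes; the remainder is its own interpolant.\<close>

lemma gauss_exact:
  assumes "degree p < 2 * N"
  shows "pI p = (\<Sum>i=1..N. gauss_weight N i * poly p (gauss_node N i))"
proof -
  let ?P = "legendre N"
  let ?q = "p div ?P" and ?r = "p mod ?P"
  have N: "N > 0" using assms by simp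
  have dr: "degree ?r < N" using degree_mod_less[of ?P p] N by auto
  have p: "p = ?q * ?P + ?r" by simp
  have dq: "degree ?q < N"
  proof (cases "?q = 0")
    case False
    hence "degree (?q * ?P) = degree ?q + N" by (simp add: degree_mult_eq)
    moreover have "degree (?q * ?P) < 2 * N"
    proof -
      have "?q * ?P = p - ?r" by (simp add: minus_mod_eq_div_mult)
      moreover have "degree (p - ?r) < 2 * N" using assms dr N by (intro degree_diff_less) auto
      ultimately show ?thesis by simp
    qed
    ultimately show ?thesis by simp
  qed (use N in auto)
  have "pI p = pI (?q * ?P) + pI ?r" by (subst p, rule pI_add)
  also have "pI (?q * ?P) = 0" by (rule legendre_orthogonal[OF dq])
  also have "pI ?r = (\<Sum>i=1..N. poly ?r (gauss_node N i) * gauss_weight N i)"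
    by (subst glag_interpolation[OF dr]) (simp add: pI_sum pI_smult gauss_weight_eq)
  also have "\<dots> = (\<Sum>i=1..N. gauss_weight N i * poly p (gauss_node N i))"
  proof (rule sum.cong)
    fix i assume "i \<in> {1..N}"
    hence "poly p (gauss_node N i) = poly ?r (gauss_node N i)"
      by (subst p) (simp only: poly_add poly_mult gauss_node_root mult_zero_right add_0_left)
    thus "poly ?r (gauss_node N i) * gauss_weight N i = gauss_weight N i * poly p (gauss_node N i)" by simp
  qed simp
  finally show ?thesis by simp
qed

text \<open>The square of a Lagrange basis polynomial has degree at most \<open>2 * N - 2\<close>,
  so its positive integral is computed exactly and collapses to the single weight.\<close>

lemma gauss_weight_pos:
  assumes i: "i \<in> {1..N}" shows "gauss_weight N i > 0"
proof -
  let ?l = "glag N i"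
  have "degree (?l * ?l) < 2 * N" using degree_mult_le[of ?l ?l] degree_glag[OF i] by simp
  hence "pI (?l * ?l) = (\<Sum>j=1..N. gauss_weight N j * poly (?l * ?l) (gauss_node N j))"
    by (rule gauss_exact)
  also have "\<dots> = (\<Sum>j=1..N. if j = i then gauss_weight N i else 0)"
    using i by (intro sum.cong) (auto simp: glag_node)
  finally have e: "pI (?l * ?l) = gauss_weight N i" using i by simp
  have "pI (?l * ?l) \<ge> 0" by (rule pI_nonneg) simp
  moreover have "?l \<noteq> 0" using glag_node[OF i i] by auto
  hence "pI (?l * ?l) \<noteq> 0" using pI_square_eq_0 by blast
  ultimately show ?thesis using e by simp
qed

lemma sum_gauss_weight: "N \<ge> 1 \<Longrightarrow> (\<Sum>i=1..N. gauss_weight N i) = 2"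
  using gauss_exact[of 1 N] pI_monom[of 0] by simp

section \<open>Integration of the interpolating polynomial and its adjoint\<close>

lemma integral_square_le:
  fixes g :: "real \<Rightarrow> real"
  assumes "a \<le> b" and g: "continuous_on {a..b} g"
  shows "(integral {a..b} g)\<^sup>2 \<le> (b - a) * integral {a..b} (\<lambda>x. (g x)\<^sup>2)"
proof (cases "a = b")
  case False
  hence ab: "b - a > 0" using assms by simp
  \<comment> \<open>The mean value of \<open>g\<close>: nonnegativity of the integral of
    \<open>(g x - c)\<^sup>2\<close> is Cauchy-Schwarz against the constant 1.\<close>
  define c where "c = integral {a..b} g / (b - a)"
  have i1: "g integrable_on {a..b}" "(\<lambda>x. (g x)\<^sup>2) integrable_on {a..b}"
    by (intro integrable_continuous_interval g continuous_intros)+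
  have "((\<lambda>x. (g x)\<^sup>2 - 2 * c * g x + c\<^sup>2) has_integral
      integral {a..b} (\<lambda>x. (g x)\<^sup>2) - 2 * c * integral {a..b} g + (b - a) * c\<^sup>2) {a..b}"
    using assms i1 has_integral_const_real[of "c\<^sup>2" a b]
    by (intro has_integral_add has_integral_diff has_integral_mult_right integrable_integral) auto
  moreover have "(g x)\<^sup>2 - 2 * c * g x + c\<^sup>2 = (g x - c)\<^sup>2" for x
    by (simp add: power2_diff)
  ultimately have "0 \<le> integral {a..b} (\<lambda>x. (g x)\<^sup>2) - 2 * c * integral {a..b} g + (b - a) * c\<^sup>2"
    by (simp add: has_integral_nonneg)
  hence "2 * c * integral {a..b} g - (b - a) * c\<^sup>2 \<le> integral {a..b} (\<lambda>x. (g x)\<^sup>2)" by simp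
  also have "2 * c * integral {a..b} g - (b - a) * c\<^sup>2 = (integral {a..b} g)\<^sup>2 / (b - a)"
  proof -
    have "(b - a) * c = integral {a..b} g" using ab by (simp add: c_def)
    hence "(b - a) * c\<^sup>2 = c * integral {a..b} g" by (simp add: power2_eq_square algebra_simps)
    thus ?thesis by (simp add: c_def power2_eq_square)
  qed
  finally show ?thesis using ab by (simp add: divide_le_eq mult.commute)
qed simp

text \<open>The values at the Gauss nodes form the Runge-Kutta matrix of Gauss collocation. It is
  the inverse of the block \<open>D_{1:N}\<close>, since a polynomial of degree at most
  \<open>N\<close> vanishing at -1 is recovered from its nodal derivatives.\<close>

definition gprim :: "nat \<Rightarrow> nat \<Rightarrow> real poly" where
  "gprim N i = poly_primitive (glag N i) - [:poly (poly_primitive (glag N i)) (-1):]"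

lemma pderiv_gprim [simp]: "pderiv (gprim N i) = glag N i"
  by (simp add: gprim_def pderiv_diff pderiv_pCons)

lemma gprim_left [simp]: "poly (gprim N i) (-1) = 0"
  by (simp add: gprim_def)

lemma gprim_right [simp]: "poly (gprim N i) 1 = gauss_weight N i"
  using pI_pderiv[of "gprim N i"] by (simp add: gauss_weight_eq)

lemma degree_gprim: "i \<in> {1..N} \<Longrightarrow> degree (gprim N i) \<le> N"
  unfolding gprim_def using degree_glag[of i N] degree_poly_primitive[of "glag N i"]
  by (intro degree_diff_le) auto

text \<open>The symplecticity condition of Gauss collocation. The product of
  \<open>gprim N i\<close> with \<open>gauss_weight N j - gprim N j\<close> vanishes at both ends,
  and its derivative has degree at most \<open>2 * N - 1\<close>, the largest for which the
  quadrature is exact.\<close>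

lemma gprim_adjoint:
  assumes i: "i \<in> {1..N}" and j: "j \<in> {1..N}"
  shows "gauss_weight N j * poly (gprim N i) (gauss_node N j) =
    gauss_weight N i * (gauss_weight N j - poly (gprim N j) (gauss_node N i))"
proof -
  let ?c = "[:gauss_weight N j:]"
  let ?q = "glag N i * (?c - gprim N j) - gprim N i * glag N j"
  have "?q = pderiv (gprim N i * (?c - gprim N j))"
    by (simp add: pderiv_mult pderiv_diff pderiv_pCons pderiv_smult algebra_simps)
  hence "pI ?q = 0" by (simp only: pI_pderiv) simp
  moreover have "degree ?q < 2 * N"
  proof -
    have "degree (glag N i * (?c - gprim N j)) \<le> degree (glag N i) + degree (?c - gprim N j)"
         "degree (gprim N i * glag N j) \<le> degree (gprim N i) + degree (glag N j)"
      by (rule degree_mult_le)+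
    moreover have "degree (?c - gprim N j) \<le> N"
      by (intro degree_diff_le degree_gprim[OF j]) auto
    ultimately show ?thesis
      using degree_glag[OF i] degree_glag[OF j] degree_gprim[OF i] by (intro degree_diff_less) auto
  qed
  hence "pI ?q = (\<Sum>k=1..N. gauss_weight N k * poly ?q (gauss_node N k))" by (rule gauss_exact)
  also have "\<dots> = (\<Sum>k=1..N. gauss_weight N k * poly (glag N i) (gauss_node N k) * poly (?c - gprim N j) (gauss_node N k))
      - (\<Sum>k=1..N. gauss_weight N k * poly (glag N j) (gauss_node N k) * poly (gprim N i) (gauss_node N k))"
    by (simp add: sum_subtractf[symmetric] algebra_simps)
  also have "(\<Sum>k=1..N. gauss_weight N k * poly (glag N i) (gauss_node N k) * poly (?c - gprim N j) (gauss_node N k))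
    = (\<Sum>k=1..N. if k = i then gauss_weight N i * poly (?c - gprim N j) (gauss_node N i) else 0)"
    using i by (intro sum.cong) (auto simp: glag_node)
  also have "\<dots> = gauss_weight N i * poly (?c - gprim N j) (gauss_node N i)" using i by simp
  also have "(\<Sum>k=1..N. gauss_weight N k * poly (glag N j) (gauss_node N k) * poly (gprim N i) (gauss_node N k))
    = (\<Sum>k=1..N. if k = j then gauss_weight N j * poly (gprim N i) (gauss_node N j) else 0)"
    using j by (intro sum.cong) (auto simp: glag_node)
  also have "\<dots> = gauss_weight N j * poly (gprim N i) (gauss_node N j)" using j by simp
  finally show ?thesis using \<open>pI ?q = 0\<close> by simp
qed

lemma poly_eq_gprim:
  assumes "degree p \<le> N" "N \<ge> 1"
  shows "poly p t = poly p (-1) + (\<Sum>i=1..N. poly (gprim N i) t * poly (pderiv p) (gauss_node N i))"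
proof -
  let ?q = "p - (\<Sum>i=1..N. smult (poly (pderiv p) (gauss_node N i)) (gprim N i))"
  have "degree (pderiv p) < N" using assms by (simp add: degree_pderiv)
  hence "pderiv ?q = 0"
    using glag_interpolation[of "pderiv p" N] by (simp add: pderiv_diff pderiv_sum_real pderiv_smult)
  then obtain c where c: "?q = [:c:]" using pderiv_iszero by blast
  have "poly ?q t = poly ?q (-1)" unfolding c by simp
  thus ?thesis by (simp add: poly_sum algebra_simps)
qed

lemma integral_poly_gprim:
  assumes "degree p < N" "-1 \<le> t"
  shows "integral {-1..t} (poly p) = (\<Sum>i=1..N. poly (gprim N i) t * poly p (gauss_node N i))"
proof -
  have "degree (poly_primitive p) \<le> N" "N \<ge> 1" using assms degree_poly_primitive[of p] by auto
  from poly_eq_gprim[OF this, of t] show ?thesis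
    using integral_unique[OF has_integral_poly[OF assms(2), of p]] by simp
qed

lemma integral_square_mono_ends:
  assumes "-1 \<le> a" "a \<le> b" "b \<le> (1::real)" "continuous_on {-1..1} g"
  shows "integral {a..b} (\<lambda>x. (g x)\<^sup>2) \<le> integral {-1..1} (\<lambda>x. (g x :: real)\<^sup>2)"
  using assms
  by (intro integral_subset_le integrable_continuous_interval continuous_intros)
     (auto intro: continuous_on_subset)

text \<open>The sum is the integral over \<open>{s..t}\<close> of the polynomial through the values
  \<open>c\<close>. Cauchy-Schwarz costs the length, at most 2, and the squared polynomial has
  degree below \<open>2 * N\<close>, so its integral is the weighted sum. Two free endpoints serve
  integration from the left (\<open>s = -1\<close>) and from the right (\<open>t = 1\<close>) at
  once.\<close>

lemma gprim_diff_bound_real: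
  fixes c :: "nat \<Rightarrow> real"
  assumes st: "-1 \<le> s" "s \<le> t" "t \<le> 1" and N: "N \<ge> 1"
  shows "(\<Sum>i=1..N. (poly (gprim N i) t - poly (gprim N i) s) * c i)\<^sup>2 \<le> 2 * (\<Sum>i=1..N. gauss_weight N i * (c i)\<^sup>2)"
proof -
  define p where "p = (\<Sum>i=1..N. smult (c i) (glag N i))"
  have dp: "degree p < N" unfolding p_def using N by (intro degree_sum_less) (auto simp: degree_glag)
  have pj: "poly p (gauss_node N j) = c j" if j: "j \<in> {1..N}" for j
  proof -
    have "poly p (gauss_node N j) = (\<Sum>i=1..N. if i = j then c j else 0)"
      unfolding p_def poly_sum by (rule sum.cong) (use j in \<open>auto simp: glag_node\<close>)
    thus ?thesis using j by simp
  qed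
  have "integral {-1..s} (poly p) + integral {s..t} (poly p) = integral {-1..t} (poly p)"
    by (rule Henstock_Kurzweil_Integration.integral_combine[OF st(1,2) poly_integrable])
  hence "integral {s..t} (poly p) = (\<Sum>i=1..N. (poly (gprim N i) t - poly (gprim N i) s) * c i)"
    using st pj by (simp add: integral_poly_gprim[OF dp] left_diff_distrib sum_subtractf)
  hence "(\<Sum>i=1..N. (poly (gprim N i) t - poly (gprim N i) s) * c i)\<^sup>2 = (integral {s..t} (poly p))\<^sup>2" by simp
  also have "\<dots> \<le> (t - s) * integral {s..t} (\<lambda>x. (poly p x)\<^sup>2)"
    using st by (intro integral_square_le continuous_intros)
  also have "\<dots> \<le> 2 * integral {-1..1} (\<lambda>x. (poly p x)\<^sup>2)"
    using st by (intro mult_mono integral_square_mono_ends continuous_intros integral_nonneg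
        integrable_continuous_interval) auto
  also have "integral {-1..1} (\<lambda>x. (poly p x)\<^sup>2) = pI (p * p)"
    unfolding pI_def by (intro integral_cong) (simp add: power2_eq_square)
  also have "\<dots> = (\<Sum>i=1..N. gauss_weight N i * (c i)\<^sup>2)"
    using degree_mult_le[of p p] dp pj by (subst gauss_exact[where N=N]) (auto simp: power2_eq_square)
  finally show ?thesis .
qed

lemma gprim_diff_bound:
  fixes a :: "nat \<Rightarrow> 'a::real_inner"
  assumes st: "-1 \<le> s" "s \<le> t" "t \<le> 1" and N: "N \<ge> 1"
  shows "norm (\<Sum>i=1..N. (poly (gprim N i) t - poly (gprim N i) s) *\<^sub>R a i)
    \<le> sqrt 2 * sqrt (\<Sum>i=1..N. gauss_weight N i * (norm (a i))\<^sup>2)"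
proof -
  let ?v = "\<Sum>i=1..N. (poly (gprim N i) t - poly (gprim N i) s) *\<^sub>R a i"
  \<comment> \<open>Pairing with the unit vector along the sum reduces the vector bound to the
    scalar one without a factor depending on the dimension.\<close>
  define e where "e = sgn ?v"
  have ne: "norm e \<le> 1" by (simp add: e_def norm_sgn)
  have "norm ?v = e \<bullet> ?v"
    by (cases "?v = 0") (simp_all add: e_def sgn_div_norm dot_square_norm power2_eq_square)
  also have "\<dots> = (\<Sum>i=1..N. (poly (gprim N i) t - poly (gprim N i) s) * (e \<bullet> a i))"
    by (simp add: inner_sum_right)
  finally have "(norm ?v)\<^sup>2 \<le> 2 * (\<Sum>i=1..N. gauss_weight N i * (e \<bullet> a i)\<^sup>2)"
    using gprim_diff_bound_real[OF assms] by simp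
  also have "\<dots> \<le> 2 * (\<Sum>i=1..N. gauss_weight N i * (norm (a i))\<^sup>2)"
  proof (rule mult_left_mono[OF sum_mono])
    fix i assume i: "i \<in> {1..N}"
    have "\<bar>e \<bullet> a i\<bar> \<le> norm e * norm (a i)" by (rule Cauchy_Schwarz_ineq2)
    also have "\<dots> \<le> norm (a i)" using ne by (simp add: mult_left_le_one_le)
    finally have "(e \<bullet> a i)\<^sup>2 \<le> (norm (a i))\<^sup>2" using abs_le_square_iff[of "e \<bullet> a i" "norm (a i)"] by simp
    thus "gauss_weight N i * (e \<bullet> a i)\<^sup>2 \<le> gauss_weight N i * (norm (a i))\<^sup>2"
      using gauss_weight_pos[OF i] by (simp add: mult_left_mono)
  qed simp
  finally show ?thesis by (simp add: real_le_rsqrt flip: real_sqrt_mult)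
qed

subsection \<open>Polynomial approximation\<close>

definition Lop :: "real poly \<Rightarrow> real poly" where
  "Lop p = - pderiv ([:1, 0, -1:] * pderiv p)"

lemma coeff_Lop: "coeff (Lop p) j = real j * (real j + 1) * coeff p j - (real j + 1) * (real j + 2) * coeff p (Suc (Suc j))"
proof -
  have e: "[:1, 0, -1:] * q = q - pCons 0 (pCons 0 q)" for q :: "real poly" by simp
  have "coeff (pCons 0 (pCons 0 (pderiv p))) (Suc j) = real j * coeff p j"
    by (cases j) (auto simp: coeff_pderiv)
  thus ?thesis
    unfolding Lop_def e by (simp add: coeff_pderiv pderiv_diff del: coeff_pCons_Suc) (simp add: algebra_simps)
qed

lemma degree_Lop: "degree (Lop p) \<le> degree p"
  by (rule degree_le) (simp add: coeff_Lop coeff_eq_0)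

text \<open>The weight \<open>1 - x\<^sup>2\<close> vanishes at both endpoints, so integration by
  parts leaves no boundary term.\<close>

lemma Lop_green: "pI (q * Lop p) = pI ([:1, 0, -1:] * pderiv p * pderiv q)"
proof -
  have "[:1, 0, -1:] * pderiv p * pderiv q - q * Lop p = pderiv (q * ([:1, 0, -1:] * pderiv p))"
    unfolding Lop_def pderiv_mult[of q] by (simp only: mult_minus_right minus_minus diff_minus_eq_add mult_ac add.commute)
  hence "pI ([:1, 0, -1:] * pderiv p * pderiv q) - pI (q * Lop p) = 0"
    by (simp only: pI_diff[symmetric] pI_pderiv) simp
  thus ?thesis by simp
qed

lemma Lop_symmetric: "pI (q * Lop p) = pI (p * Lop q)"
  unfolding Lop_green by (simp only: mult_ac)

lemma Lop_smult: "Lop (smult c p) = smult c (Lop p)"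
  by (rule poly_eqI) (simp add: coeff_Lop algebra_simps)
lemma Lop_sum: "Lop (\<Sum>i\<in>A. f i) = (\<Sum>i\<in>A. Lop (f i))"
  by (rule poly_eqI) (simp add: coeff_Lop coeff_sum sum_distrib_left sum_subtractf)

text \<open>Legendre's equation: the difference of both sides has degree below \<open>k\<close>, and by the symmetry of
  \<^const>\<open>Lop\<close> it is orthogonal to itself.\<close>

lemma Lop_legendre: "Lop (legendre k) = smult (real k * (real k + 1)) (legendre k)"
proof (rule ccontr)
  assume ne: "\<not> ?thesis"
  define s where "s = Lop (legendre k) - smult (real k * (real k + 1)) (legendre k)"
  have s0: "s \<noteq> 0" using ne by (simp add: s_def)
  have c: "coeff s j = 0" if "j \<ge> k" for j
    using that by (cases "j = k") (auto simp: s_def coeff_Lop coeff_eq_0)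
  hence ds: "degree s < k" using s0 by (metis leading_coeff_0_iff not_le)
  have "pI (s * s) = pI (s * Lop (legendre k)) - real k * (real k + 1) * pI (s * legendre k)"
    by (subst (2) s_def) (simp only: right_diff_distrib mult_smult_right pI_diff pI_smult)
  also have "pI (s * Lop (legendre k)) = pI (Lop s * legendre k)"
    by (subst Lop_symmetric) (simp only: mult.commute)
  also have "\<dots> = 0" using ds degree_Lop[of s] by (intro legendre_orthogonal) auto
  also have "pI (s * legendre k) = 0" by (rule legendre_orthogonal[OF ds])
  finally show False using pI_square_eq_0 s0 by auto
qed

lemma legendre_expansion:
  "degree p \<le> M \<Longrightarrow> \<exists>c. p = (\<Sum>k\<le>M. smult (c k) (legendre k))"
proof (induction M arbitrary: p)
  case 0
  then obtain a where "p = [:a:]" using degree_eq_zeroE by blast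
  thus ?case by (intro exI[of _ "\<lambda>_. a"]) simp
next
  case (Suc M)
  let ?P = "legendre (Suc M)"
  define a where "a = coeff p (Suc M) / coeff ?P (Suc M)"
  have "coeff ?P (Suc M) \<noteq> 0" using legendre_neq_0[of "Suc M"] degree_legendre[of "Suc M"]
    by (metis leading_coeff_0_iff)
  hence "coeff (p - smult a ?P) j = 0" if "j > M" for j
    using that Suc.prems by (cases "j = Suc M") (auto simp: a_def coeff_eq_0 simp del: legendre.simps)
  hence "degree (p - smult a ?P) \<le> M" by (intro degree_le) auto
  then obtain c where c: "p - smult a ?P = (\<Sum>k\<le>M. smult (c k) (legendre k))" using Suc.IH by blast
  have "p = (\<Sum>k\<le>M. smult (c k) (legendre k)) + smult a ?P" unfolding c[symmetric] by simp
  also have "\<dots> = (\<Sum>k\<le>Suc M. smult ((c(Suc M := a)) k) (legendre k))"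
    by (simp del: legendre.simps)
  finally show ?case by blast
qed

lemma pI_legendre_product:
  "pI ((\<Sum>k\<le>M. smult (a k) (legendre k)) * (\<Sum>k\<le>M. smult (b k) (legendre k)))
   = (\<Sum>k\<le>M. a k * b k * pI (legendre k * legendre k))"
proof -
  have o: "pI (legendre i * legendre j) = (if i = j then pI (legendre i * legendre i) else 0)" for i j
    using legendre_orthogonal[of "legendre i" j] legendre_orthogonal[of "legendre j" i]
    by (cases i j rule: linorder_cases) (auto simp: mult.commute)
  have "pI ((\<Sum>k\<le>M. smult (a k) (legendre k)) * (\<Sum>k\<le>M. smult (b k) (legendre k)))
     = (\<Sum>i\<le>M. \<Sum>j\<le>M. a i * b j * pI (legendre i * legendre j))"
    by (simp only: sum_product pI_sum mult_smult_left mult_smult_right smult_smult pI_smult)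
       (simp only: mult_ac)
  also have "\<dots> = (\<Sum>i\<le>M. \<Sum>j\<le>M. if i = j then a i * b i * pI (legendre i * legendre i) else 0)"
    by (intro sum.cong refl) (subst o, simp)
  finally show ?thesis by simp
qed

text \<open>\<open>q\<close> is the truncated Legendre expansion. The discarded modes have
  eigenvalue \<open>k * (k + 1)\<close> above \<open>(real N)\<^sup>2\<close>, so by Parseval the
  tail times this factor is at most \<open>pI (p * Lop p)\<close>; there the weight
  \<open>1 - x\<^sup>2\<close> is at most 1.\<close>

lemma legendre_projection_bound:
  "\<exists>q. degree q \<le> N \<and> (real N)\<^sup>2 * pI ((p - q) * (p - q)) \<le> pI (pderiv p * pderiv p)"
proof -
  define M where "M = max N (degree p)"
  define h where "h k = pI (legendre k * legendre k)" for k
  have h: "h k \<ge> 0" for k unfolding h_def by (rule pI_nonneg) simp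
  obtain c where c: "p = (\<Sum>k\<le>M. smult (c k) (legendre k))"
    using legendre_expansion[of p M] by (auto simp: M_def)
  define q where "q = (\<Sum>k\<le>M. smult (if k \<le> N then c k else 0) (legendre k))"
  have "degree q \<le> N" unfolding q_def by (rule degree_sum_le) auto
  have pq: "p - q = (\<Sum>k\<le>M. smult (if k \<le> N then 0 else c k) (legendre k))"
    unfolding c q_def sum_subtractf[symmetric] by (intro sum.cong) auto
  have "(real N)\<^sup>2 * pI ((p - q) * (p - q)) = (\<Sum>k\<le>M. (real N)\<^sup>2 * ((if k \<le> N then 0 else c k) * (if k \<le> N then 0 else c k) * h k))"
    unfolding pq unfolding pI_legendre_product unfolding h_def sum_distrib_left ..
  also have "\<dots> \<le> (\<Sum>k\<le>M. c k * (c k * (real k * (real k + 1))) * h k)"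
  proof (rule sum_mono)
    fix k
    have "(real N)\<^sup>2 * ((c k * c k) * h k) \<le> (real k * (real k + 1)) * ((c k * c k) * h k)" if "N < k"
      using that h[of k] by (intro mult_right_mono) (auto simp: power2_eq_square intro!: mult_mono)
    moreover have "0 \<le> (c k * c k) * (real k * (real k + 1)) * h k" using h[of k] by simp
    ultimately show "(real N)\<^sup>2 * ((if k \<le> N then 0 else c k) * (if k \<le> N then 0 else c k) * h k)
        \<le> c k * (c k * (real k * (real k + 1))) * h k"
      by (cases "k \<le> N") (auto simp: mult_ac)
  qed
  also have "\<dots> = pI (p * Lop p)"
  proof -
    have "Lop p = (\<Sum>k\<le>M. smult (c k * (real k * (real k + 1))) (legendre k))"
      unfolding c Lop_sum by (simp add: Lop_smult Lop_legendre)
    thus ?thesis unfolding h_def using pI_legendre_product[of c M "\<lambda>k. c k * (real k * (real k + 1))"] c by simp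
  qed
  also have "\<dots> = pI ([:1, 0, -1:] * pderiv p * pderiv p)" by (rule Lop_green)
  also have "\<dots> \<le> pI (pderiv p * pderiv p)"
  proof -
    have "0 \<le> pI (pderiv p * pderiv p - [:1, 0, -1:] * pderiv p * pderiv p)"
    proof (rule pI_nonneg)
      fix x :: real
      have "poly (pderiv p * pderiv p - [:1, 0, -1:] * pderiv p * pderiv p) x = (x * poly (pderiv p) x)\<^sup>2"
        by (simp add: power2_eq_square algebra_simps)
      thus "0 \<le> poly (pderiv p * pderiv p - [:1, 0, -1:] * pderiv p * pderiv p) x" by simp
    qed
    thus ?thesis by (simp only: pI_diff)
  qed
  finally show ?thesis using \<open>degree q \<le> N\<close> by blast
qed

section \<open>Approximation rates for smooth functions and the collocation defect\<close>

lemma Weierstrass_poly: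
  fixes g :: "real \<Rightarrow> real"
  assumes "continuous_on {-1..1} g" "e > 0"
  shows "\<exists>p. \<forall>x\<in>{-1..1}. \<bar>g x - poly p x\<bar> < e"
proof -
  obtain h where h: "real_polynomial_function h" "\<And>x. x \<in> {-1..1} \<Longrightarrow> \<bar>g x - h x\<bar> < e"
    using Stone_Weierstrass_real_polynomial_function[of "{-1..1}" g e] assms by auto
  obtain a n where a: "h = (\<lambda>x. \<Sum>i\<le>n. a i * x ^ i)"
    using h(1) by (auto simp: real_polynomial_function_iff_sum)
  have "h x = poly (\<Sum>i\<le>n. monom (a i) i) x" for x by (simp add: a poly_sum poly_monom)
  thus ?thesis using h(2) by metis
qed

lemma integral_square_add_le:
  fixes f g h :: "real \<Rightarrow> real"
  assumes "continuous_on {-1..1} f" "continuous_on {-1..1} g" "\<And>x. x \<in> {-1..1} \<Longrightarrow> \<bar>f x - g x\<bar> \<le> e"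
  shows "integral {-1..1} (\<lambda>x. (f x)\<^sup>2) \<le> 2 * integral {-1..1} (\<lambda>x. (g x)\<^sup>2) + 4 * e\<^sup>2"
proof -
  have i: "(\<lambda>x. (f x)\<^sup>2) integrable_on {-1..1}" "(\<lambda>x. (g x)\<^sup>2) integrable_on {-1..1}"
    by (intro integrable_continuous_interval assms continuous_intros)+
  have "((\<lambda>x. 2 * (g x)\<^sup>2 + 2 * e\<^sup>2) has_integral 2 * integral {-1..1} (\<lambda>x. (g x)\<^sup>2) + 4 * e\<^sup>2) {-1..1}"
    using i(2) has_integral_const_real[of "2 * e\<^sup>2" "-1" 1]
    by (intro has_integral_add has_integral_mult_right integrable_integral) auto
  moreover have "(f x)\<^sup>2 \<le> 2 * (g x)\<^sup>2 + 2 * e\<^sup>2" if "x \<in> {-1..1}" for x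
  proof -
    have "(f x - g x)\<^sup>2 \<le> e\<^sup>2" using assms(3)[OF that] by (metis abs_ge_zero power2_abs power_mono)
    moreover have "(f x)\<^sup>2 \<le> 2 * (g x)\<^sup>2 + 2 * (f x - g x)\<^sup>2"
      using zero_le_power2[of "f x - 2 * g x"] by (simp add: power2_eq_square algebra_simps)
    ultimately show ?thesis by linarith
  qed
  ultimately show ?thesis using has_integral_le[OF integrable_integral[OF i(1)]] by blast
qed

lemma abs_diff_le_of_deriv:
  fixes g g' :: "real \<Rightarrow> real"
  assumes g: "\<And>t. t \<in> {-1..1} \<Longrightarrow> (g has_vector_derivative g' t) (at t within {-1..1})"
    and t: "t \<in> {-1..1}"
  shows "(g' has_integral g t - g (-1)) {-1..t}"
  using t by (intro fundamental_theorem_of_calculus) (auto intro!: has_vector_derivative_within_subset[OF g])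

text \<open>The projection bound is available for polynomials only, hence \<open>g'\<close> is first
  replaced by a Weierstrass approximation and integrated from -1. The free summand \<delta> pays for
  the replacement and can later be taken of the order of the main term.\<close>

lemma L2_approx:
  fixes g g' :: "real \<Rightarrow> real"
  assumes g: "\<And>t. t \<in> {-1..1} \<Longrightarrow> (g has_vector_derivative g' t) (at t within {-1..1})"
    and g': "continuous_on {-1..1} g'" and N: "N \<ge> 1" and \<delta>: "\<delta> > 0"
  shows "\<exists>q. degree q \<le> N \<and> integral {-1..1} (\<lambda>x. (g x - poly q x)\<^sup>2)
     \<le> 4 / (real N)\<^sup>2 * integral {-1..1} (\<lambda>x. (g' x)\<^sup>2) + \<delta>"
proof -
  \<comment> \<open>24 = 8 + 16: replacing \<open>g'\<close> by \<open>h\<close> contributes at most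
    \<open>8 * e\<^sup>2\<close>, and replacing \<open>g\<close> by \<open>p\<close>, which is
    within \<open>2 * e\<close> of it, contributes \<open>16 * e\<^sup>2\<close>.\<close>
  define e where "e = sqrt (\<delta> / 24)"
  have e: "e > 0" "e\<^sup>2 = \<delta> / 24" using \<delta> by (auto simp: e_def)
  obtain h where h: "\<And>x. x \<in> {-1..1} \<Longrightarrow> \<bar>g' x - poly h x\<bar> < e" using Weierstrass_poly[OF g' e(1)] by blast
  define p where "p = poly_primitive h + [:g (-1) - poly (poly_primitive h) (-1):]"
  have pp: "pderiv p = h" "poly p (-1) = g (-1)" by (auto simp: p_def pderiv_add pderiv_pCons)
  have gp: "\<bar>g x - poly p x\<bar> \<le> 2 * e" if x: "x \<in> {-1..1}" for x
  proof -
    have "((\<lambda>t. g' t - poly h t) has_integral (g x - g (-1)) - (poly p x - poly p (-1))) {-1..x}"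
      using x poly_FTC[of "-1" x p] unfolding pp
      by (intro has_integral_diff abs_diff_le_of_deriv[OF g x]) (auto simp: pp)
    from has_integral_bound_real[OF _ _ this, of e "{}"]
    have "norm ((g x - g (-1)) - (poly p x - poly p (-1))) \<le> e * (x + 1)"
      using e(1) x less_imp_le[OF h] by auto
    also have "\<dots> \<le> e * 2" using x e(1) by (intro mult_left_mono) auto
    finally show ?thesis by (simp add: pp)
  qed
  obtain q where q: "degree q \<le> N" "(real N)\<^sup>2 * pI ((p - q) * (p - q)) \<le> pI (h * h)"
    using legendre_projection_bound[of N p] pp by auto
  have cg: "continuous_on {-1..1} g"
    using g by (rule continuous_on_vector_derivative)
  have "integral {-1..1} (\<lambda>x. (g x - poly q x)\<^sup>2)
      \<le> 2 * integral {-1..1} (\<lambda>x. (poly p x - poly q x)\<^sup>2) + 4 * (2 * e)\<^sup>2"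
    by (intro integral_square_add_le continuous_intros cg) (use gp in auto)
  also have "integral {-1..1} (\<lambda>x. (poly p x - poly q x)\<^sup>2) = pI ((p - q) * (p - q))"
    unfolding pI_def by (intro integral_cong) (simp add: power2_eq_square)
  also have "\<dots> \<le> pI (h * h) / (real N)\<^sup>2" using q(2) N by (simp add: pos_le_divide_eq mult.commute)
  also have "pI (h * h) = integral {-1..1} (\<lambda>x. (poly h x)\<^sup>2)"
    unfolding pI_def by (intro integral_cong) (simp add: power2_eq_square)
  also have "\<dots> \<le> 2 * integral {-1..1} (\<lambda>x. (g' x)\<^sup>2) + 4 * e\<^sup>2"
  proof (intro integral_square_add_le g' continuous_intros)
    fix x :: real assume "x \<in> {-1..1}"
    thus "\<bar>poly h x - g' x\<bar> \<le> e" using h[of x] by linarith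
  qed
  finally have "integral {-1..1} (\<lambda>x. (g x - poly q x)\<^sup>2)
     \<le> 2 * ((2 * integral {-1..1} (\<lambda>x. (g' x)\<^sup>2) + 4 * e\<^sup>2) / (real N)\<^sup>2) + 4 * (2 * e)\<^sup>2"
    by (simp add: divide_right_mono)
  also have "\<dots> = 4 / (real N)\<^sup>2 * integral {-1..1} (\<lambda>x. (g' x)\<^sup>2) + (8 * e\<^sup>2 / (real N)\<^sup>2 + 16 * e\<^sup>2)"
    by (simp add: add_divide_distrib power_mult_distrib)
  also have "8 * e\<^sup>2 / (real N)\<^sup>2 \<le> 8 * e\<^sup>2"
    using divide_left_mono[of 1 "(real N)\<^sup>2" "8 * e\<^sup>2"] N by (simp add: one_le_power)
  hence "8 * e\<^sup>2 / (real N)\<^sup>2 + 16 * e\<^sup>2 \<le> \<delta>" using e(2) by linarith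
  finally show ?thesis using q(1) by (intro exI[of _ q]) auto
qed

text \<open>Apply the first-order estimate to \<open>D 0\<close> minus the primitive of an approximation of \<open>D 1\<close>.\<close>

lemma L2_approx_iterated:
  fixes D :: "nat \<Rightarrow> real \<Rightarrow> real"
  assumes "\<And>j t. j < k \<Longrightarrow> t \<in> {-1..1} \<Longrightarrow> (D j has_vector_derivative D (Suc j) t) (at t within {-1..1})"
    and "continuous_on {-1..1} (D k)"
  shows "\<exists>c\<ge>0. \<forall>N\<ge>Suc k. \<exists>q. degree q \<le> N \<and> integral {-1..1} (\<lambda>x. (D 0 x - poly q x)\<^sup>2) \<le> c / real N ^ (2 * k)"
  using assms
proof (induction k arbitrary: D)
  case 0
  have "integral {-1..1} (\<lambda>x. (D 0 x)\<^sup>2) \<ge> 0"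
    by (intro integral_nonneg integrable_continuous_interval continuous_intros) (use 0 in auto)
  thus ?case by (intro exI[of _ "integral {-1..1} (\<lambda>x. (D 0 x)\<^sup>2)"] conjI allI impI exI[of _ 0]) auto
next
  case (Suc k)
  obtain c where c: "c \<ge> 0" "\<And>N. N \<ge> Suc k \<Longrightarrow> \<exists>q. degree q \<le> N \<and>
      integral {-1..1} (\<lambda>x. (D 1 x - poly q x)\<^sup>2) \<le> c / real N ^ (2 * k)"
    using Suc.IH[of "\<lambda>j. D (Suc j)"] Suc.prems by auto
  have d1: "(D 0 has_vector_derivative D 1 t) (at t within {-1..1})" if "t \<in> {-1..1}" for t
    using Suc.prems(1)[of 0 t] that by simp
  have c1: "continuous_on {-1..1} (D 1)"
  proof (cases "k = 0")
    case True thus ?thesis using Suc.prems(2) by simp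
  next
    case False
    thus ?thesis using Suc.prems(1)[of 1] by (intro continuous_on_vector_derivative[of _ _ "D 2"]) (auto simp: numeral_2_eq_2)
  qed
  show ?case
  \<comment> \<open>The factor 4 comes from the first-order estimate, \<open>4 ^ k\<close> from
    \<open>real (N - 1) \<ge> real N / 2\<close>, and the summand 1 from the free error of
    \<open>L2_approx\<close>. The approximant of \<open>D 1\<close> gets degree \<open>N - 1\<close>
    because its primitive gains one.\<close>
  proof (intro exI[of _ "4 * 4 ^ k * c + 1"] conjI allI impI)
    fix N assume N: "N \<ge> Suc (Suc k)"
    have "Suc k \<le> N - 1" using N by simp
    from c(2)[OF this] obtain r where r: "degree r \<le> N - 1" "integral {-1..1} (\<lambda>x. (D 1 x - poly r x)\<^sup>2) \<le> c / real (N - 1) ^ (2 * k)"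
      by blast
    let ?R = "poly_primitive r"
    have dR: "degree ?R \<le> N" using degree_poly_primitive[of r] r(1) N by linarith
    have dG: "((\<lambda>x. D 0 x - poly ?R x) has_vector_derivative D 1 t - poly r t) (at t within {-1..1})" if "t \<in> {-1..1}" for t
    proof -
      have "(poly ?R has_real_derivative poly r t) (at t within {-1..1})"
        using poly_DERIV[of ?R t] by (auto intro: DERIV_subset)
      thus ?thesis using d1[OF that]
        by (intro has_vector_derivative_diff) (auto simp: has_real_derivative_iff_has_vector_derivative)
    qed
    have "continuous_on {-1..1} (\<lambda>x. D 1 x - poly r x)" by (intro continuous_intros c1)
    from L2_approx[OF dG this, of N "1 / real N ^ (2 * Suc k)"] N
    obtain q where q: "degree q \<le> N" "integral {-1..1} (\<lambda>x. (D 0 x - poly ?R x - poly q x)\<^sup>2)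
     \<le> 4 / (real N)\<^sup>2 * integral {-1..1} (\<lambda>x. (D 1 x - poly r x)\<^sup>2) + 1 / real N ^ (2 * Suc k)" by auto
    have "c / real (N - 1) ^ (2 * k) \<le> c / (real N / 2) ^ (2 * k)"
      using N c(1) by (intro divide_left_mono power_mono) auto
    also have "\<dots> = c * 4 ^ k / real N ^ (2 * k)" by (simp add: power_divide power_mult)
    finally have "4 / (real N)\<^sup>2 * integral {-1..1} (\<lambda>x. (D 1 x - poly r x)\<^sup>2) \<le> 4 / (real N)\<^sup>2 * (c * 4 ^ k / real N ^ (2 * k))"
      using r(2) by (intro mult_left_mono) auto
    also have "\<dots> = 4 * 4 ^ k * c / real N ^ (2 * Suc k)" by (simp add: power2_eq_square mult_ac)
    finally have "integral {-1..1} (\<lambda>x. (D 0 x - poly ?R x - poly q x)\<^sup>2) \<le> (4 * 4 ^ k * c + 1) / real N ^ (2 * Suc k)"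
      using q(2) by (simp add: add_divide_distrib)
    moreover have "degree (?R + q) \<le> N" using dR q(1) by (rule degree_add_le)
    ultimately show "\<exists>q. degree q \<le> N \<and> integral {-1..1} (\<lambda>x. (D 0 x - poly q x)\<^sup>2) \<le> (4 * 4 ^ k * c + 1) / real N ^ (2 * Suc k)"
      by (intro exI[of _ "?R + q"]) (simp add: diff_diff_eq)
  qed (use c(1) in simp)
qed

text \<open>Integrating an L2 approximant of \<open>D 1\<close> and applying Cauchy-Schwarz on
  \<open>{-1..t}\<close> gives a sup bound at the price of one derivative: \<open>k + 1\<close>
  derivatives yield the rate \<open>k\<close>.\<close>

lemma sup_approx:
  fixes D :: "nat \<Rightarrow> real \<Rightarrow> real"
  assumes D: "\<And>j t. j < Suc k \<Longrightarrow> t \<in> {-1..1} \<Longrightarrow> (D j has_vector_derivative D (Suc j) t) (at t within {-1..1})"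
    and cD: "continuous_on {-1..1} (D (Suc k))"
  shows "\<exists>c\<ge>0. \<forall>N\<ge>Suc k. \<exists>q. degree q \<le> Suc N \<and> (\<forall>t\<in>{-1..1}. \<bar>D 0 t - poly q t\<bar> \<le> c / real N ^ k)"
proof -
  obtain c where c: "c \<ge> 0" "\<And>N. N \<ge> Suc k \<Longrightarrow> \<exists>q. degree q \<le> N \<and>
      integral {-1..1} (\<lambda>x. (D 1 x - poly q x)\<^sup>2) \<le> c / real N ^ (2 * k)"
    using L2_approx_iterated[of k "\<lambda>j. D (Suc j)"] assms by auto
  have d1: "(D 0 has_vector_derivative D 1 t) (at t within {-1..1})" if "t \<in> {-1..1}" for t
    using D[of 0 t] that by simp
  have c1: "continuous_on {-1..1} (D 1)"
  proof (cases "k = 0")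
    case True thus ?thesis using cD by simp
  next
    case False
    thus ?thesis using D[of 1] by (intro continuous_on_vector_derivative[of _ _ "D 2"]) (auto simp: numeral_2_eq_2)
  qed
  show ?thesis
  proof (intro exI[of _ "sqrt (2 * c)"] conjI allI impI)
    fix N assume N: "N \<ge> Suc k"
    obtain r where r: "degree r \<le> N" "integral {-1..1} (\<lambda>x. (D 1 x - poly r x)\<^sup>2) \<le> c / real N ^ (2 * k)"
      using c(2)[OF N] by auto
    define q where "q = poly_primitive r + [:D 0 (-1) - poly (poly_primitive r) (-1):]"
    have qq: "pderiv q = r" "poly q (-1) = D 0 (-1)" by (auto simp: q_def pderiv_add pderiv_pCons)
    have "degree q \<le> Suc N" unfolding q_def
      using degree_poly_primitive[of r] r(1) by (intro degree_add_le) auto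
    moreover have "\<bar>D 0 t - poly q t\<bar> \<le> sqrt (2 * c) / real N ^ k" if t: "t \<in> {-1..1}" for t
    proof -
      have "((\<lambda>t. D 1 t - poly r t) has_integral (D 0 t - D 0 (-1)) - (poly q t - poly q (-1))) {-1..t}"
        using t poly_FTC[of "-1" t q] unfolding qq
        by (intro has_integral_diff abs_diff_le_of_deriv[OF d1 t]) (auto simp: qq)
      hence "D 0 t - poly q t = integral {-1..t} (\<lambda>t. D 1 t - poly r t)" by (simp add: qq integral_unique)
      hence "(D 0 t - poly q t)\<^sup>2 \<le> (t - (-1)) * integral {-1..t} (\<lambda>t. (D 1 t - poly r t)\<^sup>2)"
        using integral_square_le[of "-1" t "\<lambda>t. D 1 t - poly r t"] t c1
        by (simp add: continuous_on_diff continuous_on_poly continuous_on_subset)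
      also have "\<dots> \<le> 2 * integral {-1..1} (\<lambda>t. (D 1 t - poly r t)\<^sup>2)"
        using t by (intro mult_mono integral_square_mono_ends continuous_intros integral_nonneg
          integrable_continuous_interval c1 continuous_on_subset[OF c1]) auto
      also have "\<dots> \<le> 2 * (c / real N ^ (2 * k))" using r(2) by simp
      also have "\<dots> = (sqrt (2 * c) / real N ^ k)\<^sup>2"
        using c(1) by (simp add: power_divide power_mult[symmetric] mult.commute)
      finally show ?thesis using c(1) by (simp add: abs_le_square_iff[symmetric])
    qed
    ultimately show "\<exists>q. degree q \<le> Suc N \<and> (\<forall>t\<in>{-1..1}. \<bar>D 0 t - poly q t\<bar> \<le> sqrt (2 * c) / real N ^ k)" by blast
  qed (use c(1) in simp)
qed

text \<open>\<open>D 0\<close> is replaced by a polynomial of degree below \<open>N\<close>, for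
  which integration through \<open>gprim\<close> is exact. Its uniform error enters twice, in the
  integral and in the nodal values, and is amplified by at most 2 each time, independently of
  \<open>N\<close>; the sup norm of interpolation itself would grow with \<open>N\<close>.\<close>

lemma collocation_defect_real:
  fixes D :: "nat \<Rightarrow> real \<Rightarrow> real"
  assumes D: "\<And>j t. j < Suc k \<Longrightarrow> t \<in> {-1..1} \<Longrightarrow> (D j has_vector_derivative D (Suc j) t) (at t within {-1..1})"
    and cD: "continuous_on {-1..1} (D (Suc k))"
    and X: "\<And>t. t \<in> {-1..1} \<Longrightarrow> (X has_vector_derivative D 0 t) (at t within {-1..1})"
  shows "\<exists>c\<ge>0. \<forall>N\<ge>k + 4. \<forall>t\<in>{-1..1}.
     \<bar>X t - X (-1) - (\<Sum>i=1..N. poly (gprim N i) t * D 0 (gauss_node N i))\<bar> \<le> c / real N ^ k"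
proof -
  obtain c where c: "c \<ge> 0" "\<And>N. N \<ge> Suc k \<Longrightarrow> \<exists>q. degree q \<le> Suc N \<and> (\<forall>t\<in>{-1..1}. \<bar>D 0 t - poly q t\<bar> \<le> c / real N ^ k)"
    using sup_approx[of k D] assms by auto
  show ?thesis
  \<comment> \<open>\<open>2 ^ k\<close> comes from \<open>real (N - 2) \<ge> real N / 2\<close>.
    The index is \<open>N - 2\<close> because \<open>sup_approx\<close> yields a degree one higher,
    and interpolation needs degree below \<open>N\<close>.\<close>
  proof (intro exI[of _ "4 * (c * 2 ^ k)"] conjI allI impI ballI)
    fix N t assume N: "N \<ge> k + 4" and t: "t \<in> {-1..1::real}"
    have "N - 2 \<ge> Suc k" using N by simp
    from c(2)[OF this] obtain q where q: "degree q \<le> Suc (N - 2)" 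
      "\<And>t. t \<in> {-1..1} \<Longrightarrow> \<bar>D 0 t - poly q t\<bar> \<le> c / real (N - 2) ^ k" by blast
    define \<epsilon> where "\<epsilon> = c / real (N - 2) ^ k"
    have \<epsilon>0: "\<epsilon> \<ge> 0" using c(1) by (simp add: \<epsilon>_def)
    have dq: "degree q < N" using q(1) N by simp
    have "\<epsilon> \<le> c / (real N / 2) ^ k"
      unfolding \<epsilon>_def using N c(1) by (intro divide_left_mono power_mono) auto
    also have "\<dots> = c * 2 ^ k / real N ^ k" by (simp add: power_divide)
    finally have \<epsilon>: "\<epsilon> \<le> c * 2 ^ k / real N ^ k" .
    have "((\<lambda>s. D 0 s - poly q s) has_integral (X t - X (-1)) - integral {-1..t} (poly q)) {-1..t}"
      using t by (intro has_integral_diff abs_diff_le_of_deriv[OF X t] integrable_integral poly_integrable) auto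
    from has_integral_bound_real[OF _ _ this, of \<epsilon> "{}"]
    have "\<bar>(X t - X (-1)) - integral {-1..t} (poly q)\<bar> \<le> \<epsilon> * (t + 1)"
      using \<epsilon>0 t q(2) by (auto simp: \<epsilon>_def)
    also have "\<dots> \<le> \<epsilon> * 2" using t \<epsilon>0 by (intro mult_left_mono) auto
    finally have 1: "\<bar>(X t - X (-1)) - integral {-1..t} (poly q)\<bar> \<le> \<epsilon> * 2" .
    have iq: "integral {-1..t} (poly q) = (\<Sum>i=1..N. poly (gprim N i) t * poly q (gauss_node N i))"
      using t by (intro integral_poly_gprim dq) auto
    let ?d = "\<lambda>i. poly q (gauss_node N i) - D 0 (gauss_node N i)"
    have "norm (\<Sum>i=1..N. (poly (gprim N i) t - poly (gprim N i) (-1)) *\<^sub>R ?d i)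
       \<le> sqrt 2 * sqrt (\<Sum>i=1..N. gauss_weight N i * (norm (?d i))\<^sup>2)"
      using t N by (intro gprim_diff_bound) auto
    also have "\<dots> \<le> sqrt 2 * sqrt (\<Sum>i=1..N. gauss_weight N i * \<epsilon>\<^sup>2)"
    proof (rule mult_left_mono[OF real_sqrt_le_mono[OF sum_mono]])
      fix i assume i: "i \<in> {1..N}"
      have "norm (?d i) \<le> \<epsilon>"
        using q(2)[of "gauss_node N i"] gauss_node_bounds[OF i] by (simp add: \<epsilon>_def abs_minus_commute)
      thus "gauss_weight N i * (norm (?d i))\<^sup>2 \<le> gauss_weight N i * \<epsilon>\<^sup>2"
        using gauss_weight_pos[OF i] abs_le_square_iff[of "?d i" \<epsilon>] \<epsilon>0 by (simp add: mult_left_mono)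
    qed simp
    also have "(\<Sum>i=1..N. gauss_weight N i * \<epsilon>\<^sup>2) = 2 * \<epsilon>\<^sup>2"
      using sum_gauss_weight[of N] N by (simp flip: sum_distrib_right)
    also have "sqrt 2 * sqrt (2 * \<epsilon>\<^sup>2) = 2 * \<epsilon>" using \<epsilon>0 by (simp add: real_sqrt_mult)
    finally have "\<bar>(\<Sum>i=1..N. poly (gprim N i) t * ?d i)\<bar> \<le> 2 * \<epsilon>" by simp
    moreover have "(\<Sum>i=1..N. poly (gprim N i) t * ?d i)
       = integral {-1..t} (poly q) - (\<Sum>i=1..N. poly (gprim N i) t * D 0 (gauss_node N i))"
      unfolding iq by (simp add: right_diff_distrib sum_subtractf)
    ultimately have "\<bar>X t - X (-1) - (\<Sum>i=1..N. poly (gprim N i) t * D 0 (gauss_node N i))\<bar> \<le> 4 * \<epsilon>"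
      using 1 by linarith
    thus "\<bar>X t - X (-1) - (\<Sum>i=1..N. poly (gprim N i) t * D 0 (gauss_node N i))\<bar> \<le> 4 * (c * 2 ^ k) / real N ^ k"
      using \<epsilon> by simp
  qed (use c(1) in simp)
qed

text \<open>The scalar estimate is applied to each component with \<open>k = \<eta> - 1\<close>: the
  integrated function \<open>g\<close> is the first derivative of \<open>x\<close>, by uniqueness of
  derivatives, and so has \<eta> continuous derivatives.\<close>

lemma collocation_defect:
  fixes x :: "real \<Rightarrow> real^'n"
  assumes x: "Ck_on (\<eta> + 1) {-1..1} x" and \<eta>: "\<eta> \<ge> 1"
    and g: "\<And>t. t \<in> {-1..1} \<Longrightarrow> (x has_vector_derivative g t) (at t within {-1..1})"
  shows "\<exists>c\<ge>0. \<forall>N\<ge>\<eta> + 3. \<forall>t\<in>{-1..1}.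
     norm (x t - x (-1) - (\<Sum>i=1..N. poly (gprim N i) t *\<^sub>R g (gauss_node N i))) \<le> c / real N ^ (\<eta> - 1)"
proof -
  obtain D where D0: "\<And>t. t \<in> {-1..1} \<Longrightarrow> D 0 t = x t"
    and D: "\<And>j t. j < \<eta> + 1 \<Longrightarrow> t \<in> {-1..1} \<Longrightarrow> (D j has_vector_derivative D (Suc j) t) (at t within {-1..1})"
    and cD: "continuous_on {-1..1} (D (\<eta> + 1))"
    using x unfolding Ck_on_def by blast
  have D1: "D (Suc 0) t = g t" if t: "t \<in> {-1..1}" for t
  proof -
    have "(D 0 has_vector_derivative D (Suc 0) t) (at t within {-1..1})" using D[of 0 t] t by simp
    hence "(x has_vector_derivative D (Suc 0) t) (at t within {-1..1})"
      by (rule has_vector_derivative_transform_within[of _ _ _ _ 1]) (use t D0 in auto)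
    thus ?thesis using vector_derivative_unique_within_closed_interval[of "-1" 1 t x "D (Suc 0) t" "g t"] g[OF t] t
      by (simp add: box_real)
  qed
  have ex: "\<exists>c\<ge>0. \<forall>N\<ge>\<eta> - 1 + 4. \<forall>t\<in>{-1..1}.
     \<bar>x t $ k - x (-1) $ k - (\<Sum>i=1..N. poly (gprim N i) t * D (Suc 0) (gauss_node N i) $ k)\<bar> \<le> c / real N ^ (\<eta> - 1)" for k
  proof (rule collocation_defect_real[of "\<eta> - 1" "\<lambda>j t. D (Suc j) t $ k" "\<lambda>t. x t $ k"])
    have *: "((\<lambda>t. f t $ k) has_vector_derivative f' $ k) (at t within {-1..1})"
      if "(f has_vector_derivative f') (at t within {-1..1})" for f :: "real \<Rightarrow> real^'n" and f' t
      using bounded_linear.has_vector_derivative[OF bounded_linear_vec_nth that] .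
    show "((\<lambda>t. D (Suc j) t $ k) has_vector_derivative D (Suc (Suc j)) t $ k) (at t within {-1..1})"
      if "j < Suc (\<eta> - 1)" "t \<in> {-1..1}" for j t
      using D[of "Suc j" t] that \<eta> by (intro *) auto
    show "continuous_on {-1..1} (\<lambda>t. D (Suc (Suc (\<eta> - 1))) t $ k)"
      using cD \<eta> by (intro continuous_intros) simp
    show "((\<lambda>t. x t $ k) has_vector_derivative D (Suc 0) t $ k) (at t within {-1..1})" if "t \<in> {-1..1}" for t
      using g[OF that] D1[OF that] by (intro *) simp
  qed
  define Pk where "Pk k c \<longleftrightarrow> 0 \<le> c \<and> (\<forall>N\<ge>\<eta> - 1 + 4. \<forall>t\<in>{-1..1}.
     \<bar>x t $ k - x (-1) $ k - (\<Sum>i=1..N. poly (gprim N i) t * D (Suc 0) (gauss_node N i) $ k)\<bar> \<le> c / real N ^ (\<eta> - 1))" for k c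
  have "\<exists>c. Pk k c" for k using ex[of k] unfolding Pk_def .
  then obtain c where c': "\<And>k. Pk k (c k)" by metis
  have c: "c k \<ge> 0" "N \<ge> \<eta> - 1 + 4 \<Longrightarrow> t \<in> {-1..1} \<Longrightarrow>
     \<bar>x t $ k - x (-1) $ k - (\<Sum>i=1..N. poly (gprim N i) t * D (Suc 0) (gauss_node N i) $ k)\<bar> \<le> c k / real N ^ (\<eta> - 1)"
    for k N t using c'[of k, unfolded Pk_def] by auto
  show ?thesis
  proof (intro exI[of _ "\<Sum>k\<in>UNIV. c k"] conjI allI impI ballI)
    fix N t assume N: "N \<ge> \<eta> + 3" and t: "t \<in> {-1..1::real}"
    let ?v = "x t - x (-1) - (\<Sum>i=1..N. poly (gprim N i) t *\<^sub>R g (gauss_node N i))"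
    have v: "?v $ k = x t $ k - x (-1) $ k - (\<Sum>i=1..N. poly (gprim N i) t * D (Suc 0) (gauss_node N i) $ k)" for k
    proof -
      have "D (Suc 0) (gauss_node N i) = g (gauss_node N i)" if "i \<in> {1..N}" for i
        using gauss_node_bounds[OF that] by (intro D1) auto
      thus ?thesis by simp
    qed
    have "norm ?v \<le> (\<Sum>k\<in>UNIV. \<bar>?v $ k\<bar>)" by (rule norm_le_l1_cart)
    also have "\<dots> \<le> (\<Sum>k\<in>UNIV. c k / real N ^ (\<eta> - 1))"
      unfolding v using N t \<eta> by (intro sum_mono c(2)) auto
    finally show "norm ?v \<le> (\<Sum>k\<in>UNIV. c k) / real N ^ (\<eta> - 1)" by (simp add: sum_divide_distrib)
  qed (use c(1) in \<open>simp add: sum_nonneg\<close>)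
qed

subsection \<open>Symmetric matrices and second derivatives\<close>

lemma symmetric_matrix_inner:
  fixes A :: "real^'k^'k"
  assumes "\<And>i j. A $ i $ j = A $ j $ i"
  shows "(A *v v) \<bullet> w = v \<bullet> (A *v w)"
proof -
  have "transpose A = A" using assms by (simp add: transpose_def vec_eq_iff)
  thus ?thesis by (metis dot_lmul_matrix inner_commute transpose_matrix_vector)
qed

text \<open>\<open>min_eigenvalue\<close> is a \<open>Min\<close>, meaningful only for a finite set.
  Eigenvectors of different eigenvalues of a symmetric matrix are orthogonal, hence independent,
  hence finitely many.\<close>

lemma finite_eigenvalues:
  fixes A :: "real^'k^'k"
  assumes s: "\<And>i j. A $ i $ j = A $ j $ i"
  shows "finite {e. \<exists>v. v \<noteq> 0 \<and> A *v v = e *s v}" (is "finite ?E")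
proof -
  define v where "v e = (SOME u. u \<noteq> 0 \<and> A *v u = e *s u)" for e
  have v: "v e \<noteq> 0 \<and> A *v v e = e *s v e" if "e \<in> ?E" for e
    unfolding v_def by (rule someI_ex) (use that in simp)
  have o: "v e \<bullet> v e' = 0" if e: "e \<in> ?E" "e' \<in> ?E" "e \<noteq> e'" for e e'
  proof -
    have "(A *v v e) \<bullet> v e' = v e \<bullet> (A *v v e')" by (rule symmetric_matrix_inner[OF s])
    hence "(e *s v e) \<bullet> v e' = v e \<bullet> (e' *s v e')" using v[OF e(1)] v[OF e(2)] by simp
    hence "e * (v e \<bullet> v e') = e' * (v e \<bullet> v e')" by (simp add: scalar_mult_eq_scaleR)
    thus ?thesis using e(3) by simp
  qed
  have inj: "inj_on v ?E"
  proof (rule inj_onI, rule ccontr)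
    fix e e' assume e: "e \<in> ?E" "e' \<in> ?E" "v e = v e'" "e \<noteq> e'"
    thus False using o[OF e(1,2,4)] v[OF e(2)] by simp
  qed
  have "independent (v ` ?E)"
  proof (rule pairwise_orthogonal_independent)
    show "pairwise orthogonal (v ` ?E)"
    proof (rule pairwiseI)
      fix x y assume x: "x \<in> v ` ?E" and y: "y \<in> v ` ?E" and xy: "x \<noteq> y"
      from x obtain e where e: "x = v e" "e \<in> ?E" by (rule imageE)
      from y obtain e' where e': "y = v e'" "e' \<in> ?E" by (rule imageE)
      have "e \<noteq> e'" using xy e(1) e'(1) by auto
      thus "orthogonal x y" using o[OF e(2) e'(2)] e(1) e'(1) by (simp add: orthogonal_def)
    qed
    show "0 \<notin> v ` ?E"
    proof
      assume "0 \<in> v ` ?E"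
      then obtain e where "0 = v e" "e \<in> ?E" by (rule imageE)
      thus False using v[of e] by simp
    qed
  qed
  hence "finite (v ` ?E)" by (rule independent_imp_finite)
  thus ?thesis using inj by (rule finite_imageD)
qed

text \<open>The Rayleigh quotient attains its minimum \<mu> on the unit sphere, and the minimizer is
  an eigenvector by first variation. So \<mu> is one of the eigenvalues and bounds
  \<open>min_eigenvalue\<close> from above.\<close>

lemma min_eigenvalue_le:
  fixes A :: "real^'k^'k"
  assumes s: "\<And>i j. A $ i $ j = A $ j $ i"
  shows "min_eigenvalue A * (norm v)\<^sup>2 \<le> v \<bullet> (A *v v)"
proof -
  let ?\<phi> = "\<lambda>v. v \<bullet> (A *v v)"
  have lin: "linear ((*v) A)" by simp
  have cont: "continuous_on S ?\<phi>" for S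
    by (intro continuous_intros linear_continuous_on_compose[OF continuous_on_id lin])
  have "compact (sphere (0::real^'k) 1)" "sphere (0::real^'k) 1 \<noteq> {}" by auto
  from continuous_attains_inf[OF this cont] obtain v0 where v0: "norm v0 = 1"
      "\<And>v. norm v = 1 \<Longrightarrow> ?\<phi> v0 \<le> ?\<phi> v" by auto
  define \<mu> where "\<mu> = ?\<phi> v0"
  have ray: "\<mu> * (norm v)\<^sup>2 \<le> ?\<phi> v" for v
  proof (cases "v = 0")
    case False
    have "\<mu> \<le> ?\<phi> (v /\<^sub>R norm v)" unfolding \<mu>_def using False by (intro v0(2)) simp
    also have "\<dots> = ?\<phi> v / (norm v)\<^sup>2"
      by (simp add: linear_scale[OF lin] power2_eq_square divide_inverse)
    finally show ?thesis using False by (simp add: pos_le_divide_eq)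
  qed simp
  \<comment> \<open>The eigenvalue residual serves as direction of variation, so that the linear
    term of the variation is \<open>2 * t * (r \<bullet> r)\<close>.\<close>
  define r where "r = A *v v0 - \<mu> *\<^sub>R v0"
  define K where "K = ?\<phi> r - \<mu> * (norm r)\<^sup>2"
  have q: "0 \<le> 2 * t * (r \<bullet> r) + t\<^sup>2 * K" for t
  proof -
    have s': "v0 \<bullet> (A *v r) = r \<bullet> (A *v v0)"
      using symmetric_matrix_inner[OF s, of v0 r] by (simp add: inner_commute)
    have e1: "?\<phi> (v0 + t *\<^sub>R r) = \<mu> + 2 * t * (r \<bullet> (A *v v0)) + t\<^sup>2 * ?\<phi> r"
      unfolding linear_add[OF lin] linear_scale[OF lin]
      by (simp add: inner_add_left inner_add_right s' \<mu>_def power2_eq_square algebra_simps)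
    have e2: "(norm (v0 + t *\<^sub>R r))\<^sup>2 = 1 + 2 * t * (r \<bullet> v0) + t\<^sup>2 * (norm r)\<^sup>2"
      using v0(1) unfolding power2_norm_eq_inner
      by (simp add: inner_add_left inner_add_right norm_eq_1 power2_eq_square inner_commute algebra_simps)
    have e3: "r \<bullet> r = r \<bullet> (A *v v0) - \<mu> * (r \<bullet> v0)"
      by (subst (2) r_def) (simp add: inner_diff_right)
    show ?thesis using ray[of "v0 + t *\<^sub>R r"] unfolding e1 e2 e3 K_def by (simp add: algebra_simps)
  qed
  have "r \<bullet> r = 0"
  proof (rule ccontr)
    assume "r \<bullet> r \<noteq> 0"
    hence p: "r \<bullet> r > 0" by simp
    \<comment> \<open>A negative step so small that the quadratic term uses up at most half of the
      linear one.\<close>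
    define t where "t = - (r \<bullet> r) / (\<bar>K\<bar> + 1)"
    have t: "t < 0" "t * (\<bar>K\<bar> + 1) = - (r \<bullet> r)" using p by (auto simp: t_def divide_less_0_iff)
    have "t\<^sup>2 * K \<le> t * (t * (\<bar>K\<bar> + 1))"
      using mult_left_mono[of K "\<bar>K\<bar> + 1" "t\<^sup>2"] by (simp add: power2_eq_square mult.assoc)
    hence "2 * t * (r \<bullet> r) + t\<^sup>2 * K \<le> t * (r \<bullet> r)" unfolding t(2) by simp
    also have "\<dots> < 0" using t(1) p by (rule mult_neg_pos)
    finally show False using q[of t] by simp
  qed
  hence "A *v v0 = \<mu> *s v0" by (simp add: r_def scalar_mult_eq_scaleR)
  moreover have "v0 \<noteq> 0" using v0(1) by auto
  ultimately have "\<mu> \<in> {e. \<exists>v. v \<noteq> 0 \<and> A *v v = e *s v}" by auto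
  hence "min_eigenvalue A \<le> \<mu>" unfolding min_eigenvalue_def by (rule Min_le[OF finite_eigenvalues[OF s]])
  hence "min_eigenvalue A * (norm v)\<^sup>2 \<le> \<mu> * (norm v)\<^sup>2" by (simp add: mult_right_mono)
  with ray[of v] show ?thesis by linarith
qed

text \<open>Mean value theorem in direction \<open>h\<close> for the increment in direction
  \<open>k\<close>; both derivative values are then expanded at \<open>z\<close>, so first-order
  information on \<open>Df\<close> is used at this one point only. The second difference is
  symmetric in \<open>h\<close> and \<open>k\<close>, so the estimate can be applied with them
  exchanged.\<close>

lemma second_difference_estimate:
  fixes f :: "'a::real_normed_vector \<Rightarrow> real" and Df :: "'a \<Rightarrow> 'a \<Rightarrow>\<^sub>L real"
  assumes d: "\<And>v. norm v < d \<Longrightarrow> (f has_derivative Df (z + v)) (at (z + v))"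
    and o: "\<And>v. norm v < d \<Longrightarrow> norm (Df (z + v) - Df z - D2 v) \<le> e * norm v"
    and t: "0 < t" "t * (norm h + norm k) < d" and e: "e \<ge> 0" and D2: "linear D2"
  shows "\<bar>f (z + t *\<^sub>R h + t *\<^sub>R k) - f (z + t *\<^sub>R h) - f (z + t *\<^sub>R k) + f z - t\<^sup>2 * blinfun_apply (D2 k) h\<bar>
    \<le> 2 * e * t\<^sup>2 * (norm h + norm k)\<^sup>2"
proof -
  define \<psi> where "\<psi> s = f (z + (s *\<^sub>R h + t *\<^sub>R k)) - f (z + s *\<^sub>R h)" for s
  have small: "norm (s *\<^sub>R h + t *\<^sub>R k) < d" "norm (s *\<^sub>R h) < d"
    "norm (s *\<^sub>R h + t *\<^sub>R k) \<le> t * (norm h + norm k)" "norm (s *\<^sub>R h) \<le> t * (norm h + norm k)" if "0 \<le> s" "s \<le> t" for s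
  proof -
    have "norm (s *\<^sub>R h + t *\<^sub>R k) \<le> s * norm h + t * norm k"
      using norm_triangle_ineq[of "s *\<^sub>R h" "t *\<^sub>R k"] that t(1) by simp
    also have "\<dots> \<le> t * norm h + t * norm k" using that by (simp add: mult_right_mono)
    finally show 1: "norm (s *\<^sub>R h + t *\<^sub>R k) \<le> t * (norm h + norm k)" by (simp add: algebra_simps)
    have "norm (s *\<^sub>R h) \<le> t * norm h" using that by (simp add: mult_right_mono)
    also have "\<dots> \<le> t * (norm h + norm k)" using t(1) by (intro mult_left_mono) auto
    finally show 2: "norm (s *\<^sub>R h) \<le> t * (norm h + norm k)" .
    show "norm (s *\<^sub>R h + t *\<^sub>R k) < d" "norm (s *\<^sub>R h) < d" using 1 2 t(2) by linarith+
  qed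
  have "(\<psi> has_derivative (*) (blinfun_apply (Df (z + (s *\<^sub>R h + t *\<^sub>R k))) h - blinfun_apply (Df (z + s *\<^sub>R h)) h)) (at s)"
    if s: "0 \<le> s" "s \<le> t" for s
  proof -
    have 1: "((\<lambda>s. f (z + (s *\<^sub>R h + t *\<^sub>R k))) has_derivative (\<lambda>x. blinfun_apply (Df (z + (s *\<^sub>R h + t *\<^sub>R k))) (x *\<^sub>R h))) (at s)"
      by (rule has_derivative_compose[where f="\<lambda>s. z + (s *\<^sub>R h + t *\<^sub>R k)" and g=f, OF _ d[OF small(1)[OF s]]]) (auto intro!: derivative_eq_intros)
    have 2: "((\<lambda>s. f (z + s *\<^sub>R h)) has_derivative (\<lambda>x. blinfun_apply (Df (z + s *\<^sub>R h)) (x *\<^sub>R h))) (at s)"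
      by (rule has_derivative_compose[where f="\<lambda>s. z + s *\<^sub>R h" and g=f, OF _ d[OF small(2)[OF s]]]) (auto intro!: derivative_eq_intros)
    show ?thesis unfolding \<psi>_def
      by (rule has_derivative_eq_rhs[OF has_derivative_diff[OF 1 2]])
         (simp add: fun_eq_iff blinfun.scaleR_right algebra_simps)
  qed
  hence dd: "(\<psi> has_real_derivative (blinfun_apply (Df (z + (s *\<^sub>R h + t *\<^sub>R k))) h - blinfun_apply (Df (z + s *\<^sub>R h)) h)) (at s)"
    if "0 \<le> s" "s \<le> t" for s
    using that unfolding has_field_derivative_def by simp
  obtain s where s: "0 < s" "s < t" "\<psi> t - \<psi> 0 = t * (blinfun_apply (Df (z + (s *\<^sub>R h + t *\<^sub>R k))) h - blinfun_apply (Df (z + s *\<^sub>R h)) h)"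
    using MVT2[OF t(1) dd] by auto
  let ?v = "s *\<^sub>R h + t *\<^sub>R k" and ?u = "s *\<^sub>R h"
  have sl: "0 \<le> s" "s \<le> t" using s by auto
  let ?E = "(Df (z + ?v) - Df z - D2 ?v) - (Df (z + ?u) - Df z - D2 ?u)"
  have "D2 ?v - D2 ?u = t *\<^sub>R D2 k" by (simp add: linear_add[OF D2] linear_scale[OF D2])
  hence E: "Df (z + ?v) - Df (z + ?u) - t *\<^sub>R D2 k = ?E" by (simp add: algebra_simps)
  have "norm ?E \<le> e * norm ?v + e * norm ?u"
    using o[OF small(1)[OF sl]] o[OF small(2)[OF sl]] norm_triangle_ineq4 add_mono order_trans by blast
  also have "\<dots> \<le> e * (t * (norm h + norm k)) + e * (t * (norm h + norm k))"
    using small(3,4)[OF sl] e by (intro add_mono mult_left_mono)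
  finally have nE: "norm ?E \<le> 2 * e * t * (norm h + norm k)" by simp
  have "\<psi> t - \<psi> 0 - t\<^sup>2 * blinfun_apply (D2 k) h = t * blinfun_apply ?E h"
    unfolding s(3) E[symmetric] by (simp add: blinfun.diff_left blinfun.scaleR_left power2_eq_square right_diff_distrib)
  also have "\<bar>\<dots>\<bar> \<le> t * (norm ?E * norm h)"
    using norm_blinfun[of ?E h] t(1) by (simp add: abs_mult mult_left_mono)
  also have "\<dots> \<le> t * ((2 * e * t * (norm h + norm k)) * (norm h + norm k))"
    using t(1) nE e by (intro mult_left_mono mult_mono) auto
  finally show ?thesis by (simp add: \<psi>_def power2_eq_square algebra_simps)
qed

text \<open>One second difference of \<open>f\<close> approximates both mixed values up to a
  multiple of \<open>e * t\<^sup>2\<close>; dividing by \<open>t\<^sup>2\<close> and letting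
  \<open>e\<close> tend to 0 identifies them.\<close>

lemma second_derivative_symmetric_real:
  fixes f :: "'a::real_normed_vector \<Rightarrow> real" and Df :: "'a \<Rightarrow> 'a \<Rightarrow>\<^sub>L real"
  assumes S: "open S" "z \<in> S" and f: "\<And>y. y \<in> S \<Longrightarrow> (f has_derivative Df y) (at y)"
    and D2: "(Df has_derivative D2) (at z)"
  shows "blinfun_apply (D2 h) k = blinfun_apply (D2 k) h"
proof -
  have lin: "linear D2" using D2 has_derivative_linear by blast
  let ?n = "norm h + norm k"
  have b: "\<bar>blinfun_apply (D2 h) k - blinfun_apply (D2 k) h\<bar> \<le> e * (4 * ?n\<^sup>2)" if e: "e > 0" for e
  proof -
    obtain d1 where d1: "d1 > 0" "ball z d1 \<subseteq> S" using S openE by blast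
    obtain d2 where d2: "d2 > 0" "\<And>y. norm (y - z) < d2 \<Longrightarrow> norm (Df y - Df z - D2 (y - z)) \<le> e * norm (y - z)"
      using D2 e unfolding has_derivative_at_alt by blast
    define d where "d = min d1 d2"
    have d: "d > 0" using d1 d2 by (simp add: d_def)
    have 1: "(f has_derivative Df (z + v)) (at (z + v))" if "norm v < d" for v
      using that d1(2) by (intro f) (auto simp: d_def dist_norm)
    have 2: "norm (Df (z + v) - Df z - D2 v) \<le> e * norm v" if "norm v < d" for v
      using that d2(2)[of "z + v"] by (simp add: d_def)
    define t where "t = d / (2 * (?n + 1))"
    have n: "?n \<ge> 0" by simp
    have n2: "2 * (?n + 1) > 0" by (intro mult_pos_pos add_nonneg_pos n) auto
    have t: "t > 0" using d n2 unfolding t_def by (intro divide_pos_pos)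
    have "t * ?n < t * (2 * (?n + 1))" using t by (intro mult_strict_left_mono) (auto intro!: add_nonneg_pos)
    also have "\<dots> = d" unfolding t_def using n2 by (intro nonzero_eq_divide_eq[THEN iffD1]) auto
    finally have t2: "t * (norm h + norm k) < d" "t * (norm k + norm h) < d" by (simp_all add: add.commute)
    have "\<bar>t\<^sup>2 * (blinfun_apply (D2 h) k - blinfun_apply (D2 k) h)\<bar> \<le> t\<^sup>2 * (e * (4 * ?n\<^sup>2))"
      using second_difference_estimate[OF 1 2 t t2(1) less_imp_le[OF e] lin]
        second_difference_estimate[OF 1 2 t t2(2) less_imp_le[OF e] lin]
      by (simp add: algebra_simps abs_le_iff)
    thus ?thesis using t by (simp add: abs_mult)
  qed
  have "\<bar>blinfun_apply (D2 h) k - blinfun_apply (D2 k) h\<bar> \<le> 0"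
  proof (rule field_le_epsilon)
    fix e :: real assume e: "e > 0"
    have "4 * ?n\<^sup>2 / (4 * ?n\<^sup>2 + 1) \<le> 1" by (simp add: divide_le_eq add_nonneg_pos)
    hence "e * (4 * ?n\<^sup>2 / (4 * ?n\<^sup>2 + 1)) \<le> e" using e mult_left_le[of "4 * ?n\<^sup>2 / (4 * ?n\<^sup>2 + 1)" e] by simp
    with b[of "e / (4 * ?n\<^sup>2 + 1)"] e show "\<bar>blinfun_apply (D2 h) k - blinfun_apply (D2 k) h\<bar> \<le> 0 + e"
      by (simp add: add_nonneg_pos)
  qed
  thus ?thesis by simp
qed

lemma second_derivative_symmetric:
  fixes f :: "'a::real_normed_vector \<Rightarrow> 'b::real_inner" and Df :: "'a \<Rightarrow> 'a \<Rightarrow>\<^sub>L 'b"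
  assumes S: "open S" "z \<in> S" and f: "\<And>y. y \<in> S \<Longrightarrow> (f has_derivative Df y) (at y)"
    and D2: "(Df has_derivative D2) (at z)"
  shows "blinfun_apply (D2 h) k = blinfun_apply (D2 k) h"
proof (rule vector_eq_rdot[THEN iffD1, rule_format])
  fix l :: 'b
  define L where "L = (blinfun_inner_right l :: 'b \<Rightarrow>\<^sub>L real)"
  have Lx: "blinfun_apply L x = l \<bullet> x" for x by (simp add: L_def)
  have 1: "((\<lambda>x. L (f x)) has_derivative (L o\<^sub>L Df y)) (at y)" if "y \<in> S" for y
    using blinfun.bounded_linear_right[of L, THEN bounded_linear.has_derivative, OF f[OF that]]
    by (rule has_derivative_eq_rhs) (simp add: fun_eq_iff)
  have 2: "((\<lambda>y. L o\<^sub>L Df y) has_derivative (\<lambda>h. L o\<^sub>L D2 h)) (at z)"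
    by (rule bounded_linear.has_derivative[OF bounded_bilinear.bounded_linear_right[OF bounded_bilinear_blinfun_compose] D2])
  have "blinfun_apply (L o\<^sub>L D2 h) k = blinfun_apply (L o\<^sub>L D2 k) h"
    by (rule second_derivative_symmetric_real[OF S 1 2])
  thus "blinfun_apply (D2 h) k \<bullet> l = blinfun_apply (D2 k) h \<bullet> l" by (simp add: Lx inner_commute)
qed

subsection \<open>Discrete integration and the linearized problem\<close>

abbreviation adj :: "('a::euclidean_space \<Rightarrow>\<^sub>L 'b::euclidean_space) \<Rightarrow> 'b \<Rightarrow> 'a" where
  "adj A \<equiv> adjoint (blinfun_apply A)"

lemma adj_inner: "adj A l \<bullet> h = l \<bullet> blinfun_apply A h"
  using adjoint_works[OF bounded_linear.linear[OF blinfun.bounded_linear_right], of h A l]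
  by (simp add: inner_commute)

lemma norm_adj_le: "norm (adj A l) \<le> norm A * norm l"
proof (cases "adj A l = 0")
  case False
  have "(norm (adj A l))\<^sup>2 = l \<bullet> blinfun_apply A (adj A l)" by (simp add: adj_inner power2_norm_eq_inner)
  also have "\<dots> \<le> norm l * norm (blinfun_apply A (adj A l))" by (rule norm_cauchy_schwarz)
  also have "\<dots> \<le> norm l * (norm A * norm (adj A l))" by (intro mult_left_mono norm_blinfun) simp
  finally show ?thesis using False by (simp add: power2_eq_square mult_ac)
qed simp

lemma adj_diff_left: "adj (A - B) l = adj A l - adj B l"
  by (rule vector_eq_rdot[THEN iffD1]) (simp add: adj_inner inner_diff_left blinfun.diff_left inner_diff_right)

lemma adj_diff_right: "adj A (l - m) = adj A l - adj A m"
  by (rule vector_eq_rdot[THEN iffD1]) (simp add: adj_inner inner_diff_left)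

lemma adj_add_right: "adj A (l + m) = adj A l + adj A m"
  by (rule vector_eq_rdot[THEN iffD1]) (simp add: adj_inner inner_add_left)

lemma adj_scaleR_right: "adj A (c *\<^sub>R l) = c *\<^sub>R adj A l"
  by (rule vector_eq_rdot[THEN iffD1]) (simp add: adj_inner)

definition primal :: "nat \<Rightarrow> (nat \<Rightarrow> 'a::real_vector) \<Rightarrow> real \<Rightarrow> 'a" where
  "primal N a t = (\<Sum>i=1..N. poly (gprim N i) t *\<^sub>R a i)"

definition dual :: "nat \<Rightarrow> (nat \<Rightarrow> 'a::real_vector) \<Rightarrow> real \<Rightarrow> 'a" where
  "dual N b t = (\<Sum>i=1..N. (gauss_weight N i - poly (gprim N i) t) *\<^sub>R b i)"

definition wnorm :: "nat \<Rightarrow> (nat \<Rightarrow> 'a::real_normed_vector) \<Rightarrow> real" where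
  "wnorm N a = sqrt (\<Sum>i=1..N. gauss_weight N i * (norm (a i))\<^sup>2)"

lemma wnorm_L2_set: "wnorm N a = L2_set (\<lambda>i. sqrt (gauss_weight N i) * norm (a i)) {1..N}"
  unfolding wnorm_def L2_set_def
  by (intro arg_cong[where f=sqrt] sum.cong)
     (auto simp: power_mult_distrib less_imp_le[OF gauss_weight_pos])

lemma wnorm_nonneg [simp]: "wnorm N a \<ge> 0"
  unfolding wnorm_L2_set by (rule L2_set_nonneg)

lemma wnorm_power2: "(wnorm N a)\<^sup>2 = (\<Sum>i=1..N. gauss_weight N i * (norm (a i))\<^sup>2)"
  unfolding wnorm_def
  by (intro real_sqrt_pow2 sum_nonneg mult_nonneg_nonneg) (auto simp: less_imp_le[OF gauss_weight_pos])

lemma wnorm_triangle: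
  assumes "\<And>i. i \<in> {1..N} \<Longrightarrow> norm (a i) \<le> \<beta> * norm (b i) + \<gamma> * norm (c i)" and "\<beta> \<ge> 0" "\<gamma> \<ge> 0"
  shows "wnorm N a \<le> \<beta> * wnorm N b + \<gamma> * wnorm N c"
proof -
  let ?s = "\<lambda>i. sqrt (gauss_weight N i)"
  have "wnorm N a \<le> L2_set (\<lambda>i. \<beta> * (?s i * norm (b i)) + \<gamma> * (?s i * norm (c i))) {1..N}"
    unfolding wnorm_L2_set
  proof (intro L2_set_mono)
    fix i assume i: "i \<in> {1..N}"
    have "?s i * norm (a i) \<le> ?s i * (\<beta> * norm (b i) + \<gamma> * norm (c i))"
      using assms(1)[OF i] gauss_weight_pos[OF i] by (intro mult_left_mono) auto
    thus "?s i * norm (a i) \<le> \<beta> * (?s i * norm (b i)) + \<gamma> * (?s i * norm (c i))" by (simp add: algebra_simps)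
    show "0 \<le> ?s i * norm (a i)" using gauss_weight_pos[OF i] by simp
  qed
  also have "\<dots> \<le> L2_set (\<lambda>i. \<beta> * (?s i * norm (b i))) {1..N} + L2_set (\<lambda>i. \<gamma> * (?s i * norm (c i))) {1..N}"
    by (rule L2_set_triangle_ineq)
  also have "\<dots> = \<beta> * wnorm N b + \<gamma> * wnorm N c"
    using assms(2,3) unfolding wnorm_L2_set by (simp add: L2_set_right_distrib)
  finally show ?thesis .
qed

lemma wnorm_const: "N \<ge> 1 \<Longrightarrow> K \<ge> 0 \<Longrightarrow> wnorm N (\<lambda>_. K::real) = sqrt 2 * K"
  using sum_gauss_weight[of N] by (simp add: wnorm_def real_sqrt_mult flip: sum_distrib_right)

lemma wnorm_le:
  assumes "N \<ge> 1" "K \<ge> 0" "\<And>i. i \<in> {1..N} \<Longrightarrow> norm (a i) \<le> K"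
  shows "wnorm N a \<le> sqrt 2 * K"
proof -
  have "wnorm N a \<le> 1 * wnorm N (\<lambda>_. K) + 0 * wnorm N (\<lambda>_. K)"
    using assms by (intro wnorm_triangle) auto
  thus ?thesis using assms by (simp add: wnorm_const)
qed

lemma wsum_inner_le:
  "\<bar>\<Sum>i=1..N. gauss_weight N i * (a i \<bullet> b i)\<bar> \<le> wnorm N a * wnorm N (b :: nat \<Rightarrow> 'a::real_inner)"
proof -
  let ?s = "\<lambda>i. sqrt (gauss_weight N i)"
  have "\<bar>\<Sum>i=1..N. gauss_weight N i * (a i \<bullet> b i)\<bar> \<le> (\<Sum>i=1..N. \<bar>gauss_weight N i * (a i \<bullet> b i)\<bar>)" by (rule sum_abs)
  also have "\<dots> \<le> (\<Sum>i=1..N. \<bar>?s i * norm (a i)\<bar> * \<bar>?s i * norm (b i)\<bar>)"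
  proof (rule sum_mono)
    fix i assume i: "i \<in> {1..N}"
    have "gauss_weight N i * \<bar>a i \<bullet> b i\<bar> \<le> gauss_weight N i * (norm (a i) * norm (b i))"
      using gauss_weight_pos[OF i] by (intro mult_left_mono Cauchy_Schwarz_ineq2) auto
    moreover have "gauss_weight N i = ?s i * ?s i" using gauss_weight_pos[OF i] by simp
    ultimately show "\<bar>gauss_weight N i * (a i \<bullet> b i)\<bar> \<le> \<bar>?s i * norm (a i)\<bar> * \<bar>?s i * norm (b i)\<bar>"
      using gauss_weight_pos[OF i] by (simp add: abs_mult mult_ac)
  qed
  also have "\<dots> \<le> wnorm N a * wnorm N b" unfolding wnorm_L2_set by (rule L2_set_mult_ineq)
  finally show ?thesis .
qed

lemma norm_primal_le: "N \<ge> 1 \<Longrightarrow> t \<in> {-1..1} \<Longrightarrow> norm (primal N a t) \<le> sqrt 2 * wnorm N (a :: nat \<Rightarrow> 'a::real_inner)"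
  using gprim_diff_bound[of "-1" t N a] by (simp add: primal_def wnorm_def)

lemma norm_dual_le: "N \<ge> 1 \<Longrightarrow> t \<in> {-1..1} \<Longrightarrow> norm (dual N b t) \<le> sqrt 2 * wnorm N (b :: nat \<Rightarrow> 'a::real_inner)"
  using gprim_diff_bound[of t 1 N b] by (simp add: dual_def wnorm_def)

lemma sup_primal_dual_le:
  fixes a :: "nat \<Rightarrow> 'a::real_inner"
  assumes "N \<ge> 1" "t \<in> {-1..1}" "K \<ge> 0" "\<And>i. i \<in> {1..N} \<Longrightarrow> norm (a i) \<le> K"
  shows "norm (primal N a t) \<le> 2 * K" "norm (dual N a t) \<le> 2 * K"
proof -
  have "sqrt 2 * wnorm N a \<le> sqrt 2 * (sqrt 2 * K)" using wnorm_le[OF assms(1,3,4)] by (simp add: mult_left_mono)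
  hence "sqrt 2 * wnorm N a \<le> (sqrt 2 * sqrt 2) * K" by (simp only: mult.assoc)
  hence "sqrt 2 * wnorm N a \<le> 2 * K" by simp
  thus "norm (primal N a t) \<le> 2 * K" "norm (dual N a t) \<le> 2 * K"
    using norm_primal_le[OF assms(1,2), of a] norm_dual_le[OF assms(1,2), of a] by linarith+
qed

lemma primal_right: "primal N a 1 = (\<Sum>i=1..N. gauss_weight N i *\<^sub>R a i)"
  by (simp add: primal_def)

lemma dual_right [simp]: "dual N b 1 = 0"
  by (simp add: dual_def)

lemma primal_left [simp]: "primal N a (-1) = 0"
  by (simp add: primal_def)

lemma primal_diff: "primal N (\<lambda>i. a i - b i) t = primal N a t - primal N b t"
  by (simp add: primal_def scaleR_right_diff_distrib sum_subtractf)

lemma dual_diff: "dual N (\<lambda>i. a i - b i) t = dual N a t - dual N b t"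
  by (simp add: dual_def scaleR_right_diff_distrib sum_subtractf)

text \<open>\<open>gprim_adjoint\<close> summed against \<open>a\<close> and \<open>b\<close>. There
  is no boundary term because \<open>primal\<close> vanishes at -1 and \<open>dual\<close> at
  1.\<close>

lemma discrete_by_parts:
  fixes a b :: "nat \<Rightarrow> 'a::real_inner"
  shows "(\<Sum>j=1..N. gauss_weight N j * (b j \<bullet> primal N a (gauss_node N j)))
   = (\<Sum>j=1..N. gauss_weight N j * (dual N b (gauss_node N j) \<bullet> a j))"
proof -
  have "(\<Sum>j=1..N. gauss_weight N j * (b j \<bullet> primal N a (gauss_node N j)))
    = (\<Sum>j=1..N. \<Sum>i=1..N. (gauss_weight N j * poly (gprim N i) (gauss_node N j)) * (b j \<bullet> a i))"
    by (simp add: primal_def inner_sum_right sum_distrib_left mult.assoc)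
  also have "\<dots> = (\<Sum>j=1..N. \<Sum>i=1..N. gauss_weight N i * (gauss_weight N j - poly (gprim N j) (gauss_node N i)) * (b j \<bullet> a i))"
    by (intro sum.cong refl) (simp only: gprim_adjoint)
  also have "\<dots> = (\<Sum>i=1..N. \<Sum>j=1..N. gauss_weight N i * (gauss_weight N j - poly (gprim N j) (gauss_node N i)) * (b j \<bullet> a i))"
    by (rule sum.swap)
  also have "\<dots> = (\<Sum>j=1..N. gauss_weight N j * (dual N b (gauss_node N j) \<bullet> a j))"
    by (simp add: dual_def inner_sum_left sum_distrib_left mult.assoc)
  finally show ?thesis .
qed

text \<open>An isometric embedding \<open>ix\<close> with adjoint \<open>px\<close>. Controls are
  represented by the orthogonal complement of the range of \<open>ix\<close>, that is by vectors
  \<open>pu w\<close> of the big space, so that a single adjoint of \<open>Df\<close> covers both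
  gradients.\<close>

locale split_space =
  fixes ix :: "'x::euclidean_space \<Rightarrow> 'w::euclidean_space" and px :: "'w \<Rightarrow> 'x"
  assumes lin_ix: "linear ix" and lin_px: "linear px"
    and px_ix [simp]: "px (ix x) = x" and ix_inner: "ix x \<bullet> w = x \<bullet> px w"
begin

definition pu :: "'w \<Rightarrow> 'w" where "pu w = w - ix (px w)"

lemma norm_ix [simp]: "norm (ix x) = norm x"
  by (simp add: norm_eq_sqrt_inner ix_inner)

lemma norm_px_le: "norm (px w) \<le> norm w"
proof (cases "px w = 0")
  case False
  have "(norm (px w))\<^sup>2 = ix (px w) \<bullet> w" by (simp add: ix_inner power2_norm_eq_inner)
  also have "\<dots> \<le> norm (px w) * norm w" using norm_cauchy_schwarz[of "ix (px w)" w] by simp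
  finally show ?thesis using False by (simp add: power2_eq_square)
qed simp

lemma px_pu [simp]: "px (pu w) = 0"
  by (simp add: pu_def linear_diff[OF lin_px])

lemma norm_pu_le: "norm (pu w) \<le> norm w"
proof -
  have "pu w \<bullet> ix (px w) = 0" using ix_inner[of "px w" "pu w"] by (simp add: inner_commute)
  hence "(norm w)\<^sup>2 = (norm (pu w))\<^sup>2 + (norm (ix (px w)))\<^sup>2"
    using norm_add_Pythagorean[of "pu w" "ix (px w)"] by (simp add: orthogonal_def pu_def)
  hence "(norm (pu w))\<^sup>2 \<le> (norm w)\<^sup>2" by simp
  thus ?thesis by (rule power2_le_imp_le) simp
qed

lemma pu_diff: "pu (w - w') = pu w - pu w'"
  by (simp add: pu_def linear_diff[OF lin_px] linear_diff[OF lin_ix])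

lemma pu_inner_ix [simp]: "pu w \<bullet> ix x = 0"
  using ix_inner[of x "pu w"] by (simp add: inner_commute)

text \<open>At each node one vector \<open>p j\<close> carries two unknowns: \<open>px (p j)\<close> is the derivative of the costate
  and \<open>pu (p j)\<close> the control; \<open>a j\<close> is the derivative of the state.\<close>

definition traj :: "nat \<Rightarrow> (nat \<Rightarrow> 'x) \<Rightarrow> (nat \<Rightarrow> 'w) \<Rightarrow> nat \<Rightarrow> 'w" where
  "traj N a p j = ix (primal N a (gauss_node N j)) + pu (p j)"

lemma px_traj [simp]: "px (traj N a p j) = primal N a (gauss_node N j)"
  by (simp add: traj_def linear_add[OF lin_px])

text \<open>Testing the second equation with \<open>y\<close>, summation by parts cancels all products of \<open>a\<close> with the
  costate, leaving the nonnegative boundary term and the coercive form \<open>y \<bullet> Q y\<close>. The hypothesis on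
  \<open>px (adj G \<mu>)\<close> allows absorbing \<open>\<mu>\<close> on the left, since the dual integration operator has norm at
  most 2.\<close>

lemma LQ_energy:
  assumes N: "N \<ge> 1" and \<alpha>: "\<alpha> > 0" and g0: "g \<ge> 0" and q0: "q \<ge> 0" and pi0: "\<pi> \<ge> 0"
    and G: "\<And>j. j \<in> {1..N} \<Longrightarrow> norm (G j) \<le> g"
    and Q: "\<And>j h. j \<in> {1..N} \<Longrightarrow> norm (Q j h) \<le> q * norm h"
    and coer: "\<And>j h. j \<in> {1..N} \<Longrightarrow> \<alpha> * (norm h)\<^sup>2 \<le> h \<bullet> Q j h"
    and Pi: "\<And>h. norm (P h) \<le> \<pi> * norm h" "\<And>h. 0 \<le> h \<bullet> P h"
    and A3: "\<And>j \<mu>. j \<in> {1..N} \<Longrightarrow> norm (px (adj (G j) \<mu>)) \<le> norm \<mu> / 4"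
    and y: "\<And>j. y j = traj N a p j"
    and \<mu>: "\<And>j. \<mu> j = P (primal N a 1) - dual N (\<lambda>i. px (p i)) (gauss_node N j)"
    and r: "\<And>j. j \<in> {1..N} \<Longrightarrow> r j = a j - blinfun_apply (G j) (y j)"
    and s: "\<And>j. j \<in> {1..N} \<Longrightarrow> s j = ix (px (p j)) + adj (G j) (\<mu> j) + Q j (y j)"
  shows "wnorm N y \<le> (1 + (5 + 8 * \<pi> + 4 * \<pi> * g + 4 * q) / \<alpha>) * (wnorm N r + wnorm N s)"
    "wnorm N a \<le> wnorm N r + g * wnorm N y"
    "wnorm N (\<lambda>j. px (p j)) \<le> wnorm N s + wnorm N \<mu> / 4 + q * wnorm N y"
    "wnorm N \<mu> \<le> 4 * \<pi> * wnorm N r + (4 * \<pi> * g + 4 * q) * wnorm N y + 4 * wnorm N s"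
proof -
  let ?b = "\<lambda>j. px (p j)" and ?\<tau> = "gauss_node N" and ?w = "gauss_weight N"
  let ?R = "wnorm N r" and ?S = "wnorm N s" and ?Y = "wnorm N y" and ?M = "wnorm N \<mu>" and ?A = "wnorm N a" and ?B = "wnorm N ?b"
  have \<tau>: "?\<tau> j \<in> {-1..1}" if "j \<in> {1..N}" for j using gauss_node_bounds[OF that] by auto
  have point: "?w j * (y j \<bullet> Q j (y j)) = ?w j * (s j \<bullet> y j) + ?w j * (\<mu> j \<bullet> r j)
     - ?w j * (?b j \<bullet> primal N a (?\<tau> j)) - ?w j * (\<mu> j \<bullet> a j)" if j: "j \<in> {1..N}" for j
  proof -
    have "s j \<bullet> y j = ?b j \<bullet> primal N a (?\<tau> j) + \<mu> j \<bullet> blinfun_apply (G j) (y j) + y j \<bullet> Q j (y j)"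
      unfolding s[OF j] inner_add_left ix_inner adj_inner by (simp add: y inner_commute[of "Q j _"])
    moreover have "blinfun_apply (G j) (y j) = a j - r j" using r[OF j] by simp
    ultimately have "y j \<bullet> Q j (y j) = s j \<bullet> y j + \<mu> j \<bullet> r j - ?b j \<bullet> primal N a (?\<tau> j) - \<mu> j \<bullet> a j"
      by (simp add: inner_diff_right)
    thus ?thesis by (simp only: right_diff_distrib distrib_left)
  qed
  have "(\<Sum>j=1..N. ?w j * (\<mu> j \<bullet> a j)) = P (primal N a 1) \<bullet> primal N a 1 - (\<Sum>j=1..N. ?w j * (dual N ?b (?\<tau> j) \<bullet> a j))"
    by (simp add: \<mu> primal_right inner_sum_right inner_diff_left right_diff_distrib sum_subtractf)
  hence pos: "0 \<le> (\<Sum>j=1..N. ?w j * (?b j \<bullet> primal N a (?\<tau> j))) + (\<Sum>j=1..N. ?w j * (\<mu> j \<bullet> a j))"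
    unfolding discrete_by_parts using Pi(2)[of "primal N a 1"] by (simp add: inner_commute)
  have "\<alpha> * ?Y\<^sup>2 = (\<Sum>j=1..N. ?w j * (\<alpha> * (norm (y j))\<^sup>2))"
    unfolding wnorm_power2 sum_distrib_left by (simp only: mult_ac)
  also have "\<dots> \<le> (\<Sum>j=1..N. ?w j * (y j \<bullet> Q j (y j)))"
    using gauss_weight_pos[of _ N] by (intro sum_mono mult_left_mono coer) (auto simp: less_imp_le)
  also have "\<dots> = (\<Sum>j=1..N. ?w j * (s j \<bullet> y j)) + (\<Sum>j=1..N. ?w j * (\<mu> j \<bullet> r j))
     - (\<Sum>j=1..N. ?w j * (?b j \<bullet> primal N a (?\<tau> j))) - (\<Sum>j=1..N. ?w j * (\<mu> j \<bullet> a j))"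
    unfolding sum_subtractf[symmetric] sum.distrib[symmetric] by (intro sum.cong refl point)
  also have "\<dots> \<le> (\<Sum>j=1..N. ?w j * (s j \<bullet> y j)) + (\<Sum>j=1..N. ?w j * (\<mu> j \<bullet> r j))" using pos by linarith
  also have "\<dots> \<le> ?S * ?Y + ?M * ?R" using wsum_inner_le[of N s y] wsum_inner_le[of N \<mu> r] by linarith
  finally have energy: "\<alpha> * ?Y\<^sup>2 \<le> ?S * ?Y + ?M * ?R" .
  show A: "?A \<le> ?R + g * ?Y"
  proof -
    have "?A \<le> 1 * ?R + g * ?Y"
    proof (rule wnorm_triangle)
      fix j assume j: "j \<in> {1..N}"
      have "norm (blinfun_apply (G j) (y j)) \<le> g * norm (y j)"
        using norm_blinfun[of "G j" "y j"] G[OF j] by (meson mult_right_mono norm_ge_zero order_trans)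
      moreover have "a j = r j + blinfun_apply (G j) (y j)" using r[OF j] by simp
      ultimately show "norm (a j) \<le> 1 * norm (r j) + g * norm (y j)"
        using norm_triangle_ineq[of "r j" "blinfun_apply (G j) (y j)"] by simp
    qed (use g0 in auto)
    thus ?thesis by simp
  qed
  have bj: "norm (?b j) \<le> norm (s j) + norm (\<mu> j) / 4 + q * norm (y j)" if j: "j \<in> {1..N}" for j
  proof -
    have e: "?b j = px (s j) - px (adj (G j) (\<mu> j)) - px (Q j (y j))"
      unfolding s[OF j] by (simp add: linear_add[OF lin_px])
    have "norm (px (Q j (y j))) \<le> q * norm (y j)" using norm_px_le Q[OF j] order_trans by blast
    thus ?thesis unfolding e using A3[OF j, of "\<mu> j"] norm_px_le[of "s j"]
      norm_triangle_ineq4[of "px (s j) - px (adj (G j) (\<mu> j))" "px (Q j (y j))"]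
      norm_triangle_ineq4[of "px (s j)" "px (adj (G j) (\<mu> j))"] by linarith
  qed
  show B: "?B \<le> ?S + ?M / 4 + q * ?Y"
  proof -
    have "?B \<le> 1 * wnorm N (\<lambda>j. norm (s j) + norm (\<mu> j) / 4) + q * ?Y"
    proof (rule wnorm_triangle)
      fix j assume "j \<in> {1..N}"
      from bj[OF this] show "norm (?b j) \<le> 1 * norm (norm (s j) + norm (\<mu> j) / 4) + q * norm (y j)" by simp
    qed (use q0 in auto)
    moreover have "wnorm N (\<lambda>j. norm (s j) + norm (\<mu> j) / 4) \<le> 1 * ?S + 1/4 * ?M"
      by (rule wnorm_triangle) auto
    ultimately show ?thesis by simp
  qed
  have M0: "?M \<le> 2 * \<pi> * ?A + 2 * ?B"
  proof -
    have "?M \<le> sqrt 2 * (\<pi> * (sqrt 2 * ?A) + sqrt 2 * ?B)"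
    proof (rule wnorm_le[OF N])
      fix j assume j: "j \<in> {1..N}"
      have "norm (P (primal N a 1)) \<le> \<pi> * (sqrt 2 * ?A)"
        using Pi(1)[of "primal N a 1"] norm_primal_le[OF N, of 1 a] pi0 by (meson atLeastAtMost_iff le_numeral_extra(4) mult_left_mono neg_le_iff_le order_trans zero_le_one le_minus_one_simps(3) le_minus_one_simps(1))
      thus "norm (\<mu> j) \<le> \<pi> * (sqrt 2 * ?A) + sqrt 2 * ?B"
        using norm_dual_le[OF N \<tau>[OF j], of ?b] unfolding \<mu>
        using norm_triangle_ineq4[of "P (primal N a 1)" "dual N ?b (?\<tau> j)"] by linarith
    qed (use pi0 in simp)
    also have "\<dots> = 2 * \<pi> * ?A + 2 * ?B" by (simp add: algebra_simps)
    finally show ?thesis .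
  qed
  show M: "?M \<le> 4 * \<pi> * ?R + (4 * \<pi> * g + 4 * q) * ?Y + 4 * ?S"
  proof -
    have "2 * \<pi> * ?A \<le> 2 * \<pi> * (?R + g * ?Y)" using A pi0 by (intro mult_left_mono) auto
    moreover have "2 * ?B \<le> 2 * (?S + ?M / 4 + q * ?Y)" using B by simp
    \<comment> \<open>\<open>?M\<close> occurs on the right with factor 2/4 = 1/2; absorbing it
      doubles the other constants.\<close>
    ultimately have "?M \<le> 2 * \<pi> * (?R + g * ?Y) + 2 * (?S + ?M / 4 + q * ?Y)" using M0 by (meson add_mono order_trans)
    thus ?thesis by (simp add: algebra_simps)
  qed
  show "?Y \<le> (1 + (5 + 8 * \<pi> + 4 * \<pi> * g + 4 * q) / \<alpha>) * (?R + ?S)"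
  \<comment> \<open>In the first case the claim is immediate. Otherwise \<open>?R\<close> and
    \<open>?S\<close> are at most \<open>?Y\<close>, which makes the bound for \<open>?M\<close>
    linear in \<open>?Y\<close>, and the energy inequality can be divided by
    \<open>?Y\<close>.\<close>
  proof (cases "?Y \<le> ?R + ?S")
    case True
    have "0 \<le> (5 + 8 * \<pi> + 4 * \<pi> * g + 4 * q) / \<alpha> * (?R + ?S)"
      using \<alpha> pi0 g0 q0 by (intro mult_nonneg_nonneg divide_nonneg_pos add_nonneg_nonneg) auto
    thus ?thesis using True by (simp add: distrib_right)
  next
    case False
    let ?T = "?R + ?S"
    have T: "?T \<ge> 0" "?R \<le> ?T" "?S \<le> ?T" "?T \<le> ?Y" using False by (auto simp: add_nonneg_nonneg)
    have Y: "?Y > 0" using False T(1) by linarith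
    have k0: "0 \<le> 4 * \<pi> * g + 4 * q" using pi0 g0 q0 by simp
    have "?M \<le> 4 * \<pi> * ?Y + (4 * \<pi> * g + 4 * q) * ?Y + 4 * ?Y"
      using M T pi0 mult_left_mono[of ?R ?Y "4 * \<pi>"] by linarith
    hence "?M \<le> (4 * \<pi> + (4 * \<pi> * g + 4 * q) + 4) * ?Y" by (simp add: algebra_simps)
    hence "?M * ?R \<le> ((4 * \<pi> + (4 * \<pi> * g + 4 * q) + 4) * ?Y) * ?T"
      using T pi0 k0 Y by (intro mult_mono) auto
    moreover have "?S * ?Y \<le> ?T * ?Y" using T Y by (intro mult_right_mono) auto
    ultimately have "\<alpha> * ?Y\<^sup>2 \<le> ?T * ?Y + ((4 * \<pi> + (4 * \<pi> * g + 4 * q) + 4) * ?Y) * ?T" using energy by linarith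
    also have "\<dots> = (5 + 4 * \<pi> + 4 * \<pi> * g + 4 * q) * ?T * ?Y" by (simp add: algebra_simps)
    also have "\<dots> \<le> (5 + 8 * \<pi> + 4 * \<pi> * g + 4 * q) * ?T * ?Y"
      using T Y pi0 by (intro mult_right_mono) auto
    finally have "(\<alpha> * ?Y) * ?Y \<le> ((5 + 8 * \<pi> + 4 * \<pi> * g + 4 * q) * ?T) * ?Y" by (simp add: power2_eq_square mult_ac)
    hence "\<alpha> * ?Y \<le> (5 + 8 * \<pi> + 4 * \<pi> * g + 4 * q) * ?T" using Y by simp
    hence "?Y \<le> (5 + 8 * \<pi> + 4 * \<pi> * g + 4 * q) / \<alpha> * ?T" using \<alpha> by (simp add: pos_le_divide_eq mult.commute)
    thus ?thesis by (subst distrib_right, intro add_increasing) (use T(1) in simp_all)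
  qed
qed

text \<open>Passage from the weighted norm to the sup norm. Trajectory and multiplier are integrals,
  hence bounded at every node by the weighted bounds; the control at a node follows from coercivity
  at that node alone; the derivatives are then read off from the two equations. The constant is
  fixed before \<open>N\<close> and all the data.\<close>

theorem LQ_stability:
  assumes \<alpha>: "\<alpha> > 0" and g0: "g \<ge> 0" and q0: "q \<ge> 0" and pi0: "\<pi> \<ge> 0"
  shows "\<exists>\<kappa>>0. \<forall>N G Q P a p K. N \<ge> 1 \<longrightarrow>
    (\<forall>j\<in>{1..N}. norm (G j) \<le> g \<and> linear (Q j) \<and> (\<forall>h. norm (Q j h) \<le> q * norm h \<and> \<alpha> * (norm h)\<^sup>2 \<le> h \<bullet> Q j h) \<and>
        (\<forall>\<mu>. norm (px (adj (G j) \<mu>)) \<le> norm \<mu> / 4)) \<longrightarrow>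
    (\<forall>h. norm (P h) \<le> \<pi> * norm h \<and> 0 \<le> h \<bullet> P h) \<longrightarrow>
    (\<forall>j\<in>{1..N}. norm (a j - blinfun_apply (G j) (traj N a p j)) \<le> K \<and>
       norm (ix (px (p j)) + adj (G j) (P (primal N a 1) - dual N (\<lambda>i. px (p i)) (gauss_node N j)) + Q j (traj N a p j)) \<le> K) \<longrightarrow>
    (\<forall>j\<in>{1..N}. norm (a j) \<le> \<kappa> * K \<and> norm (p j) \<le> \<kappa> * K)"
proof -
  \<comment> \<open>\<open>cY\<close>, \<open>cA\<close>, \<open>cM\<close>, \<open>cB\<close> are
    for the weighted norms of \<open>y\<close>, \<open>a\<close>, \<mu> and the costate derivative;
    \<open>m\<close>, \<open>d\<close>, \<open>yy\<close> are for \<mu>, the control part and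
    \<open>y\<close> at one node. The factor \<open>2 * sqrt 2\<close> bounds the weighted norms of
    two residuals of size 1.\<close>
  define cY where "cY = (1 + (5 + 8 * \<pi> + 4 * \<pi> * g + 4 * q) / \<alpha>) * (2 * sqrt 2)"
  define cA where "cA = sqrt 2 + g * cY"
  define cM where "cM = 4 * \<pi> * sqrt 2 + (4 * \<pi> * g + 4 * q) * cY + 4 * sqrt 2"
  define cB where "cB = sqrt 2 + cM / 4 + q * cY"
  define m where "m = \<pi> * (sqrt 2 * cA) + sqrt 2 * cB"
  define d where "d = (1 + g * m + q * (sqrt 2 * cA)) / \<alpha>"
  define yy where "yy = sqrt 2 * cA + d"
  define \<kappa> where "\<kappa> = (1 + g * yy) + (1 + m / 4 + q * yy + d)"
  have nn: "cY \<ge> 0" "cA \<ge> 0" "cM \<ge> 0" "cB \<ge> 0" "m \<ge> 0" "d \<ge> 0" "yy \<ge> 0"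
  proof -
    show 1: "cY \<ge> 0" using assms by (simp add: cY_def)
    show 2: "cA \<ge> 0" using assms 1 by (simp add: cA_def)
    show 3: "cM \<ge> 0" using assms 1 by (simp add: cM_def)
    show 4: "cB \<ge> 0" using assms 1 3 by (simp add: cB_def)
    show 5: "m \<ge> 0" using assms 2 4 by (simp add: m_def)
    show 6: "d \<ge> 0" using assms 2 5 by (simp add: d_def)
    show "yy \<ge> 0" using 2 6 by (simp add: yy_def)
  qed
  have "\<kappa> > 0" using assms nn by (auto simp: \<kappa>_def intro!: add_pos_nonneg)
  moreover have "norm (a j) \<le> \<kappa> * K \<and> norm (p j) \<le> \<kappa> * K"
    if N: "N \<ge> 1" and
      G: "\<forall>j\<in>{1..N}. norm (G j) \<le> g \<and> linear (Q j) \<and> (\<forall>h. norm (Q j h) \<le> q * norm h \<and> \<alpha> * (norm h)\<^sup>2 \<le> h \<bullet> Q j h) \<and>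
        (\<forall>\<mu>. norm (px (adj (G j) \<mu>)) \<le> norm \<mu> / 4)" and
      P: "\<forall>h. norm (P h) \<le> \<pi> * norm h \<and> 0 \<le> h \<bullet> P h" and
      K: "\<forall>j\<in>{1..N}. norm (a j - blinfun_apply (G j) (traj N a p j)) \<le> K \<and>
       norm (ix (px (p j)) + adj (G j) (P (primal N a 1) - dual N (\<lambda>i. px (p i)) (gauss_node N j)) + Q j (traj N a p j)) \<le> K" and
      j: "j \<in> {1..N}" for N G Q P a p K j
  proof -
    define y where "y j = traj N a p j" for j
    define \<mu> where "\<mu> j = P (primal N a 1) - dual N (\<lambda>i. px (p i)) (gauss_node N j)" for j
    define r where "r j = a j - blinfun_apply (G j) (y j)" for j
    define s where "s j = ix (px (p j)) + adj (G j) (\<mu> j) + Q j (y j)" for j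
    have rs: "norm (r j) \<le> K" "norm (s j) \<le> K" if "j \<in> {1..N}" for j
      using K that unfolding r_def s_def \<mu>_def y_def by auto
    have K0: "K \<ge> 0" using rs(1)[OF j] norm_ge_zero order_trans by blast
    have "wnorm N r \<le> sqrt 2 * K" "wnorm N s \<le> sqrt 2 * K" by (intro wnorm_le N K0 rs; assumption)+
    hence R: "wnorm N r \<le> sqrt 2 * K" and S: "wnorm N s \<le> sqrt 2 * K" and RS: "wnorm N r + wnorm N s \<le> 2 * sqrt 2 * K" by simp_all
    note L = LQ_energy[where G=G and Q=Q and P=P and a=a and p=p and y=y and \<mu>=\<mu> and r=r and s=s, OF N \<alpha> g0 q0 pi0 _ _ _ _ _ _ y_def \<mu>_def r_def s_def]
    have Y: "wnorm N y \<le> cY * K"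
    proof -
      have "wnorm N y \<le> (1 + (5 + 8 * \<pi> + 4 * \<pi> * g + 4 * q) / \<alpha>) * (wnorm N r + wnorm N s)"
        by (rule L(1)) (use G P in auto)
      also have "\<dots> \<le> (1 + (5 + 8 * \<pi> + 4 * \<pi> * g + 4 * q) / \<alpha>) * (2 * sqrt 2 * K)"
        using RS assms by (intro mult_left_mono) auto
      finally show ?thesis by (simp add: cY_def mult_ac)
    qed
    have A: "wnorm N a \<le> cA * K"
    proof -
      have "wnorm N a \<le> wnorm N r + g * wnorm N y" by (rule L(2)) (use G P in auto)
      also have "\<dots> \<le> sqrt 2 * K + g * (cY * K)" using R Y g0 by (intro add_mono mult_left_mono)
      finally show ?thesis by (simp add: cA_def algebra_simps)
    qed
    have M: "wnorm N \<mu> \<le> cM * K"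
    proof -
      have "wnorm N \<mu> \<le> 4 * \<pi> * wnorm N r + (4 * \<pi> * g + 4 * q) * wnorm N y + 4 * wnorm N s"
        by (rule L(4)) (use G P in auto)
      also have "\<dots> \<le> 4 * \<pi> * (sqrt 2 * K) + (4 * \<pi> * g + 4 * q) * (cY * K) + 4 * (sqrt 2 * K)"
        using R S Y assms by (intro add_mono mult_left_mono) auto
      finally show ?thesis by (simp add: cM_def algebra_simps)
    qed
    have B: "wnorm N (\<lambda>j. px (p j)) \<le> cB * K"
    proof -
      have "wnorm N (\<lambda>j. px (p j)) \<le> wnorm N s + wnorm N \<mu> / 4 + q * wnorm N y"
        by (rule L(3)) (use G P in auto)
      also have "\<dots> \<le> sqrt 2 * K + cM * K / 4 + q * (cY * K)"
        using S M Y q0 by (intro add_mono mult_left_mono divide_right_mono) auto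
      finally show ?thesis by (simp add: cB_def algebra_simps)
    qed
    have \<tau>: "gauss_node N j \<in> {-1..1}" using gauss_node_bounds[OF j] by auto
    let ?x = "primal N a (gauss_node N j)"
    have pa: "norm (primal N a t) \<le> sqrt 2 * cA * K" if "t \<in> {-1..1}" for t
    proof -
      have "sqrt 2 * wnorm N a \<le> sqrt 2 * (cA * K)" by (rule mult_left_mono[OF A]) simp
      thus ?thesis using norm_primal_le[OF N that, of a] by (simp only: mult.assoc)
    qed
    have m: "norm (\<mu> j) \<le> m * K"
    proof -
      have "norm (P (primal N a 1)) \<le> \<pi> * norm (primal N a 1)" using P by blast
      also have "\<dots> \<le> \<pi> * (sqrt 2 * cA * K)" using pi0 by (intro mult_left_mono pa) auto
      finally have "norm (P (primal N a 1)) \<le> \<pi> * (sqrt 2 * cA * K)" .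
      moreover have "sqrt 2 * wnorm N (\<lambda>j. px (p j)) \<le> sqrt 2 * (cB * K)" by (rule mult_left_mono[OF B]) simp
      hence "norm (dual N (\<lambda>i. px (p i)) (gauss_node N j)) \<le> sqrt 2 * (cB * K)"
        using norm_dual_le[OF N \<tau>, of "\<lambda>i. px (p i)"] order_trans by blast
      ultimately show ?thesis unfolding \<mu>_def m_def
        using norm_triangle_ineq4[of "P (primal N a 1)" "dual N (\<lambda>i. px (p i)) (gauss_node N j)"]
        by (simp add: algebra_simps)
    qed
    have Gj: "norm (blinfun_apply (G j) h) \<le> g * norm h" for h
      using norm_blinfun[of "G j" h] G j by (meson mult_right_mono norm_ge_zero order_trans)
    let ?d = "pu (p j)"
    have yj: "y j = ix ?x + ?d" by (simp add: y_def traj_def)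
    have d: "norm ?d \<le> d * K"
    proof (cases "?d = 0")
      case False
      have lQ: "linear (Q j)" using G j by blast
      \<comment> \<open>Testing with \<open>?d\<close> removes the costate derivative, since
        \<open>pu\<close> is orthogonal to the range of \<open>ix\<close>; a coercive equation for
        the control remains.\<close>
      have "?d \<bullet> s j = \<mu> j \<bullet> blinfun_apply (G j) ?d + ?d \<bullet> Q j (ix ?x) + ?d \<bullet> Q j ?d"
        unfolding s_def yj linear_add[OF lQ] by (simp add: inner_add_right inner_commute[of ?d "adj _ _"] adj_inner)
      hence "?d \<bullet> Q j ?d = ?d \<bullet> s j - \<mu> j \<bullet> blinfun_apply (G j) ?d - ?d \<bullet> Q j (ix ?x)" by simp
      moreover have "\<bar>?d \<bullet> s j\<bar> \<le> norm ?d * K"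
        using Cauchy_Schwarz_ineq2[of ?d "s j"] rs(2)[OF j] by (meson mult_left_mono norm_ge_zero order_trans)
      moreover have "\<bar>\<mu> j \<bullet> blinfun_apply (G j) ?d\<bar> \<le> (m * K) * (g * norm ?d)"
        by (rule order_trans[OF Cauchy_Schwarz_ineq2 mult_mono[OF m Gj[of ?d]]]) (use nn K0 in auto)
      moreover have "\<bar>?d \<bullet> Q j (ix ?x)\<bar> \<le> norm ?d * (q * (sqrt 2 * cA * K))"
      proof -
        have "norm (Q j (ix ?x)) \<le> q * norm (ix ?x)" using G j by blast
        also have "\<dots> \<le> q * (sqrt 2 * cA * K)" using pa[OF \<tau>] q0 by (simp add: mult_left_mono)
        finally show ?thesis using Cauchy_Schwarz_ineq2[of ?d "Q j (ix ?x)"]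
          by (meson mult_left_mono norm_ge_zero order_trans)
      qed
      moreover have "\<alpha> * (norm ?d)\<^sup>2 \<le> ?d \<bullet> Q j ?d" using G j by blast
      ultimately have "\<alpha> * (norm ?d)\<^sup>2 \<le> norm ?d * K + (m * K) * (g * norm ?d) + norm ?d * (q * (sqrt 2 * cA * K))"
        by linarith
      also have "\<dots> = ((1 + g * m + q * (sqrt 2 * cA)) * K) * norm ?d" by (simp add: algebra_simps)
      finally have "(\<alpha> * norm ?d) * norm ?d \<le> ((1 + g * m + q * (sqrt 2 * cA)) * K) * norm ?d"
        by (simp add: power2_eq_square mult_ac)
      hence "\<alpha> * norm ?d \<le> (1 + g * m + q * (sqrt 2 * cA)) * K" using False by simp
      thus ?thesis using \<alpha> by (simp add: d_def pos_le_divide_eq mult_ac)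
    qed (use nn K0 in simp)
    have yb: "norm (y j) \<le> yy * K"
      using norm_triangle_ineq[of "ix ?x" ?d] pa[OF \<tau>] d unfolding yj yy_def by (simp add: algebra_simps)
    have "norm (a j) \<le> K + g * (yy * K)"
    proof -
      have e: "a j = r j + blinfun_apply (G j) (y j)" by (simp add: r_def)
      show ?thesis unfolding e using norm_triangle_ineq[of "r j" "blinfun_apply (G j) (y j)"] rs(1)[OF j] Gj[of "y j"]
          mult_left_mono[OF yb g0] by linarith
    qed
    moreover have "norm (px (p j)) \<le> K + m * K / 4 + q * (yy * K)"
    proof -
      have e: "px (p j) = px (s j) - px (adj (G j) (\<mu> j)) - px (Q j (y j))"
        unfolding s_def by (simp add: linear_add[OF lin_px])
      have "norm (px (Q j (y j))) \<le> q * norm (y j)" using norm_px_le G j order_trans by blast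
      moreover have "norm (px (adj (G j) (\<mu> j))) \<le> norm (\<mu> j) / 4" using G j by blast
      ultimately show ?thesis unfolding e using norm_px_le[of "s j"] rs(2)[OF j] m mult_left_mono[OF yb q0]
        norm_triangle_ineq4[of "px (s j) - px (adj (G j) (\<mu> j))" "px (Q j (y j))"]
        norm_triangle_ineq4[of "px (s j)" "px (adj (G j) (\<mu> j))"] by linarith
    qed
    moreover have "norm (p j) \<le> norm (px (p j)) + norm ?d"
      using norm_triangle_ineq[of "ix (px (p j))" ?d] by (simp add: pu_def)
    moreover have "K + g * (yy * K) \<le> \<kappa> * K" "K + m * K / 4 + q * (yy * K) + d * K \<le> \<kappa> * K"
    proof -
      have "0 \<le> g * (yy * K)" "0 \<le> m * K" "0 \<le> q * (yy * K)" "0 \<le> d * K" using nn K0 g0 q0 by auto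
      moreover have "\<kappa> * K = K + g * (yy * K) + (K + m * K / 4 + q * (yy * K) + d * K)"
        by (simp add: \<kappa>_def algebra_simps)
      ultimately show "K + g * (yy * K) \<le> \<kappa> * K" "K + m * K / 4 + q * (yy * K) + d * K \<le> \<kappa> * K"
        using K0 by linarith+
    qed
    ultimately show ?thesis using d by linarith
  qed
  ultimately show ?thesis by blast
qed

end

subsection \<open>Finite sequences as a Banach space and Newton's method\<close>

text \<open>\<open>N\<close> is a term, so the length cannot be put into a type. The sequences are
  embedded in the bounded functions on \<open>nat\<close>, all of which are continuous, with value 0
  off \<open>{1..N}\<close>; the norm there is the maximum over the nodes.\<close>

definition fseq :: "nat \<Rightarrow> (nat \<Rightarrow> 'e::euclidean_space) \<Rightarrow> (nat \<Rightarrow>\<^sub>C 'e)" where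
  "fseq N f = Bcontfun (\<lambda>i. if i \<in> {1..N} then f i else 0)"

lemma apply_fseq: "apply_bcontfun (fseq N f) i = (if i \<in> {1..N} then f i else 0)"
proof -
  have "(\<lambda>i. if i \<in> {1..N} then f i else 0) \<in> bcontfun"
  proof (rule bcontfun_normI)
    show "norm (if i \<in> {1..N} then f i else 0) \<le> (\<Sum>j=1..N. norm (f j))" for i
      by (auto intro: member_le_sum sum_nonneg)
  qed simp
  thus ?thesis unfolding fseq_def by (simp add: Bcontfun_inverse)
qed

definition fsub :: "nat \<Rightarrow> (nat \<Rightarrow>\<^sub>C 'e::euclidean_space) set" where
  "fsub N = {z. \<forall>i. i \<notin> {1..N} \<longrightarrow> apply_bcontfun z i = 0}"

lemma fseq_in_fsub [simp]: "fseq N f \<in> fsub N"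
  by (auto simp: fsub_def apply_fseq)

lemma subspace_fsub: "subspace (fsub N)"
  by (auto simp: subspace_def fsub_def)

lemma fsub_norm_le:
  assumes "z \<in> fsub N" "K \<ge> 0" "\<And>i. i \<in> {1..N} \<Longrightarrow> norm (apply_bcontfun z i) \<le> K"
  shows "norm z \<le> K"
proof (rule norm_bound)
  show "norm (apply_bcontfun z i) \<le> K" for i
    using assms by (cases "i \<in> {1..N}") (auto simp: fsub_def)
qed

lemma complete_fsub: "complete (fsub N :: (nat \<Rightarrow>\<^sub>C 'e::euclidean_space) set)"
  unfolding complete_def
proof (intro allI impI, elim conjE)
  fix \<sigma> :: "nat \<Rightarrow> (nat \<Rightarrow>\<^sub>C 'e)"
  assume \<sigma>: "\<forall>n. \<sigma> n \<in> fsub N" and C: "Cauchy \<sigma>"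
  have "Cauchy (\<lambda>n. apply_bcontfun (\<sigma> n) i)" for i
  proof (rule metric_CauchyI)
    fix e :: real assume "e > 0"
    then obtain M where "\<And>m n. m \<ge> M \<Longrightarrow> n \<ge> M \<Longrightarrow> dist (\<sigma> m) (\<sigma> n) < e" using C metric_CauchyD by blast
    thus "\<exists>M. \<forall>m\<ge>M. \<forall>n\<ge>M. dist (apply_bcontfun (\<sigma> m) i) (apply_bcontfun (\<sigma> n) i) < e"
      by (intro exI[of _ M] allI impI le_less_trans[OF dist_bounded])
  qed
  hence lim: "(\<lambda>n. apply_bcontfun (\<sigma> n) i) \<longlonglongrightarrow> lim (\<lambda>n. apply_bcontfun (\<sigma> n) i)" for i
    using Cauchy_convergent convergent_LIMSEQ_iff by blast
  define l where "l i = lim (\<lambda>n. apply_bcontfun (\<sigma> n) i)" for i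
  have "(\<lambda>n. norm (apply_bcontfun (\<sigma> n) i - l i)) \<longlonglongrightarrow> 0" for i
    using lim[of i] unfolding l_def by (simp add: LIM_zero tendsto_norm_zero)
  hence L: "(\<lambda>n. \<Sum>i=1..N. norm (apply_bcontfun (\<sigma> n) i - l i)) \<longlonglongrightarrow> 0"
    by (intro tendsto_null_sum)
  have bd: "norm (\<sigma> n - fseq N l) \<le> (\<Sum>i=1..N. norm (apply_bcontfun (\<sigma> n) i - l i))" for n
  proof (rule fsub_norm_le)
    show "\<sigma> n - fseq N l \<in> fsub N" using \<sigma> by (intro subspace_diff[OF subspace_fsub]) auto
    show "norm (apply_bcontfun (\<sigma> n - fseq N l) i) \<le> (\<Sum>i=1..N. norm (apply_bcontfun (\<sigma> n) i - l i))"
      if "i \<in> {1..N}" for i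
      using that member_le_sum[of i "{1..N}" "\<lambda>i. norm (apply_bcontfun (\<sigma> n) i - l i)"] by (simp add: apply_fseq)
  qed (simp add: sum_nonneg)
  have "(\<lambda>n. \<sigma> n - fseq N l) \<longlonglongrightarrow> 0"
    by (rule Lim_null_comparison[OF always_eventually[OF allI[OF bd]] L])
  hence "\<sigma> \<longlonglongrightarrow> fseq N l" by (rule LIM_zero_cancel)
  thus "\<exists>z\<in>fsub N. \<sigma> \<longlonglongrightarrow> z" by (rule bexI) (rule fseq_in_fsub)
qed

lemma apply_bcontfun_sum: "apply_bcontfun (\<Sum>a\<in>A. f a) x = (\<Sum>a\<in>A. apply_bcontfun (f a) x)"
  by (induction A rule: infinite_finite_induct) auto

lemma fsub_finite_span: "\<exists>B. finite B \<and> B \<subseteq> fsub N \<and> fsub N \<subseteq> span (B :: (nat \<Rightarrow>\<^sub>C 'e::euclidean_space) set)"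
proof -
  define b where "b = (\<lambda>(j, e::'e). fseq N (\<lambda>i. if i = j then e else 0))"
  let ?B = "b ` ({1..N} \<times> Basis)"
  have "z \<in> span ?B" if z: "z \<in> fsub N" for z
  proof -
    have "z = (\<Sum>j\<in>{1..N}. \<Sum>e\<in>Basis. (apply_bcontfun z j \<bullet> e) *\<^sub>R b (j, e))"
    proof (rule bcontfun_eqI)
      fix i
      show "apply_bcontfun z i = apply_bcontfun (\<Sum>j\<in>{1..N}. \<Sum>e\<in>Basis. (apply_bcontfun z j \<bullet> e) *\<^sub>R b (j, e)) i"
      proof (cases "i \<in> {1..N}")
        case True
        have "apply_bcontfun (\<Sum>j\<in>{1..N}. \<Sum>e\<in>Basis. (apply_bcontfun z j \<bullet> e) *\<^sub>R b (j, e)) i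
          = (\<Sum>j\<in>{1..N}. if j = i then (\<Sum>e\<in>Basis. (apply_bcontfun z i \<bullet> e) *\<^sub>R e) else 0)"
          unfolding apply_bcontfun_sum using True
          by (intro sum.cong refl) (auto simp: b_def apply_fseq apply_bcontfun_sum)
        thus ?thesis using True by (simp add: euclidean_representation)
      next
        case False
        thus ?thesis using z unfolding apply_bcontfun_sum by (auto simp: b_def apply_fseq fsub_def)
      qed
    qed
    moreover have "(\<Sum>j\<in>{1..N}. \<Sum>e\<in>Basis. (apply_bcontfun z j \<bullet> e) *\<^sub>R b (j, e)) \<in> span ?B"
      by (intro span_sum span_scale span_base) auto
    ultimately show ?thesis by simp
  qed
  thus ?thesis by (intro exI[of _ ?B]) (auto simp: b_def)
qed

text \<open>The ambient space may be infinite-dimensional, so the dimension count takes place inside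
  \<open>V\<close>: the image of a basis is independent, and a vector of \<open>V\<close> outside
  its span would give an independent set larger than the basis.\<close>

lemma linear_inj_imp_surj_on_finite_span:
  fixes T :: "'a::real_vector \<Rightarrow> 'a"
  assumes V: "subspace V" and B: "finite B" "B \<subseteq> V" "V \<subseteq> span B"
    and T: "linear T" "\<And>x. x \<in> V \<Longrightarrow> T x \<in> V" and inj: "\<And>x. x \<in> V \<Longrightarrow> T x = 0 \<Longrightarrow> x = 0"
    and y: "y \<in> V"
  shows "\<exists>x\<in>V. T x = y"
proof -
  obtain B' where B': "B' \<subseteq> B" "independent B'" "B \<subseteq> span B'"
    using maximal_independent_subset by blast
  have fB': "finite B'" using B' B finite_subset by blast
  have sp: "span B' = V"
  proof
    show "span B' \<subseteq> V" using B' B V by (intro span_minimal) auto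
    show "V \<subseteq> span B'" using B(3) B'(3) span_minimal[OF B'(3) subspace_span] by blast
  qed
  have injV: "inj_on T V"
  proof (rule inj_onI)
    fix u v assume uv: "u \<in> V" "v \<in> V" "T u = T v"
    have "u - v \<in> V" using V uv subspace_diff by blast
    moreover have "T (u - v) = 0" using uv by (simp add: linear_diff[OF T(1)])
    ultimately show "u = v" using inj[of "u - v"] by simp
  qed
  have ind: "independent (T ` B')"
    using linear_independent_injective_image[OF T(1) B'(2)] injV sp by simp
  have card: "card (T ` B') = card B'"
    using injV B' B(2) by (intro card_image) (meson inj_on_subset order_trans)
  have "y \<in> span (T ` B')"
  proof (rule ccontr)
    assume n: "y \<notin> span (T ` B')"
    hence "independent (insert y (T ` B'))" using ind independent_insert by metis
    moreover have "insert y (T ` B') \<subseteq> span B'" using y T(2) B' B(2) by (auto simp: sp)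
    ultimately have "card (insert y (T ` B')) \<le> card B'" using independent_span_bound[OF fB'] by blast
    moreover have "y \<notin> T ` B'" using n span_base[of y "T ` B'"] by argo
    ultimately show False using card fB' by simp
  qed
  hence "y \<in> T ` V" by (simp add: linear_span_image[OF T(1)] sp)
  thus ?thesis by (rule imageE) (rule bexI, rule sym)
qed

text \<open>Iteration of \<open>x - S (F x)\<close> with the fixed operator \<open>T\<close>:
  stability turns \<open>lin\<close> into the contraction factor 1/2. The first step has length at
  most half of the radius \<open>2 * \<kappa> * norm (F z0)\<close>, so the ball of this radius is
  mapped into itself.\<close>

lemma newton_contraction:
  fixes F T :: "'e::real_normed_vector \<Rightarrow> 'e"
  assumes V: "subspace V" "complete V" and T: "linear T"
    and surj: "\<And>y. y \<in> V \<Longrightarrow> \<exists>x\<in>V. T x = y"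
    and stab: "\<And>x. x \<in> V \<Longrightarrow> norm x \<le> \<kappa> * norm (T x)" and \<kappa>: "\<kappa> > 0"
    and F: "\<And>x. x \<in> V \<Longrightarrow> F x \<in> V"
    and z0: "z0 \<in> V" and small: "2 * \<kappa> * norm (F z0) \<le> r"
    and lin: "\<And>x y. x \<in> V \<Longrightarrow> y \<in> V \<Longrightarrow> norm (x - z0) \<le> r \<Longrightarrow> norm (y - z0) \<le> r \<Longrightarrow>
       norm (F x - F y - T (x - y)) \<le> norm (x - y) / (2 * \<kappa>)"
  shows "\<exists>z\<in>V. norm (z - z0) \<le> 2 * \<kappa> * norm (F z0) \<and> F z = 0"
proof -
  \<comment> \<open>A right inverse of \<open>T\<close> by choice; linearity of \<open>S\<close> is
    not at stake, since only images under \<open>T\<close> are estimated.\<close>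
  define S where "S y = (SOME x. x \<in> V \<and> T x = y)" for y
  have S: "S y \<in> V" "T (S y) = y" if "y \<in> V" for y
    using someI_ex[of "\<lambda>x. x \<in> V \<and> T x = y"] surj[OF that] unfolding S_def by auto
  define \<rho> where "\<rho> = 2 * \<kappa> * norm (F z0)"
  have \<rho>: "0 \<le> \<rho>" "\<rho> \<le> r" using \<kappa> small by (auto simp: \<rho>_def)
  define \<phi> where "\<phi> x = x - S (F x)" for x
  have \<phi>V: "\<phi> x \<in> V" if "x \<in> V" for x unfolding \<phi>_def using that S F V(1) by (intro subspace_diff) auto
  have contr: "norm (\<phi> x - \<phi> y) \<le> norm (x - y) / 2"
    if x: "x \<in> V" "norm (x - z0) \<le> r" and y: "y \<in> V" "norm (y - z0) \<le> r" for x y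
  proof -
    have "\<phi> x - \<phi> y \<in> V" using x y \<phi>V V(1) by (intro subspace_diff) auto
    moreover have "T (\<phi> x - \<phi> y) = - (F x - F y - T (x - y))"
      using S F x y unfolding \<phi>_def by (simp add: linear_diff[OF T])
    hence "norm (T (\<phi> x - \<phi> y)) \<le> norm (x - y) / (2 * \<kappa>)" using lin[OF x(1) y(1) x(2) y(2)] by (simp only: norm_minus_cancel)
    ultimately have "norm (\<phi> x - \<phi> y) \<le> \<kappa> * (norm (x - y) / (2 * \<kappa>))"
      using stab \<kappa> by (meson less_imp_le mult_left_mono order_trans)
    thus ?thesis using \<kappa> by simp
  qed
  have start: "norm (\<phi> z0 - z0) \<le> \<rho> / 2"
  proof -
    have "norm (S (F z0)) \<le> \<kappa> * norm (T (S (F z0)))" using S F z0 by (intro stab) auto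
    thus ?thesis using S F z0 by (simp add: \<phi>_def \<rho>_def)
  qed
  let ?s = "V \<inter> cball z0 \<rho>"
  have "complete ?s" using V(2) by (simp add: complete_Int_closed)
  moreover have "?s \<noteq> {}" using z0 \<rho> by auto
  moreover have "\<phi> ` ?s \<subseteq> ?s"
  proof (intro image_subsetI IntI)
    fix x assume x: "x \<in> ?s"
    show "\<phi> x \<in> V" using x \<phi>V by blast
    have "norm (x - z0) \<le> \<rho>" using x by (simp add: dist_norm norm_minus_commute)
    hence "norm (\<phi> x - \<phi> z0) \<le> \<rho> / 2" using contr[of x z0] x z0 \<rho> by simp
    hence "norm (\<phi> x - z0) \<le> \<rho>" using start norm_triangle_ineq[of "\<phi> x - \<phi> z0" "\<phi> z0 - z0"] by simp
    thus "\<phi> x \<in> cball z0 \<rho>" by (simp add: dist_norm norm_minus_commute)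
  qed
  moreover have "dist (\<phi> x) (\<phi> y) \<le> (1/2) * dist x y" if "x \<in> ?s" "y \<in> ?s" for x y
    using contr[of x y] that \<rho> by (simp add: dist_norm norm_minus_commute)
  ultimately have "\<exists>!x\<in>?s. \<phi> x = x" by (intro Banach_fix[where c="1/2"]) auto
  then obtain z where z: "z \<in> V" "dist z0 z \<le> \<rho>" "\<phi> z = z" by auto
  have "S (F z) = 0" using z(3) by (simp add: \<phi>_def)
  hence "F z = 0" using S(2)[OF F[OF z(1)]] linear_0[OF T] by simp
  thus ?thesis using z by (intro bexI[of _ z]) (auto simp: \<rho>_def dist_norm norm_minus_commute)
qed

subsection \<open>The discrete optimality system\<close>

lemma adj_add_left: "adj (A + B) l = adj A l + adj B l"
  by (rule vector_eq_rdot[THEN iffD1]) (simp add: adj_inner inner_add_left blinfun.add_left inner_add_right)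

lemma primal_add: "primal N (\<lambda>i. a i + b i) t = primal N a t + primal N b t"
  by (simp add: primal_def scaleR_add_right sum.distrib)
lemma primal_scale: "primal N (\<lambda>i. c *\<^sub>R a i) t = c *\<^sub>R primal N a t"
  by (simp add: primal_def scaleR_sum_right mult.commute)
lemma dual_add: "dual N (\<lambda>i. a i + b i) t = dual N a t + dual N b t"
  by (simp add: dual_def scaleR_add_right sum.distrib)
lemma dual_scale: "dual N (\<lambda>i. c *\<^sub>R a i) t = c *\<^sub>R dual N a t"
  by (simp add: dual_def scaleR_sum_right mult.commute)

context split_space
begin

lemma pu_add: "pu (w + w') = pu w + pu w'"
  by (simp add: pu_def linear_add[OF lin_px] linear_add[OF lin_ix])
lemma pu_scale: "pu (c *\<^sub>R w) = c *\<^sub>R pu w"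
  by (simp add: pu_def linear_scale[OF lin_px] linear_scale[OF lin_ix] scaleR_right_diff_distrib)

lemma traj_add: "traj N (\<lambda>i. a i + a' i) (\<lambda>i. p i + p' i) j = traj N a p j + traj N a' p' j"
  by (simp add: traj_def primal_add pu_add linear_add[OF lin_ix])
lemma traj_scale: "traj N (\<lambda>i. c *\<^sub>R a i) (\<lambda>i. c *\<^sub>R p i) j = c *\<^sub>R traj N a p j"
  by (simp add: traj_def primal_scale pu_scale linear_scale[OF lin_ix] scaleR_add_right)
lemma traj_diff: "traj N (\<lambda>i. a i - a' i) (\<lambda>i. p i - p' i) j = traj N a p j - traj N a' p' j"
  by (simp add: traj_def primal_diff pu_diff linear_diff[OF lin_ix])

lemma norm_traj_le:
  assumes "N \<ge> 1" "D \<ge> 0" "\<And>i. i \<in> {1..N} \<Longrightarrow> norm (a i) \<le> D \<and> norm (p i) \<le> D" "j \<in> {1..N}"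
  shows "norm (traj N a p j) \<le> 3 * D"
proof -
  have t: "gauss_node N j \<in> {-1..1}" using gauss_node_bounds[OF assms(4)] by auto
  have "norm (primal N a (gauss_node N j)) \<le> 2 * D" using assms by (intro sup_primal_dual_le t) auto
  moreover have "norm (pu (p j)) \<le> D" using norm_pu_le assms(3)[OF assms(4)] order_trans by blast
  ultimately show ?thesis unfolding traj_def
    using norm_triangle_ineq[of "ix (primal N a (gauss_node N j))" "pu (p j)"] by simp
qed

end

text \<open>The continuous solution: \<open>ws\<close> is state and control, \<open>ls\<close> the
  costate, \<open>xd\<close> and \<open>ld\<close> are the derivatives of state and costate,
  \<open>D2 t\<close> is the second derivative of \<open>f\<close> at \<open>ws t\<close>, and
  \<open>P\<close> the Hessian of the cost. In \<open>costate\<close> the \<open>px\<close> part is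
  the adjoint equation and the \<open>pu\<close> part stationarity in the control.
  \<open>lin_f\<close> and \<open>lin_C\<close> state strict differentiability, the former uniformly
  in \<open>t\<close>; this is what the contraction consumes.\<close>

locale ocp = split_space ix px for ix :: "'x::euclidean_space \<Rightarrow> 'w::euclidean_space" and px +
  fixes f :: "'w \<Rightarrow> 'x" and Df :: "'w \<Rightarrow> ('w \<Rightarrow>\<^sub>L 'x)" and D2 :: "real \<Rightarrow> 'w \<Rightarrow> ('w \<Rightarrow>\<^sub>L 'x)"
    and gC :: "'x \<Rightarrow> 'x" and P :: "'x \<Rightarrow> 'x"
    and ws :: "real \<Rightarrow> 'w" and ls xd ld :: "real \<Rightarrow> 'x" and \<alpha> g q \<pi> L :: real
  assumes cst: "\<alpha> > 0" "g \<ge> 0" "q \<ge> 0" "\<pi> \<ge> 0" "L \<ge> 0"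
    and G_le: "t \<in> {-1..1} \<Longrightarrow> norm (Df (ws t)) \<le> g"
    and D2_lin: "t \<in> {-1..1} \<Longrightarrow> linear (D2 t)"
    and D2_le: "t \<in> {-1..1} \<Longrightarrow> norm (D2 t h) \<le> q * norm h"
    and ls_le: "t \<in> {-1..1} \<Longrightarrow> norm (ls t) \<le> L"
    and coer: "t \<in> {-1..1} \<Longrightarrow> \<alpha> * (norm h)\<^sup>2 \<le> ls t \<bullet> blinfun_apply (D2 t h) h"
    and A3: "t \<in> {-1..1} \<Longrightarrow> norm (px (adj (Df (ws t)) \<mu>)) \<le> norm \<mu> / 4"
    and P_lin: "linear P" and P_le: "norm (P x) \<le> \<pi> * norm x" and P_pos: "0 \<le> x \<bullet> P x"
    and state: "t \<in> {-1..1} \<Longrightarrow> xd t = f (ws t)"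
    and costate: "t \<in> {-1..1} \<Longrightarrow> ix (ld t) + adj (Df (ws t)) (ls t) = 0"
    and end_costate: "ls 1 = gC (px (ws 1))"
    and lin_f: "\<delta> > 0 \<Longrightarrow> \<exists>r>0. \<forall>t\<in>{-1..1}. \<forall>w w'. norm (w - ws t) \<le> r \<longrightarrow> norm (w' - ws t) \<le> r \<longrightarrow>
       norm (f w - f w' - blinfun_apply (Df (ws t)) (w - w')) \<le> \<delta> * norm (w - w') \<and>
       norm (Df w - Df w' - D2 t (w - w')) \<le> \<delta> * norm (w - w')"
    and lin_C: "\<delta> > 0 \<Longrightarrow> \<exists>r>0. \<forall>x x'. norm (x - px (ws 1)) \<le> r \<longrightarrow> norm (x' - px (ws 1)) \<le> r \<longrightarrow>
       norm (gC x - gC x' - P (x - x')) \<le> \<delta> * norm (x - x')"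
begin

definition x1 :: "nat \<Rightarrow> (nat \<Rightarrow> 'x) \<Rightarrow> 'x" where "x1 N a = px (ws (-1)) + primal N a 1"

definition wt :: "nat \<Rightarrow> (nat \<Rightarrow> 'x) \<Rightarrow> (nat \<Rightarrow> 'w) \<Rightarrow> nat \<Rightarrow> 'w" where
  "wt N a p j = ix (px (ws (-1))) + traj N a p j"

definition lam :: "nat \<Rightarrow> (nat \<Rightarrow> 'x) \<Rightarrow> (nat \<Rightarrow> 'w) \<Rightarrow> real \<Rightarrow> 'x" where
  "lam N a p t = gC (x1 N a) - dual N (\<lambda>i. px (p i)) t"

definition pst :: "real \<Rightarrow> 'w" where "pst t = ix (ld t) + pu (ws t)"

definition res1 :: "nat \<Rightarrow> (nat \<Rightarrow> 'x) \<Rightarrow> (nat \<Rightarrow> 'w) \<Rightarrow> nat \<Rightarrow> 'x" where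
  "res1 N a p j = a j - f (wt N a p j)"

text \<open>Zero exactly when the discrete costate equation (its \<open>px\<close> part) and
  stationarity in the control (its \<open>pu\<close> part) hold at the node.\<close>

definition res2 :: "nat \<Rightarrow> (nat \<Rightarrow> 'x) \<Rightarrow> (nat \<Rightarrow> 'w) \<Rightarrow> nat \<Rightarrow> 'w" where
  "res2 N a p j = ix (px (p j)) + adj (Df (wt N a p j)) (lam N a p (gauss_node N j))"

definition lin1 :: "nat \<Rightarrow> (nat \<Rightarrow> 'x) \<Rightarrow> (nat \<Rightarrow> 'w) \<Rightarrow> nat \<Rightarrow> 'x" where
  "lin1 N a p j = a j - blinfun_apply (Df (ws (gauss_node N j))) (traj N a p j)"

text \<open>Product rule for \<open>adj (Df w) \<lambda>\<close>: the middle term varies the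
  multiplier, the last one varies \<open>Df\<close>. The coefficients are taken along the continuous
  solution, so the operator is the same for all iterates.\<close>

definition lin2 :: "nat \<Rightarrow> (nat \<Rightarrow> 'x) \<Rightarrow> (nat \<Rightarrow> 'w) \<Rightarrow> nat \<Rightarrow> 'w" where
  "lin2 N a p j = ix (px (p j)) + adj (Df (ws (gauss_node N j))) (P (primal N a 1) - dual N (\<lambda>i. px (p i)) (gauss_node N j))
     + adj (D2 (gauss_node N j) (traj N a p j)) (ls (gauss_node N j))"

definition defect :: "nat \<Rightarrow> real \<Rightarrow> bool" where
  "defect N \<epsilon> \<longleftrightarrow> (\<forall>t\<in>{-1..1}.
     norm (px (ws (-1)) + primal N (\<lambda>i. xd (gauss_node N i)) t - px (ws t)) \<le> \<epsilon> \<and>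
     norm (ls 1 - dual N (\<lambda>i. ld (gauss_node N i)) t - ls t) \<le> \<epsilon>)"

definition near :: "nat \<Rightarrow> real \<Rightarrow> (nat \<Rightarrow> 'x) \<Rightarrow> (nat \<Rightarrow> 'w) \<Rightarrow> bool" where
  "near N d a p \<longleftrightarrow> (\<forall>i\<in>{1..N}. norm (a i - xd (gauss_node N i)) \<le> d \<and> norm (p i - pst (gauss_node N i)) \<le> d)"

lemma px_pst [simp]: "px (pst t) = ld t"
  by (simp add: pst_def linear_add[OF lin_px])

lemma pu_pst [simp]: "pu (pst t) = pu (ws t)"
  by (simp add: pst_def pu_def linear_add[OF lin_px] linear_add[OF lin_ix] linear_diff[OF lin_px])

lemma linear_Q: "t \<in> {-1..1} \<Longrightarrow> linear (\<lambda>h. adj (D2 t h) l)"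
proof (rule linearI)
  fix h h' and r :: real assume t: "t \<in> {-1..1}"
  show "adj (D2 t (h + h')) l = adj (D2 t h) l + adj (D2 t h') l"
    by (rule vector_eq_rdot[THEN iffD1])
       (simp add: adj_inner linear_add[OF D2_lin[OF t]] blinfun.add_left inner_add_right inner_add_left)
  show "adj (D2 t (r *\<^sub>R h)) l = r *\<^sub>R adj (D2 t h) l"
    by (rule vector_eq_rdot[THEN iffD1])
       (simp add: adj_inner linear_scale[OF D2_lin[OF t]] blinfun.scaleR_left)
qed

lemma lin1_add: "lin1 N (\<lambda>i. a i + a' i) (\<lambda>i. p i + p' i) j = lin1 N a p j + lin1 N a' p' j"
  by (simp add: lin1_def traj_add blinfun.add_right)
lemma lin1_scale: "lin1 N (\<lambda>i. c *\<^sub>R a i) (\<lambda>i. c *\<^sub>R p i) j = c *\<^sub>R lin1 N a p j"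
  by (simp add: lin1_def traj_scale blinfun.scaleR_right scaleR_right_diff_distrib)

lemma lin2_add:
  assumes "j \<in> {1..N}"
  shows "lin2 N (\<lambda>i. a i + a' i) (\<lambda>i. p i + p' i) j = lin2 N a p j + lin2 N a' p' j"
proof -
  have t: "gauss_node N j \<in> {-1..1}" using gauss_node_bounds[OF assms] by auto
  show ?thesis unfolding lin2_def traj_add primal_add linear_add[OF P_lin] linear_add[OF lin_px] dual_add
      linear_add[OF lin_ix] linear_add[OF linear_Q[OF t]] add_diff_add adj_add_right
    by (simp only: ac_simps)
qed

lemma lin2_scale:
  assumes "j \<in> {1..N}"
  shows "lin2 N (\<lambda>i. c *\<^sub>R a i) (\<lambda>i. c *\<^sub>R p i) j = c *\<^sub>R lin2 N a p j"
proof -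
  have t: "gauss_node N j \<in> {-1..1}" using gauss_node_bounds[OF assms] by auto
  show ?thesis unfolding lin2_def traj_scale primal_scale linear_scale[OF P_lin] linear_scale[OF lin_px] dual_scale
      linear_scale[OF lin_ix] linear_scale[OF linear_Q[OF t]] scaleR_right_diff_distrib[symmetric] adj_scaleR_right
    by (simp only: scaleR_add_right)
qed

lemma stability:
  "\<exists>\<kappa>>0. \<forall>N a p K. N \<ge> 1 \<longrightarrow> (\<forall>j\<in>{1..N}. norm (lin1 N a p j) \<le> K \<and> norm (lin2 N a p j) \<le> K) \<longrightarrow>
    (\<forall>j\<in>{1..N}. norm (a j) \<le> \<kappa> * K \<and> norm (p j) \<le> \<kappa> * K)"
proof -
  have qL: "0 \<le> q * L" using cst by simp
  obtain \<kappa> where \<kappa>: "\<kappa> > 0" and H: "\<And>N G Q P a p K. N \<ge> 1 \<Longrightarrow>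
    (\<forall>j\<in>{1..N}. norm (G j) \<le> g \<and> linear (Q j) \<and> (\<forall>h. norm (Q j h) \<le> (q * L) * norm h \<and> \<alpha> * (norm h)\<^sup>2 \<le> h \<bullet> Q j h) \<and>
        (\<forall>\<mu>. norm (px (adj (G j) \<mu>)) \<le> norm \<mu> / 4)) \<Longrightarrow>
    (\<forall>h. norm (P h) \<le> \<pi> * norm h \<and> 0 \<le> h \<bullet> P h) \<Longrightarrow>
    (\<forall>j\<in>{1..N}. norm (a j - blinfun_apply (G j) (traj N a p j)) \<le> K \<and>
       norm (ix (px (p j)) + adj (G j) (P (primal N a 1) - dual N (\<lambda>i. px (p i)) (gauss_node N j)) + Q j (traj N a p j)) \<le> K) \<Longrightarrow>
    (\<forall>j\<in>{1..N}. norm (a j) \<le> \<kappa> * K \<and> norm (p j) \<le> \<kappa> * K)"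
    using LQ_stability[OF cst(1,2) qL cst(4)] by blast
  have "(\<forall>j\<in>{1..N}. norm (a j) \<le> \<kappa> * K \<and> norm (p j) \<le> \<kappa> * K)"
    if N: "N \<ge> 1" and K: "\<forall>j\<in>{1..N}. norm (lin1 N a p j) \<le> K \<and> norm (lin2 N a p j) \<le> K" for N a p K
  proof (rule H[OF N, where G="\<lambda>j. Df (ws (gauss_node N j))" and Q="\<lambda>j h. adj (D2 (gauss_node N j) h) (ls (gauss_node N j))" and P=P])
    have t: "gauss_node N j \<in> {-1..1}" if "j \<in> {1..N}" for j using gauss_node_bounds[OF that] by auto
    have "norm (adj (D2 t h) (ls t)) \<le> q * L * norm h" if "t \<in> {-1..1}" for t h
    proof -
      have "norm (adj (D2 t h) (ls t)) \<le> norm (D2 t h) * norm (ls t)" by (rule norm_adj_le)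
      also have "\<dots> \<le> (q * norm h) * L" using D2_le[OF that] ls_le[OF that] cst by (intro mult_mono) auto
      finally show ?thesis by (simp add: mult_ac)
    qed
    moreover have "\<alpha> * (norm h)\<^sup>2 \<le> h \<bullet> adj (D2 t h) (ls t)" if "t \<in> {-1..1}" for t h
      using coer[OF that] by (simp add: adj_inner inner_commute[of h])
    ultimately show "\<forall>j\<in>{1..N}. norm (Df (ws (gauss_node N j))) \<le> g \<and> linear (\<lambda>h. adj (D2 (gauss_node N j) h) (ls (gauss_node N j))) \<and>
       (\<forall>h. norm (adj (D2 (gauss_node N j) h) (ls (gauss_node N j))) \<le> (q * L) * norm h \<and>
            \<alpha> * (norm h)\<^sup>2 \<le> h \<bullet> adj (D2 (gauss_node N j) h) (ls (gauss_node N j))) \<and>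
        (\<forall>\<mu>. norm (px (adj (Df (ws (gauss_node N j))) \<mu>)) \<le> norm \<mu> / 4)"
      using t G_le linear_Q A3 by simp
    show "\<forall>h. norm (P h) \<le> \<pi> * norm h \<and> 0 \<le> h \<bullet> P h" using P_le P_pos by simp
    show "\<forall>j\<in>{1..N}. norm (a j - blinfun_apply (Df (ws (gauss_node N j))) (traj N a p j)) \<le> K \<and>
       norm (ix (px (p j)) + adj (Df (ws (gauss_node N j))) (P (primal N a 1) - dual N (\<lambda>i. px (p i)) (gauss_node N j)) + adj (D2 (gauss_node N j) (traj N a p j)) (ls (gauss_node N j))) \<le> K"
      using K unfolding lin1_def lin2_def .
  qed
  thus ?thesis using \<kappa> by blast
qed

text \<open>Integration from either end amplifies sup norms by at most 2; the third \<open>d\<close>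
  in the bound for \<open>wt\<close> is the control, which is not integrated.\<close>

lemma near_bounds:
  assumes N: "N \<ge> 1" and d: "0 \<le> d" "near N d a p" and def: "defect N \<epsilon>"
  shows "t \<in> {-1..1} \<Longrightarrow> norm (px (ws (-1)) + primal N a t - px (ws t)) \<le> \<epsilon> + 2 * d"
    and "j \<in> {1..N} \<Longrightarrow> norm (wt N a p j - ws (gauss_node N j)) \<le> \<epsilon> + 3 * d"
    and "t \<in> {-1..1} \<Longrightarrow> norm (ls 1 - dual N (\<lambda>i. px (p i)) t - ls t) \<le> \<epsilon> + 2 * d"
proof -
  let ?a = "\<lambda>i. xd (gauss_node N i)" and ?b = "\<lambda>i. ld (gauss_node N i)"
  have nr: "norm (a i - ?a i) \<le> d" "norm (p i - pst (gauss_node N i)) \<le> d" if "i \<in> {1..N}" for i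
    using d(2) that unfolding near_def by auto
  have A: "norm (px (ws (-1)) + primal N a t - px (ws t)) \<le> \<epsilon> + 2 * d" if t: "t \<in> {-1..1}" for t
  proof -
    have "norm (primal N a t - primal N ?a t) \<le> 2 * d"
      unfolding primal_diff[symmetric] by (intro sup_primal_dual_le N t d nr)
    moreover have "norm (px (ws (-1)) + primal N ?a t - px (ws t)) \<le> \<epsilon>" using def t unfolding defect_def by blast
    moreover have "px (ws (-1)) + primal N a t - px (ws t) = (px (ws (-1)) + primal N ?a t - px (ws t)) + (primal N a t - primal N ?a t)"
      by simp
    ultimately show ?thesis by (metis norm_triangle_mono)
  qed
  show "t \<in> {-1..1} \<Longrightarrow> norm (px (ws (-1)) + primal N a t - px (ws t)) \<le> \<epsilon> + 2 * d" by (rule A)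
  show "norm (wt N a p j - ws (gauss_node N j)) \<le> \<epsilon> + 3 * d" if j: "j \<in> {1..N}"
  proof -
    let ?t = "gauss_node N j"
    have t: "?t \<in> {-1..1}" using gauss_node_bounds[OF j] by auto
    have w: "ws ?t = ix (px (ws ?t)) + pu (ws ?t)" by (simp add: pu_def)
    have e: "wt N a p j - ws ?t = ix (px (ws (-1)) + primal N a ?t - px (ws ?t)) + pu (p j - pst ?t)"
      by (subst w) (simp add: wt_def traj_def linear_add[OF lin_ix] linear_diff[OF lin_ix] pu_diff)
    have "norm (pu (p j - pst ?t)) \<le> d" using norm_pu_le nr(2)[OF j] order_trans by blast
    thus ?thesis unfolding e
      using norm_triangle_ineq[of "ix (px (ws (-1)) + primal N a ?t - px (ws ?t))" "pu (p j - pst ?t)"] A[OF t] by simp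
  qed
  show "norm (ls 1 - dual N (\<lambda>i. px (p i)) t - ls t) \<le> \<epsilon> + 2 * d" if t: "t \<in> {-1..1}"
  proof -
    have "norm (px (p i) - ?b i) \<le> d" if "i \<in> {1..N}" for i
      using norm_px_le[of "p i - pst (gauss_node N i)"] nr(2)[OF that] by (simp add: linear_diff[OF lin_px])
    hence "norm (dual N (\<lambda>i. px (p i)) t - dual N ?b t) \<le> 2 * d"
      unfolding dual_diff[symmetric] by (intro sup_primal_dual_le N t d)
    moreover have "norm (ls 1 - dual N ?b t - ls t) \<le> \<epsilon>" using def t unfolding defect_def by blast
    moreover have e: "ls 1 - dual N (\<lambda>i. px (p i)) t - ls t = (ls 1 - dual N ?b t - ls t) - (dual N (\<lambda>i. px (p i)) t - dual N ?b t)"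
      by simp
    ultimately show ?thesis unfolding e
      using norm_triangle_ineq4[of "ls 1 - dual N ?b t - ls t" "dual N (\<lambda>i. px (p i)) t - dual N ?b t"] by linarith
  qed
qed

text \<open>Near the endpoint \<open>gC\<close> changes by at most \<pi> + 1 times the displacement,
  by \<open>C\<close> and \<delta> \<le> 1; the integrated part adds one more.\<close>

lemma lam_bound:
  assumes C: "\<And>x x'. norm (x - px (ws 1)) \<le> r \<Longrightarrow> norm (x' - px (ws 1)) \<le> r \<Longrightarrow>
       norm (gC x - gC x' - P (x - x')) \<le> \<delta> * norm (x - x')"
    and \<delta>: "\<delta> \<le> 1" and N: "N \<ge> 1" and d: "0 \<le> d" "near N d a p" and def: "defect N \<epsilon>" "0 \<le> \<epsilon>"
    and r: "\<epsilon> + 3 * d \<le> r" and t: "t \<in> {-1..1}"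
  shows "norm (lam N a p t - ls t) \<le> (\<pi> + 2) * (\<epsilon> + 2 * d)"
proof -
  let ?x = "x1 N a" and ?y = "px (ws 1)"
  have x: "norm (?x - ?y) \<le> \<epsilon> + 2 * d"
    unfolding x1_def using near_bounds(1)[OF N d def(1), of 1] by simp
  have "norm (gC ?x - gC ?y - P (?x - ?y)) \<le> \<delta> * norm (?x - ?y)"
    using x r d def(2) by (intro C) auto
  also have "\<dots> \<le> 1 * norm (?x - ?y)" using \<delta> by (intro mult_right_mono) auto
  finally have "norm (gC ?x - gC ?y) \<le> \<pi> * norm (?x - ?y) + norm (?x - ?y)"
    using P_le[of "?x - ?y"] norm_triangle_ineq[of "gC ?x - gC ?y - P (?x - ?y)" "P (?x - ?y)"] by simp
  also have "\<dots> = (\<pi> + 1) * norm (?x - ?y)" by (simp add: distrib_right)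
  also have "\<dots> \<le> (\<pi> + 1) * (\<epsilon> + 2 * d)" using x cst by (intro mult_left_mono) auto
  finally have A: "norm (gC ?x - gC ?y) \<le> (\<pi> + 1) * (\<epsilon> + 2 * d)" .
  have B: "norm (ls 1 - dual N (\<lambda>i. px (p i)) t - ls t) \<le> \<epsilon> + 2 * d" by (rule near_bounds(3)[OF N d def(1) t])
  have e: "lam N a p t - ls t = (gC ?x - gC ?y) + (ls 1 - dual N (\<lambda>i. px (p i)) t - ls t)"
    by (simp add: lam_def end_costate)
  have "norm (lam N a p t - ls t) \<le> (\<pi> + 1) * (\<epsilon> + 2 * d) + (\<epsilon> + 2 * d)"
    unfolding e by (rule norm_triangle_mono[OF A B])
  thus ?thesis by (simp add: algebra_simps)
qed

lemma wt_diff: "wt N a p j - wt N a' p' j = traj N (\<lambda>i. a i - a' i) (\<lambda>i. p i - p' i) j"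
  by (simp add: wt_def traj_diff)

text \<open>The three sources of error in linearizing \<open>Df(w)\<^sup>T \<lambda>\<close>: the change of \<open>Df\<close>
  against the change of the multiplier, the nonlinearity of \<open>gC\<close>, and the second-order term.\<close>

lemma residual_linearization:
  assumes \<delta>: "0 < \<delta>" "\<delta> \<le> 1"
  shows "\<exists>s>0. \<forall>N \<epsilon> a p a' p' D j. N \<ge> 1 \<longrightarrow> 0 \<le> \<epsilon> \<longrightarrow> \<epsilon> \<le> s \<longrightarrow> defect N \<epsilon> \<longrightarrow> near N s a p \<longrightarrow> near N s a' p' \<longrightarrow>
    0 \<le> D \<longrightarrow> (\<forall>i\<in>{1..N}. norm (a i - a' i) \<le> D \<and> norm (p i - p' i) \<le> D) \<longrightarrow> j \<in> {1..N} \<longrightarrow>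
    norm (res1 N a p j - res1 N a' p' j - lin1 N (\<lambda>i. a i - a' i) (\<lambda>i. p i - p' i) j) \<le> \<delta> * (3 * D) \<and>
    norm (res2 N a p j - res2 N a' p' j - lin2 N (\<lambda>i. a i - a' i) (\<lambda>i. p i - p' i) j)
       \<le> \<delta> * ((2 * \<pi> + 7 + 2 * g + 3 * q + 3 * L) * D)"
proof -
  obtain r1 where r1: "r1 > 0" "\<And>t w w'. t \<in> {-1..1} \<Longrightarrow> norm (w - ws t) \<le> r1 \<Longrightarrow> norm (w' - ws t) \<le> r1 \<Longrightarrow>
       norm (f w - f w' - blinfun_apply (Df (ws t)) (w - w')) \<le> \<delta> * norm (w - w') \<and>
       norm (Df w - Df w' - D2 t (w - w')) \<le> \<delta> * norm (w - w')"
    using lin_f[OF \<delta>(1)] by blast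
  obtain r2 where r2: "r2 > 0" "\<And>x x'. norm (x - px (ws 1)) \<le> r2 \<Longrightarrow> norm (x' - px (ws 1)) \<le> r2 \<Longrightarrow>
       norm (gC x - gC x' - P (x - x')) \<le> \<delta> * norm (x - x')"
    using lin_C[OF \<delta>(1)] by blast
  define r where "r = min (min r1 r2) (\<delta> / (q + 1))"
  have q1: "q + 1 > 0" "\<pi> + 3 > 0" using cst by auto
  have r: "r > 0" "r \<le> r1" "r \<le> r2" "(q + 1) * r \<le> \<delta>"
  proof -
    show "r > 0" "r \<le> r1" "r \<le> r2" using r1 r2 \<delta> q1 by (auto simp: r_def)
    have "r \<le> \<delta> / (q + 1)" by (simp add: r_def)
    thus "(q + 1) * r \<le> \<delta>" using q1 by (simp add: pos_le_divide_eq mult.commute)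
  qed
  \<comment> \<open>Chosen so that \<open>\<epsilon> + 3 * s \<le> 4 * s \<le> r\<close> keeps
    trajectories inside the linearization radius and
    \<open>(\<pi> + 2) * (3 * s) \<le> \<delta>\<close> keeps multipliers within \<delta> of
    \<open>ls\<close>.\<close>
  define s where "s = min r \<delta> / (4 * (\<pi> + 3))"
  have s: "s > 0" using r \<delta> q1 by (simp add: s_def)
  have s': "4 * (\<pi> + 3) * s \<le> r" "4 * (\<pi> + 3) * s \<le> \<delta>" using q1 by (auto simp: s_def)
  have \<pi>s: "0 \<le> \<pi> * s" using cst s by simp
  have s4: "4 * s \<le> r" "(\<pi> + 2) * (3 * s) \<le> \<delta>"
    using s' s \<pi>s by (simp_all add: algebra_simps)
  show ?thesis
  proof (intro exI[of _ s] conjI s allI impI)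
    fix N \<epsilon> a p a' p' D j
    assume N: "N \<ge> 1" and \<epsilon>: "0 \<le> \<epsilon>" "\<epsilon> \<le> s" and def: "defect N \<epsilon>" and n: "near N s a p" "near N s a' p'"
      and D: "0 \<le> D" "\<forall>i\<in>{1..N}. norm (a i - a' i) \<le> D \<and> norm (p i - p' i) \<le> D" and j: "j \<in> {1..N}"
    let ?t = "gauss_node N j"
    let ?da = "\<lambda>i. a i - a' i" and ?dp = "\<lambda>i. p i - p' i"
    let ?w = "wt N a p j" and ?w' = "wt N a' p' j"
    define dw where "dw = traj N ?da ?dp j"
    define G where "G = Df (ws ?t)"
    have t: "?t \<in> {-1..1}" using gauss_node_bounds[OF j] by auto
    have s0: "0 \<le> s" using s by simp
    have sr: "\<epsilon> + 3 * s \<le> r" using \<epsilon> s4 by simp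
    have w: "norm (?w - ws ?t) \<le> r1" "norm (?w' - ws ?t) \<le> r1" "norm (?w - ws ?t) \<le> r"
      using near_bounds(2)[OF N s0 n(1) def j] near_bounds(2)[OF N s0 n(2) def j] sr r by auto
    have dww: "?w - ?w' = dw" unfolding dw_def by (rule wt_diff)
    have dwD: "norm dw \<le> 3 * D" unfolding dw_def using D by (intro norm_traj_le[OF N _ _ j]) auto
    have F: "norm (f ?w - f ?w' - blinfun_apply G dw) \<le> \<delta> * norm dw"
       "norm (Df ?w - Df ?w' - D2 ?t dw) \<le> \<delta> * norm dw"
      using r1(2)[OF t w(1,2)] unfolding dww G_def by auto
    have \<delta>dw: "\<delta> * norm dw \<le> \<delta> * (3 * D)" using dwD \<delta> by simp
    have e1: "res1 N a p j - res1 N a' p' j - lin1 N ?da ?dp j = - (f ?w - f ?w' - blinfun_apply G dw)"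
      by (simp add: res1_def lin1_def dw_def G_def)
    show "norm (res1 N a p j - res1 N a' p' j - lin1 N ?da ?dp j) \<le> \<delta> * (3 * D)"
      unfolding e1 norm_minus_cancel using F(1) \<delta>dw by linarith
    let ?l = "lam N a p ?t" and ?l' = "lam N a' p' ?t"
    define \<mu> where "\<mu> = P (primal N ?da 1) - dual N (\<lambda>i. px (?dp i)) ?t"
    define e where "e = ?l - ?l' - \<mu>"
    have pD: "norm (primal N ?da 1) \<le> 2 * D" using D by (intro sup_primal_dual_le N) auto
    have xx: "x1 N a - x1 N a' = primal N ?da 1" by (simp add: x1_def primal_diff)
    have "e = gC (x1 N a) - gC (x1 N a') - P (x1 N a - x1 N a')"
      unfolding xx by (simp add: e_def lam_def \<mu>_def linear_diff[OF lin_px] dual_diff)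
    moreover have "norm (x1 N b - px (ws 1)) \<le> r2" if "near N s b p''" for b p''
      using near_bounds(1)[OF N s0 that def, of 1] s \<epsilon> sr r unfolding x1_def by auto
    ultimately have "norm e \<le> \<delta> * norm (primal N ?da 1)"
      using r2(2)[of "x1 N a" "x1 N a'"] n xx by metis
    also have "\<dots> \<le> \<delta> * (2 * D)" using pD \<delta> by simp
    finally have e: "norm e \<le> \<delta> * (2 * D)" .
    have "norm \<mu> \<le> \<pi> * (2 * D) + 2 * D"
    proof -
      have "norm (P (primal N ?da 1)) \<le> \<pi> * (2 * D)" using P_le[of "primal N ?da 1"] pD cst by (meson mult_left_mono order_trans)
      moreover have "norm (px (?dp i)) \<le> D" if "i \<in> {1..N}" for i
        using norm_px_le[of "?dp i"] D(2) that order_trans by blast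
      hence "norm (dual N (\<lambda>i. px (?dp i)) ?t) \<le> 2 * D" by (intro sup_primal_dual_le N t D(1))
      ultimately show ?thesis unfolding \<mu>_def using norm_triangle_ineq4[of "P (primal N ?da 1)" "dual N (\<lambda>i. px (?dp i)) ?t"] by linarith
    qed
    moreover have "?l - ?l' = \<mu> + e" by (simp add: e_def)
    moreover have "\<delta> * (2 * D) \<le> 1 * (2 * D)" using \<delta> D by (intro mult_right_mono) auto
    ultimately have ll: "norm (?l - ?l') \<le> (2 * \<pi> + 4) * D"
      using norm_triangle_ineq[of \<mu> e] e by (simp add: algebra_simps)
    have C2: "norm (gC x - gC x' - P (x - x')) \<le> \<delta> * norm (x - x')"
      if "norm (x - px (ws 1)) \<le> r" "norm (x' - px (ws 1)) \<le> r" for x x'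
      using r2(2) that r(3) by (meson order_trans)
    have l': "norm (?l' - ls ?t) \<le> \<delta>"
    proof -
      have "norm (?l' - ls ?t) \<le> (\<pi> + 2) * (\<epsilon> + 2 * s)"
        using sr by (intro lam_bound[OF C2 \<delta>(2) N s0 n(2) def \<epsilon>(1) _ t])
      also have "\<dots> \<le> (\<pi> + 2) * (3 * s)" using \<epsilon> cst by (intro mult_left_mono) auto
      finally show ?thesis using s4(2) by linarith
    qed
    have DG: "norm (Df ?w - G) \<le> \<delta>"
    proof -
      let ?u = "?w - ws ?t"
      have "norm (Df ?w - G - D2 ?t ?u) \<le> \<delta> * norm ?u" unfolding G_def using r1(2)[OF t w(1), of "ws ?t"] r1(1) by auto
      moreover have "\<delta> * norm ?u \<le> 1 * norm ?u" using \<delta> by (intro mult_right_mono) auto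
      ultimately have "norm (Df ?w - G) \<le> (q + 1) * norm ?u"
        using D2_le[OF t, of ?u] norm_triangle_ineq[of "Df ?w - G - D2 ?t ?u" "D2 ?t ?u"] by (simp add: algebra_simps)
      also have "\<dots> \<le> (q + 1) * r" using w(3) q1 by (intro mult_left_mono) auto
      finally show ?thesis using r(4) by linarith
    qed
    have DD: "norm (Df ?w - Df ?w') \<le> (q + 1) * (3 * D)"
    proof -
      have "\<delta> * norm dw \<le> 1 * norm dw" using \<delta> by (intro mult_right_mono) auto
      hence "norm (Df ?w - Df ?w') \<le> (q + 1) * norm dw"
        using F(2) D2_le[OF t, of dw] norm_triangle_ineq[of "Df ?w - Df ?w' - D2 ?t dw" "D2 ?t dw"] by (simp add: algebra_simps)
      also have "\<dots> \<le> (q + 1) * (3 * D)" using dwD q1 by (intro mult_left_mono) auto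
      finally show ?thesis .
    qed
    let ?T1 = "adj (Df ?w - G) (?l - ?l')" and ?T2 = "adj G e" and ?T3 = "adj (Df ?w - Df ?w') (?l' - ls ?t)"
      and ?T4 = "adj (Df ?w - Df ?w' - D2 ?t dw) (ls ?t)"
    have pxd: "px (p j - p' j) = px (p j) - px (p' j)" by (rule linear_diff[OF lin_px])
    \<comment> \<open>An exact telescoping identity: \<open>?T1\<close> and \<open>?T3\<close> are
      products of two small changes, \<open>?T2\<close> carries the nonlinearity of
      \<open>gC\<close>, \<open>?T4\<close> the second-order remainder of \<open>Df\<close>.\<close>
    have e2: "res2 N a p j - res2 N a' p' j - lin2 N ?da ?dp j = ?T1 + ?T2 + ?T3 + ?T4"
      unfolding res2_def lin2_def G_def[symmetric] dw_def[symmetric] \<mu>_def[symmetric] pxd linear_diff[OF lin_ix]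
      by (simp add: e_def adj_diff_left adj_diff_right adj_add_right adj_add_left algebra_simps)
    have "norm ?T1 \<le> \<delta> * ((2 * \<pi> + 4) * D)"
      by (rule order_trans[OF norm_adj_le mult_mono[OF DG ll]]) (use \<delta> in auto)
    moreover have "norm ?T2 \<le> g * (\<delta> * (2 * D))"
      by (rule order_trans[OF norm_adj_le mult_mono[OF _ e]]) (use G_le[OF t] cst in \<open>auto simp: G_def\<close>)
    moreover have "norm ?T3 \<le> ((q + 1) * (3 * D)) * \<delta>"
      by (rule order_trans[OF norm_adj_le mult_mono[OF DD l']]) (use q1 D in auto)
    moreover have "norm ?T4 \<le> (\<delta> * (3 * D)) * L"
      by (rule order_trans[OF norm_adj_le mult_mono[OF order_trans[OF F(2) \<delta>dw] ls_le[OF t]]]) (use \<delta> D in auto)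
    moreover have "norm (?T1 + ?T2 + ?T3 + ?T4) \<le> norm ?T1 + norm ?T2 + norm ?T3 + norm ?T4"
      by (intro norm_triangle_mono order_refl)
    moreover have "\<delta> * ((2 * \<pi> + 4) * D) + g * (\<delta> * (2 * D)) + ((q + 1) * (3 * D)) * \<delta> + (\<delta> * (3 * D)) * L
      = \<delta> * ((2 * \<pi> + 7 + 2 * g + 3 * q + 3 * L) * D)" by (simp add: algebra_simps)
    ultimately show "norm (res2 N a p j - res2 N a' p' j - lin2 N ?da ?dp j)
       \<le> \<delta> * ((2 * \<pi> + 7 + 2 * g + 3 * q + 3 * L) * D)" unfolding e2 by linarith
  qed
qed

text \<open>The derivatives of the continuous solution satisfy the optimality system along the exact
  trajectory, so the residual only sees the displacement of the reconstructed trajectory and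
  multiplier, both of order \<epsilon>. The constant is the sum of the bounds for the two residuals
  and serves both.\<close>

lemma residual_consistency:
  "\<exists>s>0. \<forall>N \<epsilon> j. N \<ge> 1 \<longrightarrow> 0 \<le> \<epsilon> \<longrightarrow> \<epsilon> \<le> s \<longrightarrow> defect N \<epsilon> \<longrightarrow> j \<in> {1..N} \<longrightarrow>
    norm (res1 N (\<lambda>i. xd (gauss_node N i)) (\<lambda>i. pst (gauss_node N i)) j) \<le> ((g + 1) * (\<pi> + 2) + (g + 1) + (q + 1) * L) * \<epsilon> \<and>
    norm (res2 N (\<lambda>i. xd (gauss_node N i)) (\<lambda>i. pst (gauss_node N i)) j) \<le> ((g + 1) * (\<pi> + 2) + (g + 1) + (q + 1) * L) * \<epsilon>"
proof -
  obtain r1 where r1: "r1 > 0" "\<And>t w w'. t \<in> {-1..1} \<Longrightarrow> norm (w - ws t) \<le> r1 \<Longrightarrow> norm (w' - ws t) \<le> r1 \<Longrightarrow>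
       norm (f w - f w' - blinfun_apply (Df (ws t)) (w - w')) \<le> 1 * norm (w - w') \<and>
       norm (Df w - Df w' - D2 t (w - w')) \<le> 1 * norm (w - w')"
    using lin_f[of 1] by (metis zero_less_one)
  obtain r2 where r2: "r2 > 0" "\<And>x x'. norm (x - px (ws 1)) \<le> r2 \<Longrightarrow> norm (x' - px (ws 1)) \<le> r2 \<Longrightarrow>
       norm (gC x - gC x' - P (x - x')) \<le> 1 * norm (x - x')"
    using lin_C[of 1] by (metis zero_less_one)
  define s where "s = min (min r1 r2) (1 / (q + 1))"
  have q1: "q + 1 > 0" using cst by auto
  have s: "s > 0" "s \<le> r1" "s \<le> r2" "(q + 1) * s \<le> 1"
  proof -
    show "s > 0" "s \<le> r1" "s \<le> r2" using r1 r2 q1 by (auto simp: s_def)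
    have "s \<le> 1 / (q + 1)" by (simp add: s_def)
    thus "(q + 1) * s \<le> 1" using q1 by (simp add: pos_le_divide_eq mult.commute)
  qed
  show ?thesis
  proof (intro exI[of _ s] conjI s(1) allI impI)
    fix N \<epsilon> j
    assume N: "N \<ge> 1" and \<epsilon>: "0 \<le> \<epsilon>" "\<epsilon> \<le> s" and def: "defect N \<epsilon>" and j: "j \<in> {1..N}"
    let ?t = "gauss_node N j" and ?a = "\<lambda>i. xd (gauss_node N i)" and ?p = "\<lambda>i. pst (gauss_node N i)"
    let ?w = "wt N ?a ?p j" and ?l = "lam N ?a ?p (gauss_node N j)"
    have t: "?t \<in> {-1..1}" using gauss_node_bounds[OF j] by auto
    have n: "near N 0 ?a ?p" by (simp add: near_def)
    have w: "norm (?w - ws ?t) \<le> \<epsilon>" using near_bounds(2)[OF N _ n def j] by simp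
    have l: "norm (?l - ls ?t) \<le> (\<pi> + 2) * \<epsilon>"
      using lam_bound[OF r2(2) order_refl N order_refl n def \<epsilon>(1) _ t] \<epsilon> s by simp
    let ?G = "Df (ws ?t)" and ?u = "?w - ws ?t"
    have F: "norm (f ?w - f (ws ?t) - blinfun_apply ?G ?u) \<le> norm ?u" "norm (Df ?w - ?G - D2 ?t ?u) \<le> norm ?u"
      using r1(2)[OF t, of ?w "ws ?t"] w \<epsilon> s r1(1) by auto
    have "norm (blinfun_apply ?G ?u) \<le> g * norm ?u"
      using norm_blinfun[of ?G ?u] G_le[OF t] by (meson mult_right_mono norm_ge_zero order_trans)
    hence "norm (f ?w - f (ws ?t)) \<le> (g + 1) * norm ?u"
      using F(1) norm_triangle_ineq[of "f ?w - f (ws ?t) - blinfun_apply ?G ?u" "blinfun_apply ?G ?u"] by (simp add: algebra_simps)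
    also have "\<dots> \<le> (g + 1) * \<epsilon>" using w cst by (intro mult_left_mono) auto
    finally have 1: "norm (res1 N ?a ?p j) \<le> (g + 1) * \<epsilon>"
      by (simp add: res1_def state[OF t] norm_minus_commute)
    have "norm (Df ?w - ?G) \<le> (q + 1) * norm ?u"
      using F(2) D2_le[OF t, of ?u] norm_triangle_ineq[of "Df ?w - ?G - D2 ?t ?u" "D2 ?t ?u"] by (simp add: algebra_simps)
    also have "\<dots> \<le> (q + 1) * \<epsilon>" using w q1 by (intro mult_left_mono) auto
    finally have DG: "norm (Df ?w - ?G) \<le> (q + 1) * \<epsilon>" .
    also have "(q + 1) * \<epsilon> \<le> (q + 1) * s" using \<epsilon> q1 by (intro mult_left_mono) auto
    finally have Dw: "norm (Df ?w) \<le> g + 1"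
      using s(4) G_le[OF t] norm_triangle_ineq[of "Df ?w - ?G" ?G] by simp
    have "adj ?G (ls ?t) = - ix (ld ?t)" using costate[OF t] by (simp add: eq_neg_iff_add_eq_0 add.commute)
    hence e2: "res2 N ?a ?p j = adj (Df ?w) (?l - ls ?t) + adj (Df ?w - ?G) (ls ?t)"
      by (simp add: res2_def adj_diff_left adj_diff_right)
    have T1: "norm (adj (Df ?w) (?l - ls ?t)) \<le> (g + 1) * ((\<pi> + 2) * \<epsilon>)"
      by (rule order_trans[OF norm_adj_le mult_mono[OF Dw l]]) (use cst in auto)
    have T2: "norm (adj (Df ?w - ?G) (ls ?t)) \<le> ((q + 1) * \<epsilon>) * L"
      by (rule order_trans[OF norm_adj_le mult_mono[OF DG ls_le[OF t]]]) (use q1 \<epsilon> in auto)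
    have 2: "norm (res2 N ?a ?p j) \<le> (g + 1) * ((\<pi> + 2) * \<epsilon>) + ((q + 1) * \<epsilon>) * L"
      unfolding e2 by (rule norm_triangle_mono[OF T1 T2])
    have nn: "0 \<le> (g + 1) * \<epsilon>" "0 \<le> (g + 1) * ((\<pi> + 2) * \<epsilon>)" "0 \<le> ((q + 1) * \<epsilon>) * L" using cst \<epsilon> by auto
    have e: "((g + 1) * (\<pi> + 2) + (g + 1) + (q + 1) * L) * \<epsilon> = (g + 1) * ((\<pi> + 2) * \<epsilon>) + (g + 1) * \<epsilon> + ((q + 1) * \<epsilon>) * L"
      by (simp add: algebra_simps)
    show "norm (res1 N ?a ?p j) \<le> ((g + 1) * (\<pi> + 2) + (g + 1) + (q + 1) * L) * \<epsilon>"
      "norm (res2 N ?a ?p j) \<le> ((g + 1) * (\<pi> + 2) + (g + 1) + (q + 1) * L) * \<epsilon>"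
      unfolding e using 1 2 nn by linarith+
  qed
qed

theorem discrete_solution:
  "\<exists>c\<ge>0. \<exists>s>0. \<forall>N \<epsilon>. N \<ge> 1 \<longrightarrow> 0 \<le> \<epsilon> \<longrightarrow> \<epsilon> \<le> s \<longrightarrow> defect N \<epsilon> \<longrightarrow>
    (\<exists>a p. near N (c * \<epsilon>) a p \<and> (\<forall>j\<in>{1..N}. res1 N a p j = 0 \<and> res2 N a p j = 0))"
proof -
  obtain \<kappa>0 where \<kappa>0: "\<kappa>0 > 0" "\<And>N a p K. N \<ge> 1 \<Longrightarrow> (\<And>j. j \<in> {1..N} \<Longrightarrow> norm (lin1 N a p j) \<le> K \<and> norm (lin2 N a p j) \<le> K) \<Longrightarrow>
    (\<forall>j\<in>{1..N}. norm (a j) \<le> \<kappa>0 * K \<and> norm (p j) \<le> \<kappa>0 * K)"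
    using stability by blast
  \<comment> \<open>Doubled because the norm of a pair is bounded by the sum of the norms of its
    components.\<close>
  define \<kappa> where "\<kappa> = 2 * \<kappa>0"
  have \<kappa>: "\<kappa> > 0" using \<kappa>0 by (simp add: \<kappa>_def)
  \<comment> \<open>Sum of the linearization constants of \<open>res1\<close> and
    \<open>res2\<close>; \<delta> is then taken so small that \<open>\<delta> * K\<close> meets the
    contraction bound \<open>1 / (2 * \<kappa>)\<close>.\<close>
  define K where "K = 3 + (2 * \<pi> + 7 + 2 * g + 3 * q + 3 * L)"
  have K: "K > 0" using cst by (simp add: K_def)
  define \<delta> where "\<delta> = min 1 (1 / (2 * \<kappa> * K))"
  have \<delta>: "0 < \<delta>" "\<delta> \<le> 1" "\<delta> * K \<le> 1 / (2 * \<kappa>)"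
  proof -
    show "0 < \<delta>" "\<delta> \<le> 1" using \<kappa> K by (auto simp: \<delta>_def)
    have "\<delta> \<le> 1 / (2 * \<kappa> * K)" by (simp add: \<delta>_def)
    also have "\<dots> = 1 / (2 * \<kappa>) / K" by simp
    finally show "\<delta> * K \<le> 1 / (2 * \<kappa>)" using K by (simp only: pos_le_divide_eq)
  qed
  obtain s1 where s1: "s1 > 0" and lin: "\<And>N \<epsilon> a p a' p' D j. N \<ge> 1 \<Longrightarrow> 0 \<le> \<epsilon> \<Longrightarrow> \<epsilon> \<le> s1 \<Longrightarrow> defect N \<epsilon> \<Longrightarrow> near N s1 a p \<Longrightarrow> near N s1 a' p' \<Longrightarrow>
    0 \<le> D \<Longrightarrow> (\<forall>i\<in>{1..N}. norm (a i - a' i) \<le> D \<and> norm (p i - p' i) \<le> D) \<Longrightarrow> j \<in> {1..N} \<Longrightarrow>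
    norm (res1 N a p j - res1 N a' p' j - lin1 N (\<lambda>i. a i - a' i) (\<lambda>i. p i - p' i) j) \<le> \<delta> * (3 * D) \<and>
    norm (res2 N a p j - res2 N a' p' j - lin2 N (\<lambda>i. a i - a' i) (\<lambda>i. p i - p' i) j)
       \<le> \<delta> * ((2 * \<pi> + 7 + 2 * g + 3 * q + 3 * L) * D)"
    using residual_linearization[OF \<delta>(1,2)] by auto
  define M where "M = (g + 1) * (\<pi> + 2) + (g + 1) + (q + 1) * L"
  have "0 \<le> (g + 1) * (\<pi> + 2)" "0 < g + 1" "0 \<le> (q + 1) * L" using cst by auto
  hence M: "M > 0" unfolding M_def by linarith
  obtain s2 where s2: "s2 > 0" and cons: "\<And>N \<epsilon> j. N \<ge> 1 \<Longrightarrow> 0 \<le> \<epsilon> \<Longrightarrow> \<epsilon> \<le> s2 \<Longrightarrow> defect N \<epsilon> \<Longrightarrow> j \<in> {1..N} \<Longrightarrow>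
    norm (res1 N (\<lambda>i. xd (gauss_node N i)) (\<lambda>i. pst (gauss_node N i)) j) \<le> M * \<epsilon> \<and>
    norm (res2 N (\<lambda>i. xd (gauss_node N i)) (\<lambda>i. pst (gauss_node N i)) j) \<le> M * \<epsilon>"
    using residual_consistency unfolding M_def by auto
  \<comment> \<open>\<open>2 * M * \<epsilon>\<close> bounds the residual pair at the starting
    point, and \<open>2 * \<kappa>\<close> is the ratio of radius to initial residual in
    \<open>newton_contraction\<close>.\<close>
  define c where "c = 2 * \<kappa> * (2 * M)"
  have c: "c > 0" using \<kappa> M by (simp add: c_def)
  define s where "s = min (min s1 s2) (s1 / c)"
  have s: "s > 0" "s \<le> s1" "s \<le> s2" "c * s \<le> s1"
  proof -
    show "s > 0" "s \<le> s1" "s \<le> s2" using s1 s2 c by (auto simp: s_def)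
    have "s \<le> s1 / c" by (simp add: s_def)
    thus "c * s \<le> s1" using c by (simp add: pos_le_divide_eq mult.commute)
  qed
  have "\<exists>a p. near N (c * \<epsilon>) a p \<and> (\<forall>j\<in>{1..N}. res1 N a p j = 0 \<and> res2 N a p j = 0)"
    if N: "N \<ge> 1" and \<epsilon>: "0 \<le> \<epsilon>" "\<epsilon> \<le> s" and def: "defect N \<epsilon>" for N \<epsilon>
  proof -
    define A where "A z = (\<lambda>i. fst (apply_bcontfun z i))" for z :: "nat \<Rightarrow>\<^sub>C ('x \<times> 'w)"
    define B where "B z = (\<lambda>i. snd (apply_bcontfun z i))" for z :: "nat \<Rightarrow>\<^sub>C ('x \<times> 'w)"
    define F where "F z = fseq N (\<lambda>j. (res1 N (A z) (B z) j, res2 N (A z) (B z) j))" for z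
    define T where "T z = fseq N (\<lambda>j. (lin1 N (A z) (B z) j, lin2 N (A z) (B z) j))" for z
    define z0 where "z0 = fseq N (\<lambda>i. (xd (gauss_node N i), pst (gauss_node N i)))"
    let ?V = "fsub N :: (nat \<Rightarrow>\<^sub>C ('x \<times> 'w)) set"
    have ABn: "norm (A z i) \<le> norm z" "norm (B z i) \<le> norm z" for z i
      using norm_fst_le[of "A z i" "B z i"] norm_snd_le[of "B z i" "A z i"] norm_bounded[of z i]
      by (simp_all add: A_def B_def)
    have ABa: "A (x + y) = (\<lambda>i. A x i + A y i)" "B (x + y) = (\<lambda>i. B x i + B y i)" for x y by (auto simp: A_def B_def)
    have ABd: "A (x - y) = (\<lambda>i. A x i - A y i)" "B (x - y) = (\<lambda>i. B x i - B y i)" for x y by (auto simp: A_def B_def)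
    have ABs: "A (r *\<^sub>R x) = (\<lambda>i. r *\<^sub>R A x i)" "B (r *\<^sub>R x) = (\<lambda>i. r *\<^sub>R B x i)" for r x by (auto simp: A_def B_def)
    have nf: "norm (fseq N h) \<le> b" if "b \<ge> 0" "\<And>i. i \<in> {1..N} \<Longrightarrow> norm (fst (h i)) + norm (snd (h i)) \<le> b" for h :: "nat \<Rightarrow> 'x \<times> 'w" and b
    proof (rule fsub_norm_le[OF fseq_in_fsub that(1)])
      fix i assume "i \<in> {1..N}"
      thus "norm (apply_bcontfun (fseq N h) i) \<le> b"
        using that(2)[of i] norm_Pair_le[of "fst (h i)" "snd (h i)"] by (simp add: apply_fseq)
    qed
    have "linear T"
    proof (rule linearI)
      show "T (x + y) = T x + T y" for x y
        unfolding T_def ABa by (rule bcontfun_eqI) (auto simp: apply_fseq lin1_add lin2_add)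
      show "T (r *\<^sub>R x) = r *\<^sub>R T x" for r x
        unfolding T_def ABs by (rule bcontfun_eqI) (auto simp: apply_fseq lin1_scale lin2_scale)
    qed
    have stab: "norm x \<le> \<kappa> * norm (T x)" if x: "x \<in> ?V" for x
    proof -
      have "norm (lin1 N (A x) (B x) j) \<le> norm (T x) \<and> norm (lin2 N (A x) (B x) j) \<le> norm (T x)" if j: "j \<in> {1..N}" for j
        using norm_bounded[of "T x" j] j norm_fst_le[of "lin1 N (A x) (B x) j" "lin2 N (A x) (B x) j"]
          norm_snd_le[of "lin2 N (A x) (B x) j" "lin1 N (A x) (B x) j"]
        by (simp add: T_def apply_fseq)
      from \<kappa>0(2)[OF N this] have AB: "norm (A x j) \<le> \<kappa>0 * norm (T x) \<and> norm (B x j) \<le> \<kappa>0 * norm (T x)" if "j \<in> {1..N}" for j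
        using that by blast
      show ?thesis
      proof (rule fsub_norm_le[OF x])
        fix i assume "i \<in> {1..N}"
        from AB[OF this] show "norm (apply_bcontfun x i) \<le> \<kappa> * norm (T x)"
          using norm_Pair_le[of "A x i" "B x i"] by (simp add: A_def B_def \<kappa>_def)
      qed (use \<kappa> in simp)
    qed
    obtain Bs :: "(nat \<Rightarrow>\<^sub>C ('x \<times> 'w)) set" where Bs: "finite Bs" "Bs \<subseteq> fsub N" "fsub N \<subseteq> span Bs"
      using fsub_finite_span by blast
    have surj: "\<exists>x\<in>?V. T x = y" if "y \<in> ?V" for y
    proof (rule linear_inj_imp_surj_on_finite_span[OF subspace_fsub Bs \<open>linear T\<close> _ _ that])
      show "T x \<in> ?V" for x by (simp add: T_def)
      show "x = 0" if "x \<in> ?V" "T x = 0" for x using stab[OF that(1)] that(2) by simp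
    qed
    have z0a: "A z0 i = xd (gauss_node N i)" "B z0 i = pst (gauss_node N i)" if "i \<in> {1..N}" for i
      using that by (auto simp: A_def B_def z0_def apply_fseq)
    have z0F: "norm (F z0) \<le> 2 * (M * \<epsilon>)"
      unfolding F_def
    proof (rule nf)
      fix j assume j: "j \<in> {1..N}"
      have p: "primal N (A z0) t = primal N (\<lambda>i. xd (gauss_node N i)) t" for t
        unfolding primal_def by (intro sum.cong refl) (simp add: z0a)
      have d: "dual N (\<lambda>i. px (B z0 i)) t = dual N (\<lambda>i. px (pst (gauss_node N i))) t" for t
        unfolding dual_def by (intro sum.cong refl) (simp add: z0a)
      have "wt N (A z0) (B z0) j = wt N (\<lambda>i. xd (gauss_node N i)) (\<lambda>i. pst (gauss_node N i)) j"
        using j by (simp add: wt_def traj_def p z0a)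
      moreover have "lam N (A z0) (B z0) t = lam N (\<lambda>i. xd (gauss_node N i)) (\<lambda>i. pst (gauss_node N i)) t" for t
        by (simp only: lam_def x1_def p d)
      ultimately show "norm (fst (res1 N (A z0) (B z0) j, res2 N (A z0) (B z0) j)) + norm (snd (res1 N (A z0) (B z0) j, res2 N (A z0) (B z0) j)) \<le> 2 * (M * \<epsilon>)"
        using cons[OF N \<epsilon>(1) _ def j] \<epsilon> s j by (simp add: res1_def res2_def z0a)
    qed (use M \<epsilon> in simp)
    have near: "near N d (A x) (B x)" if "norm (x - z0) \<le> d" for x d
      unfolding near_def
    proof (intro ballI)
      fix i assume i: "i \<in> {1..N}"
      show "norm (A x i - xd (gauss_node N i)) \<le> d \<and> norm (B x i - pst (gauss_node N i)) \<le> d"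
        using ABn[of "x - z0" i] that unfolding ABd z0a[OF i] by linarith
    qed
    have small: "2 * \<kappa> * norm (F z0) \<le> c * \<epsilon>"
      using mult_left_mono[OF z0F, of "2 * \<kappa>"] \<kappa> by (simp add: c_def mult_ac)
    have "c * \<epsilon> \<le> c * s" using \<epsilon> c by simp
    hence small1: "2 * \<kappa> * norm (F z0) \<le> s1" using small s(4) by linarith
    have "\<exists>z\<in>?V. norm (z - z0) \<le> 2 * \<kappa> * norm (F z0) \<and> F z = 0"
    proof (rule newton_contraction[where F=F and T=T and V="?V" and r=s1, OF subspace_fsub complete_fsub \<open>linear T\<close> surj stab \<kappa>])
      show "F x \<in> ?V" for x by (simp add: F_def)
      show "z0 \<in> ?V" by (simp add: z0_def)
      show "2 * \<kappa> * norm (F z0) \<le> s1" by (rule small1)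
      fix x y assume xy: "x \<in> ?V" "y \<in> ?V" "norm (x - z0) \<le> s1" "norm (y - z0) \<le> s1"
      let ?D = "norm (x - y)"
      have D: "\<forall>i\<in>{1..N}. norm (A x i - A y i) \<le> ?D \<and> norm (B x i - B y i) \<le> ?D"
        using ABn[of "x - y"] unfolding ABd by blast
      have \<epsilon>1: "\<epsilon> \<le> s1" using \<epsilon> s by linarith
      have e: "F x - F y - T (x - y) = fseq N (\<lambda>j. (res1 N (A x) (B x) j - res1 N (A y) (B y) j - lin1 N (A (x - y)) (B (x - y)) j,
           res2 N (A x) (B x) j - res2 N (A y) (B y) j - lin2 N (A (x - y)) (B (x - y)) j))"
        unfolding F_def T_def by (rule bcontfun_eqI) (auto simp: apply_fseq)
      have "norm (F x - F y - T (x - y)) \<le> \<delta> * K * ?D"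
        unfolding e ABd
      proof (rule nf)
        fix j assume j: "j \<in> {1..N}"
        have "\<delta> * (3 * ?D) + \<delta> * ((2 * \<pi> + 7 + 2 * g + 3 * q + 3 * L) * ?D) = \<delta> * K * ?D"
          by (simp add: K_def algebra_simps)
        thus "norm (fst (res1 N (A x) (B x) j - res1 N (A y) (B y) j - lin1 N (\<lambda>i. A x i - A y i) (\<lambda>i. B x i - B y i) j,
             res2 N (A x) (B x) j - res2 N (A y) (B y) j - lin2 N (\<lambda>i. A x i - A y i) (\<lambda>i. B x i - B y i) j))
          + norm (snd (res1 N (A x) (B x) j - res1 N (A y) (B y) j - lin1 N (\<lambda>i. A x i - A y i) (\<lambda>i. B x i - B y i) j,
             res2 N (A x) (B x) j - res2 N (A y) (B y) j - lin2 N (\<lambda>i. A x i - A y i) (\<lambda>i. B x i - B y i) j)) \<le> \<delta> * K * ?D"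
          using lin[OF N \<epsilon>(1) \<epsilon>1 def near[OF xy(3)] near[OF xy(4)] norm_ge_zero D j] unfolding fst_conv snd_conv by linarith
      qed (use \<delta> K in simp)
      also have "\<dots> \<le> 1 / (2 * \<kappa>) * ?D" using \<delta>(3) by (intro mult_right_mono) auto
      finally show "norm (F x - F y - T (x - y)) \<le> ?D / (2 * \<kappa>)" by simp
    qed
    then obtain z where z: "norm (z - z0) \<le> c * \<epsilon>" "F z = 0" using small by (meson order_trans)
    have "res1 N (A z) (B z) j = 0 \<and> res2 N (A z) (B z) j = 0" if j: "j \<in> {1..N}" for j
    proof -
      have "apply_bcontfun (F z) j = 0" using z(2) by simp
      thus ?thesis using j by (simp add: F_def apply_fseq zero_prod_def)
    qed
    thus ?thesis using near[OF z(1)] by blast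
  qed
  thus ?thesis using c s(1) by (intro exI[of _ c] exI[of _ s] conjI) auto
qed

end

section \<open>Convexity near the solution and local minimality\<close>

lemma mvt_lower_bound:
  fixes \<phi> \<phi>' :: "real \<Rightarrow> real"
  assumes d: "\<And>s. 0 \<le> s \<Longrightarrow> s \<le> 1 \<Longrightarrow> (\<phi> has_real_derivative \<phi>' s) (at s)"
    and m: "\<And>s. 0 \<le> s \<Longrightarrow> s \<le> 1 \<Longrightarrow> m \<le> \<phi>' s"
  shows "\<phi> 0 + m \<le> \<phi> 1"
proof -
  obtain z where "0 < z" "z < 1" "\<phi> 1 - \<phi> 0 = (1 - 0) * \<phi>' z"
    using MVT2[of 0 1 \<phi> \<phi>'] d by auto
  thus ?thesis using m[of z] by simp
qed

lemma segment_near: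
  fixes w w' c :: "'z::real_normed_vector"
  assumes "norm (w - c) \<le> r" "norm (w' - c) \<le> r" "0 \<le> s" "s \<le> 1"
  shows "norm (w + s *\<^sub>R (w' - w) - c) \<le> r"
proof -
  have "w + s *\<^sub>R (w' - w) - c = (1 - s) *\<^sub>R (w - c) + s *\<^sub>R (w' - c)" by (simp add: algebra_simps)
  hence "norm (w + s *\<^sub>R (w' - w) - c) \<le> (1 - s) * norm (w - c) + s * norm (w' - c)"
    using norm_triangle_ineq[of "(1 - s) *\<^sub>R (w - c)" "s *\<^sub>R (w' - c)"] assms by simp
  also have "\<dots> \<le> (1 - s) * r + s * r" using assms by (intro add_mono mult_left_mono) auto
  finally show ?thesis by (simp add: algebra_simps)
qed

locale ocp_min = ocp +
  fixes C :: "'a \<Rightarrow> real"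
  assumes f_der: "\<exists>r>0. \<forall>t\<in>{-1..1}. \<forall>w. norm (w - ws t) \<le> r \<longrightarrow> (f has_derivative blinfun_apply (Df w)) (at w)"
    and C_der: "\<exists>r>0. \<forall>x. norm (x - px (ws 1)) \<le> r \<longrightarrow> (C has_derivative (\<lambda>h. gC x \<bullet> h)) (at x)"
    and P_coer: "\<alpha> * (norm x)\<^sup>2 \<le> x \<bullet> P x"
begin

text \<open>Only a fixed multiplier \<open>l\<close> enters, so second-order sufficiency reduces to convexity of \<open>l \<bullet> f\<close>.\<close>

lemma H_convex:
  "\<exists>r>0. \<forall>t\<in>{-1..1}. \<forall>w w' l. norm (w - ws t) \<le> r \<longrightarrow> norm (w' - ws t) \<le> r \<longrightarrow> norm (l - ls t) \<le> r \<longrightarrow>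
     0 \<le> l \<bullet> (f w' - f w - blinfun_apply (Df w) (w' - w))"
proof -
  \<comment> \<open>\<alpha> is split into halves: one pays for the linearization error of
    \<open>Df\<close>, with \<open>norm l \<le> L + 1\<close>, the other for replacing
    \<open>ls t\<close> by \<open>l\<close>, whence \<open>r * q \<le> \<alpha> / 2\<close>.\<close>
  define \<delta> where "\<delta> = \<alpha> / 2 / (L + 1)"
  have L1: "L + 1 > 0" using cst by simp
  have \<delta>: "\<delta> > 0" "(L + 1) * \<delta> = \<alpha> / 2"
    using cst L1 unfolding \<delta>_def times_divide_eq_right by (simp_all del: divide_divide_eq_left)
  obtain r1 where r1: "r1 > 0" "\<And>t w w'. t \<in> {-1..1} \<Longrightarrow> norm (w - ws t) \<le> r1 \<Longrightarrow> norm (w' - ws t) \<le> r1 \<Longrightarrow>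
       norm (f w - f w' - blinfun_apply (Df (ws t)) (w - w')) \<le> \<delta> * norm (w - w') \<and>
       norm (Df w - Df w' - D2 t (w - w')) \<le> \<delta> * norm (w - w')"
    using lin_f[OF \<delta>(1)] by blast
  obtain r2 where r2: "r2 > 0" "\<And>t w. t \<in> {-1..1} \<Longrightarrow> norm (w - ws t) \<le> r2 \<Longrightarrow> (f has_derivative blinfun_apply (Df w)) (at w)"
    using f_der by blast
  define r where "r = min (min r1 r2) (min 1 (\<alpha> / (2 * (q + 1))))"
  have q1: "q + 1 > 0" using cst by auto
  have r: "r > 0" "r \<le> r1" "r \<le> r2" "r \<le> 1" "r * q \<le> \<alpha> / 2"
  proof -
    show r0: "r > 0" "r \<le> r1" "r \<le> r2" "r \<le> 1" using r1 r2 cst q1 by (auto simp: r_def)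
    have "r \<le> \<alpha> / 2 / (q + 1)" by (simp add: r_def)
    hence "r * (q + 1) \<le> \<alpha> / 2" using q1 by (simp only: pos_le_divide_eq)
    thus "r * q \<le> \<alpha> / 2" using r0 by (simp add: algebra_simps)
  qed
  show ?thesis
  proof (intro exI[of _ r] conjI r(1) ballI allI impI)
    fix t :: real and w w' l
    assume t: "t \<in> {-1..1}" and w: "norm (w - ws t) \<le> r" "norm (w' - ws t) \<le> r" and l: "norm (l - ls t) \<le> r"
    define h where "h = w' - w"
    define p where "p s = w + s *\<^sub>R h" for s
    have p: "norm (p s - ws t) \<le> r" if "0 \<le> s" "s \<le> 1" for s
      unfolding p_def h_def using segment_near[OF w that] .
    have d: "((\<lambda>s. l \<bullet> f (p s)) has_real_derivative l \<bullet> blinfun_apply (Df (p s)) h) (at s)" if s: "0 \<le> s" "s \<le> 1" for s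
    proof -
      have fd: "(f has_derivative blinfun_apply (Df (p s))) (at (p s))" using p[OF s] r(3) by (intro r2(2)[OF t]) simp
      have "((\<lambda>s. f (p s)) has_derivative (\<lambda>x. blinfun_apply (Df (p s)) (x *\<^sub>R h))) (at s)"
        by (rule has_derivative_compose[where f=p and g=f, OF _ fd]) (auto simp: p_def[abs_def] intro!: derivative_eq_intros)
      hence "((\<lambda>s. l \<bullet> f (p s)) has_derivative (\<lambda>x. l \<bullet> blinfun_apply (Df (p s)) (x *\<^sub>R h))) (at s)"
        by (rule has_derivative_inner_right)
      thus ?thesis unfolding has_field_derivative_def
        by (rule has_derivative_eq_rhs) (simp add: fun_eq_iff blinfun.scaleR_right)
    qed
    have m: "l \<bullet> blinfun_apply (Df w) h \<le> l \<bullet> blinfun_apply (Df (p s)) h" if s: "0 \<le> s" "s \<le> 1" for s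
    proof -
      let ?n = "(norm h)\<^sup>2"
      let ?E = "Df (p s) - Df w - D2 t (p s - w)"
      have ps: "p s - w = s *\<^sub>R h" by (simp add: p_def)
      have "norm ?E \<le> \<delta> * norm (p s - w)" using r1(2)[OF t, of "p s" w] p[OF s] w r(2) by auto
      hence nE: "norm ?E \<le> \<delta> * (s * norm h)" using s by (simp add: ps)
      have nl: "norm l \<le> L + 1" using l ls_le[OF t] r(4) norm_triangle_ineq[of "l - ls t" "ls t"] by simp
      have "\<bar>l \<bullet> blinfun_apply ?E h\<bar> \<le> norm l * norm (blinfun_apply ?E h)" by (rule Cauchy_Schwarz_ineq2)
      also have "\<dots> \<le> (L + 1) * ((\<delta> * (s * norm h)) * norm h)"
        using nl cst by (intro mult_mono order_trans[OF norm_blinfun mult_right_mono[OF nE]]) auto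
      also have "\<dots> = (\<alpha> / 2) * (s * ?n)" unfolding \<delta>(2)[symmetric] by (simp add: power2_eq_square mult_ac)
      finally have 1: "\<bar>l \<bullet> blinfun_apply ?E h\<bar> \<le> (\<alpha> / 2) * (s * ?n)" .
      have "\<bar>(l - ls t) \<bullet> blinfun_apply (D2 t h) h\<bar> \<le> norm (l - ls t) * norm (blinfun_apply (D2 t h) h)" by (rule Cauchy_Schwarz_ineq2)
      also have "\<dots> \<le> r * ((q * norm h) * norm h)"
        using l r(1) by (intro mult_mono order_trans[OF norm_blinfun mult_right_mono[OF D2_le[OF t]]]) auto
      also have "\<dots> = (r * q) * ?n" by (simp add: power2_eq_square)
      also have "\<dots> \<le> (\<alpha> / 2) * ?n" using r(5) by (rule mult_right_mono) simp
      finally have "(\<alpha> / 2) * ?n \<le> l \<bullet> blinfun_apply (D2 t h) h"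
        using coer[OF t, of h] unfolding inner_diff_left by linarith
      hence "s * ((\<alpha> / 2) * ?n) \<le> s * (l \<bullet> blinfun_apply (D2 t h) h)" using s by (intro mult_left_mono)
      moreover have "l \<bullet> blinfun_apply (Df (p s)) h - l \<bullet> blinfun_apply (Df w) h = l \<bullet> blinfun_apply ?E h + s * (l \<bullet> blinfun_apply (D2 t h) h)"
        unfolding ps linear_scale[OF D2_lin[OF t]]
        by (simp add: blinfun.diff_left blinfun.scaleR_left inner_diff_right)
      ultimately show ?thesis using 1 by (simp add: abs_le_iff algebra_simps)
    qed
    have "l \<bullet> f (p 0) + l \<bullet> blinfun_apply (Df w) h \<le> l \<bullet> f (p 1)" by (rule mvt_lower_bound[OF d m])
    thus "0 \<le> l \<bullet> (f w' - f w - blinfun_apply (Df w) (w' - w))"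
      by (simp add: p_def h_def inner_diff_right)
  qed
qed

text \<open>The derivative along a segment is monotone as in \<open>H_convex\<close>; no multiplier
  is perturbed here, so all of \<alpha> is available for the linearization error.\<close>

lemma C_convex:
  "\<exists>r>0. \<forall>x x'. norm (x - px (ws 1)) \<le> r \<longrightarrow> norm (x' - px (ws 1)) \<le> r \<longrightarrow> C x + gC x \<bullet> (x' - x) \<le> C x'"
proof -
  obtain r1 where r1: "r1 > 0" "\<And>x x'. norm (x - px (ws 1)) \<le> r1 \<Longrightarrow> norm (x' - px (ws 1)) \<le> r1 \<Longrightarrow>
       norm (gC x - gC x' - P (x - x')) \<le> \<alpha> * norm (x - x')"
    using lin_C[OF cst(1)] by blast
  obtain r2 where r2: "r2 > 0" "\<And>x. norm (x - px (ws 1)) \<le> r2 \<Longrightarrow> (C has_derivative (\<lambda>h. gC x \<bullet> h)) (at x)"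
    using C_der by blast
  define r where "r = min r1 r2"
  have r: "r > 0" "r \<le> r1" "r \<le> r2" using r1 r2 by (auto simp: r_def)
  show ?thesis
  proof (intro exI[of _ r] conjI r(1) allI impI)
    fix x x' assume x: "norm (x - px (ws 1)) \<le> r" "norm (x' - px (ws 1)) \<le> r"
    define h where "h = x' - x"
    define p where "p s = x + s *\<^sub>R h" for s
    have p: "norm (p s - px (ws 1)) \<le> r" if "0 \<le> s" "s \<le> 1" for s
      unfolding p_def h_def using segment_near[OF x that] .
    have d: "((\<lambda>s. C (p s)) has_real_derivative gC (p s) \<bullet> h) (at s)" if s: "0 \<le> s" "s \<le> 1" for s
    proof -
      have Cd: "(C has_derivative (\<lambda>h. gC (p s) \<bullet> h)) (at (p s))" using p[OF s] r(3) by (intro r2(2)) simp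
      have "((\<lambda>s. C (p s)) has_derivative (\<lambda>x. gC (p s) \<bullet> (x *\<^sub>R h))) (at s)"
        by (rule has_derivative_compose[where f=p and g=C, OF _ Cd]) (auto simp: p_def[abs_def] intro!: derivative_eq_intros)
      thus ?thesis unfolding has_field_derivative_def
        by (rule has_derivative_eq_rhs) (simp add: fun_eq_iff)
    qed
    have m: "gC x \<bullet> h \<le> gC (p s) \<bullet> h" if s: "0 \<le> s" "s \<le> 1" for s
    proof -
      let ?E = "gC (p s) - gC x - P (p s - x)"
      have ps: "p s - x = s *\<^sub>R h" by (simp add: p_def)
      have "norm ?E \<le> \<alpha> * norm (p s - x)" using p[OF s] x r by (intro r1(2)) auto
      hence nE: "norm ?E \<le> \<alpha> * (s * norm h)" using s by (simp add: ps)
      have "\<bar>?E \<bullet> h\<bar> \<le> norm ?E * norm h" by (rule Cauchy_Schwarz_ineq2)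
      also have "\<dots> \<le> (\<alpha> * (s * norm h)) * norm h" using nE by (rule mult_right_mono) simp
      finally have 1: "\<bar>?E \<bullet> h\<bar> \<le> s * (\<alpha> * (norm h)\<^sup>2)" by (simp add: power2_eq_square mult_ac)
      have "s * (\<alpha> * (norm h)\<^sup>2) \<le> s * (h \<bullet> P h)" using P_coer s by (intro mult_left_mono)
      moreover have "gC (p s) \<bullet> h - gC x \<bullet> h = ?E \<bullet> h + s * (h \<bullet> P h)"
        unfolding ps linear_scale[OF P_lin] by (simp add: inner_diff_left inner_diff_right inner_commute)
      ultimately show ?thesis using 1 by (simp add: abs_le_iff)
    qed
    have "C (p 0) + gC x \<bullet> h \<le> C (p 1)" by (rule mvt_lower_bound[OF d m])
    thus "C x + gC x \<bullet> (x' - x) \<le> C x'" by (simp add: p_def h_def)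
  qed
qed

text \<open>Competitors are compared through \<open>wt\<close> and \<open>x1\<close>, because the
  costate part of \<open>p'\<close> is arbitrary for a feasible point of (D). Convexity of the
  multiplier-weighted dynamics, summed with the quadrature weights, gives
  \<open>gC (x1 N a) \<bullet> (x1 N a' - x1 N a) \<ge> 0\<close>, and convexity of \<open>C\<close>
  concludes.\<close>

theorem discrete_minimizer:
  "\<exists>c\<ge>0. \<exists>s>0. \<forall>N \<epsilon>. N \<ge> 1 \<longrightarrow> 0 \<le> \<epsilon> \<longrightarrow> \<epsilon> \<le> s \<longrightarrow> defect N \<epsilon> \<longrightarrow>
    (\<exists>a p. (\<forall>j\<in>{1..N}. res1 N a p j = 0 \<and> res2 N a p j = 0 \<and> norm (p j - pst (gauss_node N j)) \<le> c * \<epsilon>) \<and>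
      (\<forall>t\<in>{-1..1}. norm (px (ws (-1)) + primal N a t - px (ws t)) \<le> c * \<epsilon> \<and> norm (lam N a p t - ls t) \<le> c * \<epsilon>) \<and>
      (\<exists>e>0. \<forall>a' p'. (\<forall>j\<in>{1..N}. res1 N a' p' j = 0 \<and> norm (wt N a' p' j - wt N a p j) < e) \<longrightarrow> norm (x1 N a' - x1 N a) < e \<longrightarrow>
         C (x1 N a) \<le> C (x1 N a')))"
proof -
  obtain c s0 where c: "c \<ge> 0" and s0: "s0 > 0" and sol: "\<And>N \<epsilon>. N \<ge> 1 \<Longrightarrow> 0 \<le> \<epsilon> \<Longrightarrow> \<epsilon> \<le> s0 \<Longrightarrow> defect N \<epsilon> \<Longrightarrow>
    (\<exists>a p. near N (c * \<epsilon>) a p \<and> (\<forall>j\<in>{1..N}. res1 N a p j = 0 \<and> res2 N a p j = 0))"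
    using discrete_solution by blast
  obtain r1 where r1: "r1 > 0" "\<And>t w w' l. t \<in> {-1..1} \<Longrightarrow> norm (w - ws t) \<le> r1 \<Longrightarrow> norm (w' - ws t) \<le> r1 \<Longrightarrow> norm (l - ls t) \<le> r1 \<Longrightarrow>
     0 \<le> l \<bullet> (f w' - f w - blinfun_apply (Df w) (w' - w))"
    using H_convex by blast
  obtain r2 where r2: "r2 > 0" "\<And>x x'. norm (x - px (ws 1)) \<le> r2 \<Longrightarrow> norm (x' - px (ws 1)) \<le> r2 \<Longrightarrow> C x + gC x \<bullet> (x' - x) \<le> C x'"
    using C_convex by blast
  obtain r3 where r3: "r3 > 0" "\<And>x x'. norm (x - px (ws 1)) \<le> r3 \<Longrightarrow> norm (x' - px (ws 1)) \<le> r3 \<Longrightarrow>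
       norm (gC x - gC x' - P (x - x')) \<le> 1 * norm (x - x')"
    using lin_C[OF zero_less_one] by blast
  \<comment> \<open>One constant dominating the amplification factors for trajectory, multiplier and
    unknowns.\<close>
  define k where "k = (\<pi> + 2) * (1 + 3 * c)"
  have k: "1 + 3 * c \<le> k" "(\<pi> + 2) * (1 + 2 * c) \<le> k" "c \<le> k"
  proof -
    have "1 * (1 + 3 * c) \<le> (\<pi> + 2) * (1 + 3 * c)" using c cst by (intro mult_right_mono) auto
    thus "1 + 3 * c \<le> k" by (simp add: k_def)
    thus "c \<le> k" using c by simp
    show "(\<pi> + 2) * (1 + 2 * c) \<le> k" unfolding k_def using c cst by (intro mult_left_mono) auto
  qed
  have k0: "k > 0" using k c by linarith
  define r where "r = min (min r1 r2) r3"
  have r: "r > 0" "r \<le> r1" "r \<le> r2" "r \<le> r3" using r1 r2 r3 by (auto simp: r_def)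
  define s where "s = min s0 (r / (2 * k))"
  have s: "s > 0" "s \<le> s0" "k * s \<le> r / 2"
  proof -
    show "s > 0" "s \<le> s0" using s0 r k0 by (auto simp: s_def)
    have "s \<le> r / 2 / k" by (simp add: s_def)
    thus "k * s \<le> r / 2" using k0 by (simp only: pos_le_divide_eq mult.commute)
  qed
  have "\<exists>a p. (\<forall>j\<in>{1..N}. res1 N a p j = 0 \<and> res2 N a p j = 0 \<and> norm (p j - pst (gauss_node N j)) \<le> k * \<epsilon>) \<and>
      (\<forall>t\<in>{-1..1}. norm (px (ws (-1)) + primal N a t - px (ws t)) \<le> k * \<epsilon> \<and> norm (lam N a p t - ls t) \<le> k * \<epsilon>) \<and>
      (\<exists>e>0. \<forall>a' p'. (\<forall>j\<in>{1..N}. res1 N a' p' j = 0 \<and> norm (wt N a' p' j - wt N a p j) < e) \<longrightarrow> norm (x1 N a' - x1 N a) < e \<longrightarrow>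
         C (x1 N a) \<le> C (x1 N a'))"
    if N: "N \<ge> 1" and \<epsilon>: "0 \<le> \<epsilon>" "\<epsilon> \<le> s" and def: "defect N \<epsilon>" for N \<epsilon>
  proof -
    obtain a p where n: "near N (c * \<epsilon>) a p" and res: "\<And>j. j \<in> {1..N} \<Longrightarrow> res1 N a p j = 0 \<and> res2 N a p j = 0"
      using sol[OF N \<epsilon>(1) order_trans[OF \<epsilon>(2) s(2)] def] by blast
    have d0: "0 \<le> c * \<epsilon>" using c \<epsilon> by simp
    have "k * \<epsilon> \<le> k * s" using \<epsilon> k0 by simp
    hence k\<epsilon>: "k * \<epsilon> \<le> r / 2" using s(3) by linarith
    have b3: "\<epsilon> + 3 * (c * \<epsilon>) \<le> k * \<epsilon>" using mult_right_mono[OF k(1) \<epsilon>(1)] by (simp add: algebra_simps)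
    have b2: "(\<pi> + 2) * (\<epsilon> + 2 * (c * \<epsilon>)) \<le> k * \<epsilon>" using mult_right_mono[OF k(2) \<epsilon>(1)] by (simp add: algebra_simps)
    have b1: "c * \<epsilon> \<le> k * \<epsilon>" using mult_right_mono[OF k(3) \<epsilon>(1)] .
    have X: "norm (px (ws (-1)) + primal N a t - px (ws t)) \<le> k * \<epsilon>" if "t \<in> {-1..1}" for t
      using near_bounds(1)[OF N d0 n def that] b3 d0 by linarith
    have Wt: "norm (wt N a p j - ws (gauss_node N j)) \<le> k * \<epsilon>" if "j \<in> {1..N}" for j
      using near_bounds(2)[OF N d0 n def that] b3 by linarith
    have r3': "\<epsilon> + 3 * (c * \<epsilon>) \<le> r3" using b3 k\<epsilon> r by linarith
    have Lm: "norm (lam N a p t - ls t) \<le> k * \<epsilon>" if "t \<in> {-1..1}" for t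
      using lam_bound[OF r3(2) order_refl N d0 n def \<epsilon>(1) r3' that] b2 by linarith
    have min: "C (x1 N a) \<le> C (x1 N a')"
      if h: "\<forall>j\<in>{1..N}. res1 N a' p' j = 0 \<and> norm (wt N a' p' j - wt N a p j) < r / 2" and hx: "norm (x1 N a' - x1 N a) < r / 2" for a' p'
    proof -
      let ?w = "wt N a p" and ?w' = "wt N a' p'" and ?b = "\<lambda>i. px (p i)" and ?da = "\<lambda>i. a' i - a i"
      let ?\<tau> = "gauss_node N"
      \<comment> \<open>At feasible points the values of \<open>f\<close> are the derivatives
        \<open>a'\<close> and \<open>a\<close>, and \<open>res2 = 0\<close> turns the
        \<open>Df\<close> term into a pairing with the costate derivative.\<close>
      have tm: "0 \<le> lam N a p (?\<tau> j) \<bullet> ?da j + ?b j \<bullet> primal N ?da (?\<tau> j)" if j: "j \<in> {1..N}" for j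
      proof -
        have t: "?\<tau> j \<in> {-1..1}" using gauss_node_bounds[OF j] by auto
        have w1: "norm (?w j - ws (?\<tau> j)) \<le> r1" using Wt[OF j] k\<epsilon> r by linarith
        have "norm (?w' j - ws (?\<tau> j)) \<le> norm (?w' j - ?w j) + norm (?w j - ws (?\<tau> j))"
          using norm_triangle_ineq[of "?w' j - ?w j" "?w j - ws (?\<tau> j)"] by simp
        moreover have "norm (?w' j - ?w j) < r / 2" using h j by blast
        ultimately have w2: "norm (?w' j - ws (?\<tau> j)) \<le> r1" using Wt[OF j] k\<epsilon> r by linarith
        have l1: "norm (lam N a p (?\<tau> j) - ls (?\<tau> j)) \<le> r1" using Lm[OF t] k\<epsilon> r by linarith
        have "0 \<le> lam N a p (?\<tau> j) \<bullet> (f (?w' j) - f (?w j) - blinfun_apply (Df (?w j)) (?w' j - ?w j))"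
          by (rule r1(2)[OF t w1 w2 l1])
        moreover have "f (?w' j) = a' j" "f (?w j) = a j" using h res j unfolding res1_def by auto
        moreover have "lam N a p (?\<tau> j) \<bullet> blinfun_apply (Df (?w j)) (?w' j - ?w j) = - (?b j \<bullet> primal N ?da (?\<tau> j))"
        proof -
          have "adj (Df (?w j)) (lam N a p (?\<tau> j)) = - ix (?b j)"
            using res[OF j] unfolding res2_def by (simp add: eq_neg_iff_add_eq_0 add.commute)
          hence "lam N a p (?\<tau> j) \<bullet> blinfun_apply (Df (?w j)) (?w' j - ?w j) = - (?b j \<bullet> px (?w' j - ?w j))"
            by (simp add: adj_inner[symmetric] ix_inner)
          also have "px (?w' j - ?w j) = primal N ?da (?\<tau> j)" unfolding wt_diff by simp
          finally show ?thesis .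
        qed
        ultimately show ?thesis by (simp add: inner_diff_right)
      qed
      have "0 \<le> (\<Sum>j=1..N. gauss_weight N j * (lam N a p (?\<tau> j) \<bullet> ?da j + ?b j \<bullet> primal N ?da (?\<tau> j)))"
        using tm gauss_weight_pos[of _ N] by (intro sum_nonneg mult_nonneg_nonneg) (auto simp: less_imp_le)
      also have "\<dots> = (\<Sum>j=1..N. gauss_weight N j * (lam N a p (?\<tau> j) \<bullet> ?da j)) + (\<Sum>j=1..N. gauss_weight N j * (?b j \<bullet> primal N ?da (?\<tau> j)))"
        by (simp add: distrib_left sum.distrib)
      also have "(\<Sum>j=1..N. gauss_weight N j * (?b j \<bullet> primal N ?da (?\<tau> j))) = (\<Sum>j=1..N. gauss_weight N j * (dual N ?b (?\<tau> j) \<bullet> ?da j))"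
        by (rule discrete_by_parts)
      \<comment> \<open>\<open>lam\<close> and \<open>dual\<close> add up to the constant
        \<open>gC (x1 N a)\<close>, so only the weighted sum of \<open>?da\<close> remains, which is
        the change of the endpoint.\<close>
      also have "(\<Sum>j=1..N. gauss_weight N j * (lam N a p (?\<tau> j) \<bullet> ?da j)) + \<dots> = (\<Sum>j=1..N. gauss_weight N j * (gC (x1 N a) \<bullet> ?da j))"
        by (simp add: lam_def sum.distrib[symmetric] distrib_left[symmetric] inner_add_left[symmetric])
      also have "\<dots> = gC (x1 N a) \<bullet> primal N ?da 1" by (simp add: primal_right inner_sum_right)
      also have "primal N ?da 1 = x1 N a' - x1 N a" by (simp add: x1_def primal_diff)
      finally have g: "0 \<le> gC (x1 N a) \<bullet> (x1 N a' - x1 N a)" .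
      have x1: "norm (x1 N a - px (ws 1)) \<le> r / 2" using X[of 1] k\<epsilon> by (simp add: x1_def)
      have x2: "norm (x1 N a' - px (ws 1)) \<le> r2"
        using norm_triangle_ineq[of "x1 N a' - x1 N a" "x1 N a - px (ws 1)"] x1 hx r by simp
      have "C (x1 N a) + gC (x1 N a) \<bullet> (x1 N a' - x1 N a) \<le> C (x1 N a')"
        using x1 r by (intro r2(2) x2) simp
      thus ?thesis using g by linarith
    qed
    have "\<forall>j\<in>{1..N}. res1 N a p j = 0 \<and> res2 N a p j = 0 \<and> norm (p j - pst (gauss_node N j)) \<le> k * \<epsilon>"
      using res n b1 unfolding near_def by (meson order_trans)
    moreover have "\<exists>e>0. \<forall>a' p'. (\<forall>j\<in>{1..N}. res1 N a' p' j = 0 \<and> norm (wt N a' p' j - wt N a p j) < e) \<longrightarrow> norm (x1 N a' - x1 N a) < e \<longrightarrow>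
         C (x1 N a) \<le> C (x1 N a')"
      using min r(1) by (intro exI[of _ "r / 2"]) auto
    ultimately show ?thesis using X Lm by blast
  qed
  thus ?thesis using k0 s(1) by (intro exI[of _ k] exI[of _ s] conjI) auto
qed

end

subsection \<open>Pairs of state and control\<close>

definition fstw :: "real^('n::finite+'m::finite) \<Rightarrow> real^'n" where "fstw w = (\<chi> i. w $ Inl i)"
definition sndw :: "real^('n::finite+'m::finite) \<Rightarrow> real^'m" where "sndw w = (\<chi> j. w $ Inr j)"
definition injw :: "real^'n::finite \<Rightarrow> real^('n+'m::finite)" where "injw x = pack x 0"

lemma pack_nth [simp]: "pack x u $ Inl i = x $ i" "pack x u $ Inr j = u $ j"
  by (simp_all add: pack_def)

lemma fstw_pack [simp]: "fstw (pack x u) = x" and sndw_pack [simp]: "sndw (pack x u) = u"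
  by (simp_all add: fstw_def sndw_def vec_eq_iff)

lemma vec_sum_eq_iff: "v = w \<longleftrightarrow> (\<forall>i. v $ Inl i = w $ Inl i) \<and> (\<forall>j. v $ Inr j = w $ Inr j)"
  for v w :: "real^('n::finite+'m::finite)"
  unfolding vec_eq_iff by (metis sum.exhaust)

lemma pack_eta [simp]: "pack (fstw w) (sndw w) = w"
  unfolding vec_sum_eq_iff by (simp add: fstw_def sndw_def)

lemma sum_UNIV_plus: "(\<Sum>k\<in>(UNIV::('n::finite+'m::finite) set). h k) = (\<Sum>i\<in>UNIV. h (Inl i)) + (\<Sum>j\<in>UNIV. h (Inr j))"
  using sum.Plus[of "UNIV::'n set" "UNIV::'m set" h] by (simp add: UNIV_Plus_UNIV o_def)

lemma inner_pack: "pack x u \<bullet> w = x \<bullet> fstw w + u \<bullet> sndw (w :: real^('n::finite+'m::finite))"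
  by (simp add: inner_vec_def sum_UNIV_plus fstw_def sndw_def)

lemma split_space_pack: "split_space (injw :: real^'n::finite \<Rightarrow> real^('n+'m::finite)) fstw"
proof (rule split_space.intro)
  show "linear (injw :: real^'n \<Rightarrow> real^('n+'m))"
    by (rule linearI) (simp_all add: vec_sum_eq_iff injw_def)
  show "linear (fstw :: real^('n+'m) \<Rightarrow> real^'n)"
    by (rule linearI) (simp_all add: vec_eq_iff fstw_def)
qed (simp_all add: injw_def inner_pack)

interpretation pk: split_space "injw :: real^'n::finite \<Rightarrow> real^('n+'m::finite)" fstw
  by (rule split_space_pack)

lemma norm_pack_sq: "(norm (pack x u))\<^sup>2 = (norm x)\<^sup>2 + (norm u)\<^sup>2"
  by (simp add: power2_norm_eq_inner inner_pack)

lemma norm_pack_le: "norm (pack x u) \<le> norm x + norm u"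
  by (rule power2_le_imp_le) (simp_all add: norm_pack_sq power2_sum)

lemma norm_sndw_le: "norm (sndw w) \<le> norm w"
proof (rule power2_le_imp_le)
  have "(norm w)\<^sup>2 = (norm (fstw w))\<^sup>2 + (norm (sndw w))\<^sup>2" using norm_pack_sq[of "fstw w" "sndw w"] by simp
  thus "(norm (sndw w))\<^sup>2 \<le> (norm w)\<^sup>2" by simp
qed simp

lemma pack_diff: "pack x u - pack y v = pack (x - y) (u - v)"
  by (simp add: vec_sum_eq_iff)

lemma pack_add: "pack x u + pack y v = pack (x + y) (u + v)"
  by (simp add: vec_sum_eq_iff)

lemma sndw_diff: "sndw (v - w) = sndw v - sndw w"
  by (simp add: sndw_def vec_eq_iff)

lemma pu_pack: "split_space.pu injw fstw w = pack 0 (sndw w)"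
proof -
  have e: "split_space.pu injw fstw w = pack (fstw w) (sndw w) - pack (fstw w) 0"
    unfolding pk.pu_def by (simp add: injw_def)
  show ?thesis unfolding e pack_diff by simp
qed

text \<open>The bridge between the abstract adjoint equation and the separate equations for the two
  gradients of H.\<close>

lemma adj_pack: "adj (Df (pack x u)) l = pack (gradxH Df x u l) (graduH Df x u l)"
proof -
  have e: "adj A l $ k = (\<Sum>j\<in>UNIV. blinfun_apply A (axis k 1) $ j * l $ j)" for A :: "(real^('a::finite+'b::finite)) \<Rightarrow>\<^sub>L (real^'a)" and k
  proof -
    have "adj A l $ k = adj A l \<bullet> axis k 1" by (simp add: inner_axis)
    also have "\<dots> = l \<bullet> blinfun_apply A (axis k 1)" by (rule adj_inner)
    finally show ?thesis by (simp add: inner_vec_def mult.commute)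
  qed
  show ?thesis
    unfolding vec_sum_eq_iff e
    by (simp add: gradxH_def graduH_def Jx_def Ju_def matrix_vector_mult_def transpose_def)
qed

lemma gradC_adj: "gradC DC x = adj (DC x) 1"
proof -
  have "adj (DC x) 1 $ k = adj (DC x) 1 \<bullet> axis k 1" for k by (simp add: inner_axis)
  thus ?thesis by (simp add: vec_eq_iff gradC_def adj_inner)
qed

section \<open>From matrix hypotheses to bilinear forms, operator norms and uniform
  linearization\<close>

lemma bilinear_matrix_inner:
  fixes b :: "real^'k \<Rightarrow> real^'k \<Rightarrow> real"
  assumes b: "bilinear b"
  shows "v \<bullet> ((\<chi> k k'. b (axis k 1) (axis k' 1)) *v v) = b v v"
proof -
  have l1: "linear (\<lambda>x. b x y)" and l2: "linear (b x)" for x y using b unfolding bilinear_def by blast+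
  have v: "v = (\<Sum>k\<in>UNIV. (v $ k) *\<^sub>R axis k 1)"
    using basis_expansion[of v] by (simp add: scalar_mult_eq_scaleR)
  have "b v v = b (\<Sum>k\<in>UNIV. (v $ k) *\<^sub>R axis k 1) v" by (subst (1) v) simp
  also have "\<dots> = (\<Sum>k\<in>UNIV. v $ k * b (axis k 1) v)"
    by (simp add: linear_sum[OF l1] linear_scale[OF l1])
  also have "\<dots> = (\<Sum>k\<in>UNIV. v $ k * (\<Sum>k'\<in>UNIV. v $ k' * b (axis k 1) (axis k' 1)))"
  proof (intro sum.cong refl arg_cong2[where f="(*)"])
    fix k
    have "b (axis k 1) v = b (axis k 1) (\<Sum>k'\<in>UNIV. (v $ k') *\<^sub>R axis k' 1)" by (subst (1) v) simp
    also have "\<dots> = (\<Sum>k'\<in>UNIV. v $ k' * b (axis k 1) (axis k' 1))"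
      by (simp add: linear_sum[OF l2] linear_scale[OF l2])
    finally show "b (axis k 1) v = (\<Sum>k'\<in>UNIV. v $ k' * b (axis k 1) (axis k' 1))" .
  qed
  finally show ?thesis
    by (simp add: inner_vec_def matrix_vector_mult_def mult.commute)
qed

lemma bilinear_coercive:
  fixes b :: "real^'k \<Rightarrow> real^'k \<Rightarrow> real"
  assumes b: "bilinear b" and s: "\<And>x y. b x y = b y x"
    and e: "min_eigenvalue (\<chi> k k'. b (axis k 1) (axis k' 1)) > \<alpha>"
  shows "\<alpha> * (norm v)\<^sup>2 \<le> b v v"
proof -
  let ?A = "\<chi> k k'. b (axis k 1) (axis k' 1)"
  have "\<alpha> * (norm v)\<^sup>2 \<le> min_eigenvalue ?A * (norm v)\<^sup>2" using e by (intro mult_right_mono) auto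
  also have "\<dots> \<le> v \<bullet> (?A *v v)" by (rule min_eigenvalue_le) (simp add: s)
  finally show ?thesis unfolding bilinear_matrix_inner[OF b] .
qed

lemma row_sum_le_mat_inf_norm: "(\<Sum>j\<in>UNIV. \<bar>A $ i $ j\<bar>) \<le> mat_inf_norm A"
  unfolding mat_inf_norm_def by (rule Max_ge) auto

text \<open>(A3) bounds row and column sums, while the energy argument works with Euclidean norms.
  Splitting each absolute entry into two square roots, Cauchy-Schwarz uses the row sums and, after
  exchanging the order of summation, the column sums enter.\<close>

lemma Schur_test:
  fixes A :: "real^'k^'l"
  assumes "mat_inf_norm A \<le> c" "mat_inf_norm (transpose A) \<le> c" "c \<ge> 0"
  shows "norm (A *v v) \<le> c * norm v"
proof (rule power2_le_imp_le)
  have row: "(\<Sum>j\<in>UNIV. \<bar>A $ i $ j\<bar>) \<le> c" for i using row_sum_le_mat_inf_norm[of A i] assms(1) by linarith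
  have col: "(\<Sum>i\<in>UNIV. \<bar>A $ i $ j\<bar>) \<le> c" for j
    using row_sum_le_mat_inf_norm[of "transpose A" j] assms(2) by (simp add: transpose_def)
  have "(norm (A *v v))\<^sup>2 = (\<Sum>i\<in>UNIV. (\<Sum>j\<in>UNIV. A $ i $ j * v $ j)\<^sup>2)"
    unfolding power2_norm_eq_inner inner_vec_def matrix_vector_mult_def by (simp add: power2_eq_square)
  also have "\<dots> \<le> (\<Sum>i\<in>UNIV. c * (\<Sum>j\<in>UNIV. \<bar>A $ i $ j\<bar> * (v $ j)\<^sup>2))"
  proof (rule sum_mono)
    fix i
    have "\<bar>\<Sum>j\<in>UNIV. A $ i $ j * v $ j\<bar> \<le> (\<Sum>j\<in>UNIV. \<bar>A $ i $ j * v $ j\<bar>)" by (rule sum_abs)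
    also have "\<dots> = (\<Sum>j\<in>UNIV. sqrt \<bar>A $ i $ j\<bar> * (sqrt \<bar>A $ i $ j\<bar> * \<bar>v $ j\<bar>))"
      by (simp add: abs_mult mult.assoc[symmetric])
    finally have "(\<Sum>j\<in>UNIV. A $ i $ j * v $ j)\<^sup>2 \<le> (\<Sum>j\<in>UNIV. sqrt \<bar>A $ i $ j\<bar> * (sqrt \<bar>A $ i $ j\<bar> * \<bar>v $ j\<bar>))\<^sup>2"
      by (simp add: abs_le_square_iff[symmetric])
    also have "\<dots> \<le> (\<Sum>j\<in>UNIV. (sqrt \<bar>A $ i $ j\<bar>)\<^sup>2) * (\<Sum>j\<in>UNIV. (sqrt \<bar>A $ i $ j\<bar> * \<bar>v $ j\<bar>)\<^sup>2)"
      by (rule Cauchy_Schwarz_ineq_sum)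
    also have "\<dots> = (\<Sum>j\<in>UNIV. \<bar>A $ i $ j\<bar>) * (\<Sum>j\<in>UNIV. \<bar>A $ i $ j\<bar> * (v $ j)\<^sup>2)"
      by (simp add: power_mult_distrib)
    also have "\<dots> \<le> c * (\<Sum>j\<in>UNIV. \<bar>A $ i $ j\<bar> * (v $ j)\<^sup>2)"
      by (intro mult_right_mono row sum_nonneg) auto
    finally show "(\<Sum>j\<in>UNIV. A $ i $ j * v $ j)\<^sup>2 \<le> c * (\<Sum>j\<in>UNIV. \<bar>A $ i $ j\<bar> * (v $ j)\<^sup>2)" .
  qed
  also have "\<dots> = c * (\<Sum>j\<in>UNIV. (\<Sum>i\<in>UNIV. \<bar>A $ i $ j\<bar>) * (v $ j)\<^sup>2)"
    unfolding sum_distrib_left[symmetric] by (subst sum.swap) (simp add: sum_distrib_right)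
  also have "\<dots> \<le> c * (\<Sum>j\<in>UNIV. c * (v $ j)\<^sup>2)"
    using assms(3) by (intro mult_left_mono sum_mono mult_right_mono col) auto
  also have "\<dots> = (c * norm v)\<^sup>2"
  proof -
    have "(norm v)\<^sup>2 = (\<Sum>j\<in>UNIV. (v $ j)\<^sup>2)"
      unfolding power2_norm_eq_inner inner_vec_def by (simp add: power2_eq_square)
    thus ?thesis by (simp add: power_mult_distrib sum_distrib_left[symmetric] power2_eq_square[of c])
  qed
  finally show "(norm (A *v v))\<^sup>2 \<le> (c * norm v)\<^sup>2" .
qed (use assms in simp)

lemma continuous_bounded_Icc:
  fixes h :: "real \<Rightarrow> 'a::real_normed_vector"
  assumes "continuous_on {-1..1} h"
  shows "\<exists>B\<ge>0. \<forall>t\<in>{-1..1}. norm (h t) \<le> B"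
proof -
  have "bounded (h ` {-1..1})" using assms by (intro compact_imp_bounded compact_continuous_image) auto
  then obtain B where "\<forall>x\<in>h ` {-1..1}. norm x \<le> B" unfolding bounded_iff by blast
  thus ?thesis by (intro exI[of _ "max B 0"]) (auto intro: max.coboundedI1)
qed

text \<open>\<open>F'\<close> is uniformly continuous on the compact tube of radius \<rho> around
  \<open>S\<close>, so the mean value inequality for \<open>F z - F' c z\<close> on a small ball
  gives a radius independent of the centre.\<close>

lemma uniform_linearization:
  fixes F :: "'a::euclidean_space \<Rightarrow> 'b::real_normed_vector" and F' :: "'a \<Rightarrow> 'a \<Rightarrow>\<^sub>L 'b"
  assumes S: "compact S" and \<rho>: "\<rho> > 0" "\<And>c. c \<in> S \<Longrightarrow> cball c \<rho> \<subseteq> U"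
    and d: "\<And>z. z \<in> U \<Longrightarrow> (F has_derivative F' z) (at z)" and c: "continuous_on U F'" and \<delta>: "\<delta> > 0"
  shows "\<exists>r>0. \<forall>c\<in>S. \<forall>w w'. norm (w - c) \<le> r \<longrightarrow> norm (w' - c) \<le> r \<longrightarrow>
     norm (F w - F w' - F' c (w - w')) \<le> \<delta> * norm (w - w')"
proof -
  define K where "K = {x + y |x y. x \<in> S \<and> y \<in> cball 0 \<rho>}"
  have "compact K" unfolding K_def by (intro compact_sums S compact_cball)
  moreover have KU: "K \<subseteq> U"
  proof
    fix z assume "z \<in> K"
    then obtain x y where xy: "z = x + y" "x \<in> S" "norm y \<le> \<rho>" unfolding K_def by auto
    hence "z \<in> cball x \<rho>" by (simp add: dist_norm)
    thus "z \<in> U" using \<rho>(2)[OF xy(2)] by blast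
  qed
  ultimately have "uniformly_continuous_on K F'"
    using c by (intro compact_uniformly_continuous) (auto intro: continuous_on_subset)
  then obtain d0 where d0: "d0 > 0" "\<And>z z'. z \<in> K \<Longrightarrow> z' \<in> K \<Longrightarrow> dist z' z < d0 \<Longrightarrow> dist (F' z') (F' z) < \<delta>"
    using \<delta> unfolding uniformly_continuous_on_def by meson
  define r where "r = min \<rho> (d0 / 2)"
  have r: "r > 0" "r \<le> \<rho>" "r < d0" using \<rho> d0 by (auto simp: r_def)
  have inK: "z \<in> K" if "c \<in> S" "norm (z - c) \<le> \<rho>" for z c
    unfolding K_def using that by (intro CollectI exI[of _ c] exI[of _ "z - c"]) auto
  show ?thesis
  proof (intro exI[of _ r] conjI r(1) ballI allI impI)
    fix c w w' assume c: "c \<in> S" and w: "norm (w - c) \<le> r" "norm (w' - c) \<le> r"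
    have "norm ((\<lambda>z. F z - F' c z) w - (\<lambda>z. F z - F' c z) w') \<le> \<delta> * norm (w - w')"
    proof (rule differentiable_bound[where S="cball c r" and f'="\<lambda>z. blinfun_apply (F' z - F' c)"])
      fix z assume z: "z \<in> cball c r"
      hence zc: "norm (z - c) \<le> r" by (simp add: dist_norm norm_minus_commute)
      have zK: "z \<in> K" "c \<in> K" using inK[OF c] zc r \<rho> by auto
      have "(F has_derivative F' z) (at z within cball c r)"
        by (rule has_derivative_at_withinI[OF d[OF subsetD[OF KU zK(1)]]])
      from has_derivative_diff[OF this bounded_linear.has_derivative[OF blinfun.bounded_linear_right[of "F' c"] has_derivative_ident]]
      show "((\<lambda>z. F z - F' c z) has_derivative blinfun_apply (F' z - F' c)) (at z within cball c r)"
        by (rule has_derivative_eq_rhs) (simp add: fun_eq_iff blinfun.diff_left)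
      have "dist (F' z) (F' c) < \<delta>" using zc r by (intro d0(2) zK) (simp add: dist_norm)
      thus "onorm (blinfun_apply (F' z - F' c)) \<le> \<delta>" by (simp add: dist_norm norm_blinfun.rep_eq)
    qed (use w in \<open>auto simp: dist_norm norm_minus_commute\<close>)
    thus "norm (F w - F w' - F' c (w - w')) \<le> \<delta> * norm (w - w')"
      by (simp add: blinfun.diff_right algebra_simps)
  qed
qed

section \<open>Polynomial trajectories in terms of nodal derivatives\<close>

lemma polyvec_primal: "polyvec N (\<lambda>t. v + primal N a t)"
  unfolding polyvec_def
proof
  fix k
  let ?p = "[:v $ k:] + (\<Sum>i=1..N. smult (a i $ k) (gprim N i))"
  have "degree ?p \<le> N"
    by (intro degree_add_le degree_sum_le) (auto intro!: order_trans[OF degree_smult_le degree_gprim] simp del: degree_smult_eq)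
  moreover have "(v + primal N a t) $ k = poly ?p t" for t
    by (simp add: primal_def poly_sum mult.commute)
  ultimately show "\<exists>p. degree p \<le> N \<and> (\<forall>t. (v + primal N a t) $ k = poly p t)" by blast
qed

lemma primal_has_derivative:
  fixes a :: "nat \<Rightarrow> 'a::real_normed_vector"
  assumes "j \<in> {1..N}"
  shows "(primal N a has_vector_derivative a j) (at (gauss_node N j))"
proof -
  have "((\<lambda>t. \<Sum>i=1..N. poly (gprim N i) t *\<^sub>R a i) has_vector_derivative (\<Sum>i=1..N. poly (glag N i) (gauss_node N j) *\<^sub>R a i)) (at (gauss_node N j))"
  proof (rule has_vector_derivative_sum)
    fix i
    have "(poly (gprim N i) has_real_derivative poly (glag N i) (gauss_node N j)) (at (gauss_node N j))"
      using poly_DERIV[of "gprim N i"] by simp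
    thus "((\<lambda>t. poly (gprim N i) t *\<^sub>R a i) has_vector_derivative poly (glag N i) (gauss_node N j) *\<^sub>R a i) (at (gauss_node N j))"
      using has_vector_derivative_scaleR[OF _ has_vector_derivative_const[of "a i"]] by auto
  qed
  moreover have "(\<Sum>i=1..N. poly (glag N i) (gauss_node N j) *\<^sub>R a i) = (\<Sum>i=1..N. if i = j then a j else 0)"
    using assms by (intro sum.cong) (auto simp: glag_node)
  ultimately show ?thesis using assms unfolding primal_def[abs_def] by simp
qed

text \<open>Every competitor in (D) is recovered from its nodal derivatives, so no generality is
  lost by taking these as the unknowns.\<close>

lemma polyvec_eq_primal:
  assumes y: "polyvec N y" and N: "N \<ge> 1"
    and d: "\<And>i. i \<in> {1..N} \<Longrightarrow> (y has_vector_derivative y' i) (at (gauss_node N i))"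
  shows "y t = y (-1) + primal N y' t"
proof (subst vec_eq_iff, intro allI)
  fix k
  obtain p where p: "degree p \<le> N" "\<And>t. y t $ k = poly p t" using y unfolding polyvec_def by blast
  have "poly (pderiv p) (gauss_node N i) = y' i $ k" if i: "i \<in> {1..N}" for i
  proof -
    have "((\<lambda>t. y t $ k) has_vector_derivative y' i $ k) (at (gauss_node N i))"
      using bounded_linear.has_vector_derivative[OF bounded_linear_vec_nth d[OF i]] .
    hence "(poly p has_real_derivative y' i $ k) (at (gauss_node N i))"
      unfolding p(2) has_real_derivative_iff_has_vector_derivative .
    thus ?thesis using poly_DERIV DERIV_unique by blast
  qed
  thus "y t $ k = (y (-1) + primal N y' t) $ k"
    using poly_eq_gprim[OF p(1) N, of t] by (simp add: p(2) primal_def)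
qed

lemma dual_eq_primal: "dual N b t = primal N b 1 - primal N b t"
  by (simp add: dual_def primal_def scaleR_left_diff_distrib sum_subtractf)

lemma continuous_on_pack:
  fixes x :: "'s::topological_space \<Rightarrow> real^'n" and u :: "'s \<Rightarrow> real^'m"
  assumes "continuous_on S x" "continuous_on S u"
  shows "continuous_on S (\<lambda>t. pack (x t) (u t))"
  unfolding pack_def
proof (rule continuous_on_vec_lambda)
  fix k :: "'n + 'm"
  show "continuous_on S (\<lambda>t. case k of Inl i \<Rightarrow> x t $ i | Inr j \<Rightarrow> u t $ j)"
    using assms by (cases k) (auto intro: continuous_intros)
qed

theorem theorem1p1:
  fixes f :: "real^'n \<Rightarrow> real^'m \<Rightarrow> real^'n"
    and C :: "real^'n \<Rightarrow> real"
    and x0 :: "real^'n"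
    and xs :: "real \<Rightarrow> real^'n" and us :: "real \<Rightarrow> real^'m" and ls :: "real \<Rightarrow> real^'n"
    and \<Omega> :: "(real^('n+'m)) set" and \<rho> :: real
    and Df :: "real^('n+'m) \<Rightarrow> ((real^('n+'m)) \<Rightarrow>\<^sub>L (real^'n))"
    and D2f :: "real^('n+'m) \<Rightarrow> ((real^('n+'m)) \<Rightarrow>\<^sub>L ((real^('n+'m)) \<Rightarrow>\<^sub>L (real^'n)))"
    and DC :: "real^'n \<Rightarrow> ((real^'n) \<Rightarrow>\<^sub>L real)"
    and D2C :: "real^'n \<Rightarrow> ((real^'n) \<Rightarrow>\<^sub>L ((real^'n) \<Rightarrow>\<^sub>L real))"
    and \<eta> :: nat and \<alpha> :: real
  assumes locmin: "local_min_P f C x0 xs us"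
    and us_C0: "continuous_on {-1..1} us"
    and xs_C1: "Ck_on 1 {-1..1} xs"
    and \<Omega>_open: "open \<Omega>" and \<rho>_pos: "\<rho> > 0"
    and balls: "\<forall>t\<in>{-1..1}. cball (pack (xs t) (us t)) \<rho> \<subseteq> \<Omega>"
    and f_D1: "\<forall>z\<in>\<Omega>. ((\<lambda>z. f (\<chi> i. z $ Inl i) (\<chi> j. z $ Inr j)) has_derivative blinfun_apply (Df z)) (at z)"
    and f_D2: "\<forall>z\<in>\<Omega>. (Df has_derivative blinfun_apply (D2f z)) (at z)"
    and f_cont: "continuous_on (closure \<Omega>) Df" "continuous_on (closure \<Omega>) D2f"
    and C_D1: "\<forall>x\<in>cball (xs 1) \<rho>. (C has_derivative blinfun_apply (DC x)) (at x within cball (xs 1) \<rho>)"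
    and C_D2: "\<forall>x\<in>cball (xs 1) \<rho>. (DC has_derivative blinfun_apply (D2C x)) (at x within cball (xs 1) \<rho>)"
    and C_cont: "continuous_on (cball (xs 1) \<rho>) DC" "continuous_on (cball (xs 1) \<rho>) D2C"
    and costate: "\<forall>t\<in>{-1..1}. (ls has_vector_derivative - gradxH Df (xs t) (us t) (ls t)) (at t within {-1..1})"
    and costate_end: "ls 1 = gradC DC (xs 1)"
    and stationary: "\<forall>t\<in>{-1..1}. graduH Df (xs t) (us t) (ls t) = 0"
    and A1: "\<eta> \<ge> 3" "Ck_on (\<eta> + 1) {-1..1} xs" "Ck_on (\<eta> + 1) {-1..1} ls"
    and A2: "\<alpha> > 0" "min_eigenvalue (hessC D2C (xs 1)) > \<alpha>"
            "\<forall>t\<in>{-1..1}. min_eigenvalue (hessH D2f (xs t) (us t) (ls t)) > \<alpha>"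
    and A3: "\<forall>t\<in>{-1..1}. mat_inf_norm (Jx Df (xs t) (us t)) \<le> 1/4 \<and>
                          mat_inf_norm (transpose (Jx Df (xs t) (us t))) \<le> 1/4"
    and P1: "\<forall>N\<ge>1. \<exists>B. is_inverse_N N (Dmat N) B \<and> row_sum_norm_N N B \<le> 2"
    and P2: "\<forall>N\<ge>1. \<exists>B. is_inverse_N N (WhalfD N) B \<and>
                       (\<forall>i\<in>{1..N}. sqrt (\<Sum>j=1..N. (B i j)\<^sup>2) \<le> sqrt 2)"
  shows "\<exists>c::real. \<exists>N0::nat. \<forall>N. N \<ge> N0 \<and> N > \<eta> + 1 \<longrightarrow>
           (\<exists>(xN :: real \<Rightarrow> real^'n) (uN :: nat \<Rightarrow> real^'m) (lN :: real \<Rightarrow> real^'n).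
              local_min_D f C x0 N xN uN \<and>
              polyvec N lN \<and>
              (\<forall>i\<in>{1..N}. (lN has_vector_derivative
                   - gradxH Df (xN (gauss_node N i)) (uN i) (lN (gauss_node N i))) (at (gauss_node N i))) \<and>
              lN 1 = gradC DC (xN 1) \<and>
              (\<forall>i\<in>{1..N}. graduH Df (xN (gauss_node N i)) (uN i) (lN (gauss_node N i)) = 0) \<and>
              (\<forall>i\<in>{0..N+1}. norm (xN (gauss_node N i) - xs (gauss_node N i)) \<le> c * real N powr (2 - real \<eta>)) \<and>
              (\<forall>i\<in>{1..N}. norm (uN i - us (gauss_node N i)) \<le> c * real N powr (2 - real \<eta>)) \<and>
              (\<forall>i\<in>{0..N+1}. norm (lN (gauss_node N i) - ls (gauss_node N i)) \<le> c * real N powr (2 - real \<eta>)))"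
proof -
  define ws where "ws t = pack (xs t) (us t)" for t
  define fW where "fW z = f (fstw z) (sndw z)" for z
  define P where "P h = adj (D2C (xs 1) h) 1" for h
  define xd where "xd t = f (xs t) (us t)" for t
  define ld where "ld t = - gradxH Df (xs t) (us t) (ls t)" for t
  define D2 where "D2 t = blinfun_apply (D2f (ws t))" for t
  have fst_ws [simp]: "fstw (ws t) = xs t" "sndw (ws t) = us t" for t by (simp_all add: ws_def)
  have feas: "feasible_P f x0 xs us" using locmin unfolding local_min_P_def by blast
  have xs_d: "(xs has_vector_derivative xd t) (at t within {-1..1})" if "t \<in> {-1..1}" for t
    using feas that unfolding feasible_P_def xd_def by blast
  have xs_0: "xs (-1) = x0" using feas unfolding feasible_P_def by blast
  have ls_d: "(ls has_vector_derivative ld t) (at t within {-1..1})" if "t \<in> {-1..1}" for t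
    using costate that unfolding ld_def by blast
  have cxs: "continuous_on {-1..1} xs" using xs_d by (rule continuous_on_vector_derivative)
  have cls: "continuous_on {-1..1} ls" using ls_d by (rule continuous_on_vector_derivative)
  have cws: "continuous_on {-1..1} ws" unfolding ws_def by (intro continuous_on_pack cxs us_C0)
  have cbl: "cball (ws t) \<rho> \<subseteq> \<Omega>" if "t \<in> {-1..1}" for t using balls that unfolding ws_def by blast
  have ws\<Omega>: "ws t \<in> \<Omega>" if "t \<in> {-1..1}" for t using cbl[OF that] \<rho>_pos by (meson centre_in_cball less_imp_le subsetD)
  have fD: "(fW has_derivative blinfun_apply (Df z)) (at z)" if "z \<in> \<Omega>" for z
    using f_D1 that unfolding fW_def fstw_def sndw_def by blast
  have DfD: "(Df has_derivative blinfun_apply (D2f z)) (at z)" if "z \<in> \<Omega>" for z using f_D2 that by blast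
  have c\<Omega>: "continuous_on \<Omega> Df" "continuous_on \<Omega> D2f"
    using f_cont closure_subset by (auto intro: continuous_on_subset)
  have cG: "continuous_on {-1..1} (\<lambda>t. Df (ws t))" "continuous_on {-1..1} (\<lambda>t. D2f (ws t))"
    using ws\<Omega> by (auto intro!: continuous_on_compose2[OF c\<Omega>(1) cws] continuous_on_compose2[OF c\<Omega>(2) cws])
  obtain g where g: "g \<ge> 0" "\<And>t. t \<in> {-1..1} \<Longrightarrow> norm (Df (ws t)) \<le> g" using continuous_bounded_Icc[OF cG(1)] by blast
  obtain q where q: "q \<ge> 0" "\<And>t. t \<in> {-1..1} \<Longrightarrow> norm (D2f (ws t)) \<le> q" using continuous_bounded_Icc[OF cG(2)] by blast
  obtain L where L: "L \<ge> 0" "\<And>t. t \<in> {-1..1} \<Longrightarrow> norm (ls t) \<le> L" using continuous_bounded_Icc[OF cls] by blast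
  define \<pi> where "\<pi> = norm (D2C (xs 1))"
  \<comment> \<open>\<open>C\<close> is differentiable within the closed ball; at interior points
    this is the full derivative, as symmetry of the second derivative requires.\<close>
  have interior: "x \<in> interior (cball (xs 1) \<rho>)" if "x \<in> ball (xs 1) \<rho>" for x using that by simp
  have CD: "(C has_derivative blinfun_apply (DC x)) (at x)" if "x \<in> ball (xs 1) \<rho>" for x
    using C_D1[rule_format, of x] that at_within_interior[OF interior[OF that]] ball_subset_cball by auto
  have DCD: "(DC has_derivative blinfun_apply (D2C x)) (at x)" if "x \<in> ball (xs 1) \<rho>" for x
    using C_D2[rule_format, of x] that at_within_interior[OF interior[OF that]] ball_subset_cball by auto
  have x1b: "xs 1 \<in> ball (xs 1) \<rho>" using \<rho>_pos by simp
  have cS: "compact (ws ` {-1..1})" using cws by (intro compact_continuous_image) auto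
  have bilf: "bilinear (\<lambda>h k. ls t \<bullet> blinfun_apply (D2 t h) k)" for t
    unfolding bilinear_def D2_def
    by (auto intro!: linearI simp: blinfun.add_right blinfun.add_left blinfun.scaleR_right blinfun.scaleR_left inner_add_right)
  \<comment> \<open>Symmetry makes (A2) usable as coercivity: for a matrix that is not symmetric, a
    bound on the real eigenvalues would not bound the quadratic form.\<close>
  have symf: "blinfun_apply (D2 t h) k = blinfun_apply (D2 t k) h" if "t \<in> {-1..1}" for t h k
    unfolding D2_def by (rule second_derivative_symmetric[OF \<Omega>_open ws\<Omega>[OF that] fD DfD[OF ws\<Omega>[OF that]]])
  have coerf: "\<alpha> * (norm h)\<^sup>2 \<le> ls t \<bullet> blinfun_apply (D2 t h) h" if t: "t \<in> {-1..1}" for t h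
  proof (rule bilinear_coercive[OF bilf])
    show "ls t \<bullet> blinfun_apply (D2 t x) y = ls t \<bullet> blinfun_apply (D2 t y) x" for x y using symf[OF t] by simp
    show "min_eigenvalue (\<chi> k k'. ls t \<bullet> blinfun_apply (D2 t (axis k 1)) (axis k' 1)) > \<alpha>"
      using A2(3) t unfolding hessH_def ws_def[symmetric] D2_def by blast
  qed
  have coerC: "\<alpha> * (norm h)\<^sup>2 \<le> blinfun_apply (blinfun_apply (D2C (xs 1)) h) h" for h
  proof (rule bilinear_coercive[where b="\<lambda>h k. blinfun_apply (blinfun_apply (D2C (xs 1)) h) k"])
    show "bilinear (\<lambda>h k. blinfun_apply (blinfun_apply (D2C (xs 1)) h) k)"
      unfolding bilinear_def
      by (auto intro!: linearI simp: blinfun.add_right blinfun.add_left blinfun.scaleR_right blinfun.scaleR_left)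
    show "blinfun_apply (blinfun_apply (D2C (xs 1)) x) y = blinfun_apply (blinfun_apply (D2C (xs 1)) y) x" for x y
      by (rule second_derivative_symmetric[OF open_ball x1b CD DCD[OF x1b]])
    show "min_eigenvalue (\<chi> k k'. blinfun_apply (blinfun_apply (D2C (xs 1)) (axis k 1)) (axis k' 1)) > \<alpha>"
      using A2(2) unfolding hessC_def .
  qed
  have adjw: "adj (Df (ws t)) l = pack (gradxH Df (xs t) (us t) l) (graduH Df (xs t) (us t) l)" for t l
    unfolding ws_def by (rule adj_pack)
  have Pin: "P h \<bullet> k = blinfun_apply (blinfun_apply (D2C (xs 1)) h) k" for h k
    unfolding P_def adj_inner by simp
  interpret O: ocp_min injw fstw fW Df D2 "gradC DC" P ws ls xd ld \<alpha> g q \<pi> L C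
  proof (intro ocp_min.intro ocp.intro ocp_axioms.intro ocp_min_axioms.intro split_space_pack)
    fix t :: real assume t: "t \<in> {-1..1}"
    show "norm (Df (ws t)) \<le> g" using g t by blast
    show "linear (D2 t)" unfolding D2_def by (rule bounded_linear.linear[OF blinfun.bounded_linear_right])
    show "norm (D2 t h) \<le> q * norm h" for h
      unfolding D2_def using norm_blinfun[of "D2f (ws t)" h] q(2)[OF t] by (meson mult_right_mono norm_ge_zero order_trans)
    show "norm (ls t) \<le> L" using L t by blast
    show "\<alpha> * (norm h)\<^sup>2 \<le> ls t \<bullet> blinfun_apply (D2 t h) h" for h by (rule coerf[OF t])
    show "norm (fstw (adj (Df (ws t)) \<mu>)) \<le> norm \<mu> / 4" for \<mu>
      using Schur_test[of "transpose (Jx Df (xs t) (us t))" "1/4" \<mu>] A3 t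
      unfolding adjw by (simp add: gradxH_def)
    show "xd t = fW (ws t)" by (simp add: xd_def fW_def)
    show "injw (ld t) + adj (Df (ws t)) (ls t) = 0"
      using stationary t unfolding adjw injw_def pack_add ld_def by (simp add: vec_sum_eq_iff)
  next
    show "linear P" unfolding P_def
      by (rule linearI; rule vector_eq_rdot[THEN iffD1])
         (simp_all add: adj_inner blinfun.add_right blinfun.add_left blinfun.scaleR_right blinfun.scaleR_left inner_add_left)
    show "norm (P x) \<le> \<pi> * norm x" for x
      unfolding P_def \<pi>_def using norm_adj_le[of "blinfun_apply (D2C (xs 1)) x" 1] norm_blinfun[of "D2C (xs 1)" x] by simp
    show "\<alpha> * (norm x)\<^sup>2 \<le> x \<bullet> P x" for x using coerC[of x] by (simp add: inner_commute[of x] Pin)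
    thus "0 \<le> x \<bullet> P x" for x using A2(1) by (meson less_imp_le mult_nonneg_nonneg order_trans zero_le_power2)
    show "ls 1 = gradC DC (fstw (ws 1))" using costate_end by simp
  next
    fix \<delta> :: real assume \<delta>: "\<delta> > 0"
    obtain r1 where r1: "r1 > 0" "\<And>c w w'. c \<in> ws ` {-1..1} \<Longrightarrow> norm (w - c) \<le> r1 \<Longrightarrow> norm (w' - c) \<le> r1 \<Longrightarrow>
       norm (fW w - fW w' - Df c (w - w')) \<le> \<delta> * norm (w - w')"
      using uniform_linearization[OF cS \<rho>_pos _ fD c\<Omega>(1) \<delta>] cbl by blast
    obtain r2 where r2: "r2 > 0" "\<And>c w w'. c \<in> ws ` {-1..1} \<Longrightarrow> norm (w - c) \<le> r2 \<Longrightarrow> norm (w' - c) \<le> r2 \<Longrightarrow>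
       norm (Df w - Df w' - D2f c (w - w')) \<le> \<delta> * norm (w - w')"
      using uniform_linearization[OF cS \<rho>_pos _ DfD c\<Omega>(2) \<delta>] cbl by blast
    show "\<exists>r>0. \<forall>t\<in>{-1..1}. \<forall>w w'. norm (w - ws t) \<le> r \<longrightarrow> norm (w' - ws t) \<le> r \<longrightarrow>
       norm (fW w - fW w' - blinfun_apply (Df (ws t)) (w - w')) \<le> \<delta> * norm (w - w') \<and>
       norm (Df w - Df w' - D2 t (w - w')) \<le> \<delta> * norm (w - w')"
      unfolding D2_def using r1 r2 by (intro exI[of _ "min r1 r2"]) auto
  next
    fix \<delta> :: real assume \<delta>: "\<delta> > 0"
    have "continuous_on (ball (xs 1) \<rho>) D2C" using C_cont(2) ball_subset_cball by (rule continuous_on_subset)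
    \<comment> \<open>Half the radius, because \<open>uniform_linearization\<close> asks for closed
      balls inside the set where the full derivative exists.\<close>
    moreover have "cball c (\<rho> / 2) \<subseteq> ball (xs 1) \<rho>" if "c \<in> {xs 1}" for c
      using that \<rho>_pos by (auto simp: dist_norm)
    ultimately obtain r where r: "r > 0" "\<And>w w'. norm (w - xs 1) \<le> r \<Longrightarrow> norm (w' - xs 1) \<le> r \<Longrightarrow>
        norm (DC w - DC w' - D2C (xs 1) (w - w')) \<le> \<delta> * norm (w - w')"
      using uniform_linearization[of "{xs 1}" "\<rho> / 2" "ball (xs 1) \<rho>" DC D2C \<delta>, OF _ _ _ DCD _ \<delta>] \<rho>_pos by auto
    have e: "gradC DC x - gradC DC x' - P (x - x') = adj (DC x - DC x' - D2C (xs 1) (x - x')) 1" for x x'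
      by (simp add: gradC_adj P_def adj_diff_left)
    show "\<exists>r>0. \<forall>x x'. norm (x - fstw (ws 1)) \<le> r \<longrightarrow> norm (x' - fstw (ws 1)) \<le> r \<longrightarrow>
       norm (gradC DC x - gradC DC x' - P (x - x')) \<le> \<delta> * norm (x - x')"
    proof (intro exI[of _ r] conjI r(1) allI impI)
      fix x x' assume "norm (x - fstw (ws 1)) \<le> r" "norm (x' - fstw (ws 1)) \<le> r"
      hence "norm (DC x - DC x' - D2C (xs 1) (x - x')) \<le> \<delta> * norm (x - x')" by (intro r(2)) simp_all
      thus "norm (gradC DC x - gradC DC x' - P (x - x')) \<le> \<delta> * norm (x - x')"
        unfolding e using norm_adj_le[of "DC x - DC x' - D2C (xs 1) (x - x')" 1] by simp
    qed
  next
    show "\<exists>r>0. \<forall>t\<in>{-1..1}. \<forall>w. norm (w - ws t) \<le> r \<longrightarrow> (fW has_derivative blinfun_apply (Df w)) (at w)"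
    proof (intro exI[of _ \<rho>] conjI \<rho>_pos ballI allI impI)
      fix t w assume "t \<in> {-1..1::real}" "norm (w - ws t) \<le> \<rho>"
      thus "(fW has_derivative blinfun_apply (Df w)) (at w)"
        using cbl[of t] by (intro fD) (auto simp: dist_norm norm_minus_commute subset_iff)
    qed
    show "\<exists>r>0. \<forall>x. norm (x - fstw (ws 1)) \<le> r \<longrightarrow> (C has_derivative (\<lambda>h. gradC DC x \<bullet> h)) (at x)"
    proof (intro exI[of _ "\<rho> / 2"] conjI allI impI)
      fix x assume "norm (x - fstw (ws 1)) \<le> \<rho> / 2"
      hence "x \<in> ball (xs 1) \<rho>" using \<rho>_pos by (simp add: dist_norm norm_minus_commute)
      from CD[OF this] show "(C has_derivative (\<lambda>h. gradC DC x \<bullet> h)) (at x)"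
        by (rule has_derivative_eq_rhs) (simp add: fun_eq_iff gradC_adj adj_inner)
    qed (use \<rho>_pos in simp)
  qed (use A2(1) g q L \<pi>_def in auto)

  obtain cx where cx: "cx \<ge> 0" "\<And>N t. N \<ge> \<eta> + 3 \<Longrightarrow> t \<in> {-1..1} \<Longrightarrow>
     norm (xs t - xs (-1) - (\<Sum>i=1..N. poly (gprim N i) t *\<^sub>R xd (gauss_node N i))) \<le> cx / real N ^ (\<eta> - 1)"
    using collocation_defect[OF A1(2) _ xs_d] A1(1) by auto
  obtain cl where cl: "cl \<ge> 0" "\<And>N t. N \<ge> \<eta> + 3 \<Longrightarrow> t \<in> {-1..1} \<Longrightarrow>
     norm (ls t - ls (-1) - (\<Sum>i=1..N. poly (gprim N i) t *\<^sub>R ld (gauss_node N i))) \<le> cl / real N ^ (\<eta> - 1)"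
    using collocation_defect[OF A1(3) _ ls_d] A1(1) by auto
  \<comment> \<open>The costate is anchored at 1 while \<open>collocation_defect\<close> measures
    from -1, so its defect is a difference of two errors and \<open>cl\<close> counts twice.\<close>
  define b where "b = cx + 2 * cl"
  have b: "b \<ge> 0" using cx cl by (simp add: b_def)
  define \<epsilon> where "\<epsilon> N = b / real N ^ (\<eta> - 1)" for N
  have def: "O.defect N (\<epsilon> N)" if N: "N \<ge> \<eta> + 3" for N
    unfolding O.defect_def
  proof (intro ballI conjI)
    fix t :: real assume t: "t \<in> {-1..1}"
    have N0: "real N ^ (\<eta> - 1) > 0" using N by simp
    have "norm (fstw (ws (-1)) + primal N (\<lambda>i. xd (gauss_node N i)) t - fstw (ws t)) \<le> cx / real N ^ (\<eta> - 1)"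
      using cx(2)[OF N t] by (simp add: primal_def norm_minus_commute diff_diff_eq algebra_simps)
    also have "\<dots> \<le> \<epsilon> N" unfolding \<epsilon>_def b_def using cl N0 by (intro divide_right_mono) auto
    finally show "norm (fstw (ws (-1)) + primal N (\<lambda>i. xd (gauss_node N i)) t - fstw (ws t)) \<le> \<epsilon> N" .
    let ?E = "\<lambda>t. ls t - ls (-1) - primal N (\<lambda>i. ld (gauss_node N i)) t"
    have E: "norm (?E t) \<le> cl / real N ^ (\<eta> - 1)" if "t \<in> {-1..1}" for t
      using cl(2)[OF N that] by (simp add: primal_def)
    have e: "ls 1 - dual N (\<lambda>i. ld (gauss_node N i)) t - ls t = ?E 1 - ?E t" by (simp add: dual_eq_primal)
    have "norm (ls 1 - dual N (\<lambda>i. ld (gauss_node N i)) t - ls t) \<le> cl / real N ^ (\<eta> - 1) + cl / real N ^ (\<eta> - 1)"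
      unfolding e using norm_triangle_ineq4[of "?E 1" "?E t"] E[of 1] E[OF t] by simp
    also have "\<dots> \<le> \<epsilon> N" unfolding \<epsilon>_def b_def add_divide_distrib[symmetric] using cx N0 by (intro divide_right_mono) auto
    finally show "norm (ls 1 - dual N (\<lambda>i. ld (gauss_node N i)) t - ls t) \<le> \<epsilon> N" .
  qed
  obtain c s where c: "c \<ge> 0" and s: "s > 0" and sol: "\<And>N \<epsilon>. N \<ge> 1 \<Longrightarrow> 0 \<le> \<epsilon> \<Longrightarrow> \<epsilon> \<le> s \<Longrightarrow> O.defect N \<epsilon> \<Longrightarrow>
    (\<exists>a p. (\<forall>j\<in>{1..N}. O.res1 N a p j = 0 \<and> O.res2 N a p j = 0 \<and> norm (p j - O.pst (gauss_node N j)) \<le> c * \<epsilon>) \<and>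
      (\<forall>t\<in>{-1..1}. norm (fstw (ws (-1)) + primal N a t - fstw (ws t)) \<le> c * \<epsilon> \<and> norm (O.lam N a p t - ls t) \<le> c * \<epsilon>) \<and>
      (\<exists>e>0. \<forall>a' p'. (\<forall>j\<in>{1..N}. O.res1 N a' p' j = 0 \<and> norm (O.wt N a' p' j - O.wt N a p j) < e) \<longrightarrow> norm (O.x1 N a' - O.x1 N a) < e \<longrightarrow>
         C (O.x1 N a) \<le> C (O.x1 N a')))"
    using O.discrete_minimizer by blast
  \<comment> \<open>Since \<open>\<eta> - 1 \<ge> 1\<close>, \<open>\<epsilon> N\<close> is at most
    \<open>b / real N\<close>, so this threshold brings the defect below \<open>s\<close>.\<close>
  obtain N1 :: nat where N1: "b / s \<le> real N1" using real_arch_simple by blast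
  define N0 where "N0 = max (\<eta> + 3) N1"
  have rate: "\<epsilon> N \<le> s" "\<epsilon> N \<le> b * real N powr (2 - real \<eta>)" "0 \<le> \<epsilon> N" if N: "N \<ge> N0" for N
  proof -
    have N': "real N \<ge> 1" "real N1 \<le> real N" using N unfolding N0_def by auto
    have "real N ^ 1 \<le> real N ^ (\<eta> - 1)" using N' A1(1) by (intro power_increasing) auto
    hence "b / real N ^ (\<eta> - 1) \<le> b / real N" using b N' by (intro divide_left_mono) auto
    also have "\<dots> \<le> s"
    proof -
      have "b \<le> s * real N1" using N1 s by (simp add: pos_divide_le_eq mult.commute)
      also have "\<dots> \<le> s * real N" using N'(2) s by (intro mult_left_mono) auto
      finally show ?thesis using N'(1) by (simp add: pos_divide_le_eq)
    qed
    finally show "\<epsilon> N \<le> s" by (simp add: \<epsilon>_def)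
    \<comment> \<open>The exponent obtained is 1 - \<eta>; here it is relaxed to that of the
      claim.\<close>
    have "inverse (real N ^ (\<eta> - 1)) = real N powr (- real (\<eta> - 1))"
      using N' by (simp add: powr_minus powr_realpow)
    also have "\<dots> \<le> real N powr (2 - real \<eta>)" using N' A1(1) by (intro powr_mono) auto
    finally have "b * inverse (real N ^ (\<eta> - 1)) \<le> b * real N powr (2 - real \<eta>)" using b by (rule mult_left_mono)
    thus "\<epsilon> N \<le> b * real N powr (2 - real \<eta>)" by (simp add: \<epsilon>_def divide_inverse)
    show "0 \<le> \<epsilon> N" using b by (simp add: \<epsilon>_def)
  qed
  show ?thesis
  proof (intro exI[of _ "c * b"] exI[of _ N0] allI impI, elim conjE)
    fix N assume NN: "N0 \<le> N" "\<eta> + 1 < N"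
    have N: "N \<ge> 1" "N \<ge> \<eta> + 3" using NN by (auto simp: N0_def)
    have ce: "c * \<epsilon> N \<le> c * b * real N powr (2 - real \<eta>)"
      using mult_left_mono[OF rate(2)[OF NN(1)] c] by (simp add: mult.assoc)
    obtain a p where
      res: "\<And>j. j \<in> {1..N} \<Longrightarrow> O.res1 N a p j = 0 \<and> O.res2 N a p j = 0 \<and> norm (p j - O.pst (gauss_node N j)) \<le> c * \<epsilon> N" and
      err: "\<And>t. t \<in> {-1..1} \<Longrightarrow> norm (fstw (ws (-1)) + primal N a t - fstw (ws t)) \<le> c * \<epsilon> N \<and> norm (O.lam N a p t - ls t) \<le> c * \<epsilon> N" and
      mn: "\<exists>e>0. \<forall>a' p'. (\<forall>j\<in>{1..N}. O.res1 N a' p' j = 0 \<and> norm (O.wt N a' p' j - O.wt N a p j) < e) \<longrightarrow> norm (O.x1 N a' - O.x1 N a) < e \<longrightarrow>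
         C (O.x1 N a) \<le> C (O.x1 N a')"
      using sol[OF N(1) rate(3)[OF NN(1)] rate(1)[OF NN(1)] def[OF N(2)]] by blast
    define xN where "xN t = x0 + primal N a t" for t
    define uN where "uN i = sndw (p i)" for i
    define lN where "lN t = O.lam N a p t" for t
    let ?\<tau> = "gauss_node N"
    have wt: "O.wt N a' p' j = pack (x0 + primal N a' (?\<tau> j)) (sndw (p' j))" for a' and p' :: "nat \<Rightarrow> real^('n+'m)" and j
      unfolding O.wt_def pk.traj_def pu_pack injw_def by (simp add: pack_add xs_0)
    have x1: "O.x1 N a' = x0 + primal N a' 1" for a' unfolding O.x1_def by (simp add: xs_0)
    have xN_d: "(xN has_vector_derivative f (xN (?\<tau> j)) (uN j)) (at (?\<tau> j))" if j: "j \<in> {1..N}" for j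
    proof -
      have "f (xN (?\<tau> j)) (uN j) = a j"
        using res[OF j] unfolding O.res1_def wt fW_def by (simp add: xN_def uN_def)
      moreover have "(xN has_vector_derivative 0 + a j) (at (?\<tau> j))"
        unfolding xN_def by (intro has_vector_derivative_add has_vector_derivative_const primal_has_derivative j)
      ultimately show ?thesis by simp
    qed
    have adjj: "fstw (p j) = - gradxH Df (xN (?\<tau> j)) (uN j) (lN (?\<tau> j))" "graduH Df (xN (?\<tau> j)) (uN j) (lN (?\<tau> j)) = 0"
      if j: "j \<in> {1..N}" for j
    proof -
      have "pack (fstw (p j) + gradxH Df (xN (?\<tau> j)) (uN j) (lN (?\<tau> j))) (graduH Df (xN (?\<tau> j)) (uN j) (lN (?\<tau> j))) = 0"
        using res[OF j] unfolding O.res2_def wt adj_pack injw_def pack_add by (simp add: xN_def uN_def lN_def)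
      hence "fstw (p j) + gradxH Df (xN (?\<tau> j)) (uN j) (lN (?\<tau> j)) = 0 \<and> graduH Df (xN (?\<tau> j)) (uN j) (lN (?\<tau> j)) = 0"
        by (subst (asm) vec_sum_eq_iff) (simp add: vec_eq_iff)
      thus "fstw (p j) = - gradxH Df (xN (?\<tau> j)) (uN j) (lN (?\<tau> j))" "graduH Df (xN (?\<tau> j)) (uN j) (lN (?\<tau> j)) = 0"
        by (auto simp: eq_neg_iff_add_eq_0)
    qed
    have lN_eq: "lN = (\<lambda>t. (gradC DC (xN 1) - primal N (\<lambda>i. fstw (p i)) 1) + primal N (\<lambda>i. fstw (p i)) t)"
      unfolding lN_def O.lam_def x1 xN_def by (simp add: dual_eq_primal fun_eq_iff)
    have lmin: "local_min_D f C x0 N xN uN"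
      unfolding local_min_D_def
    proof (intro conjI)
      show "feasible_D f x0 N xN uN"
        unfolding feasible_D_def using xN_d polyvec_primal[of N x0 a] by (simp add: xN_def[abs_def])
      obtain e where e: "e > 0" and em: "\<And>a' p'. (\<forall>j\<in>{1..N}. O.res1 N a' p' j = 0 \<and> norm (O.wt N a' p' j - O.wt N a p j) < e) \<Longrightarrow>
          norm (O.x1 N a' - O.x1 N a) < e \<Longrightarrow> C (O.x1 N a) \<le> C (O.x1 N a')"
        using mn by blast
      show "\<exists>\<epsilon>>0. \<forall>y v. feasible_D f x0 N y v \<and> (\<forall>t\<in>{-1..1}. norm (y t - xN t) < \<epsilon>) \<and> (\<forall>i\<in>{1..N}. norm (v i - uN i) < \<epsilon>) \<longrightarrow> C (xN 1) \<le> C (y 1)"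
      \<comment> \<open>State and control deviations add up in the norm of \<open>pack\<close>,
        hence half of \<open>e\<close> for each.\<close>
      proof (intro exI[of _ "e / 2"] conjI allI impI, goal_cases)
        case (2 y v)
        hence F: "polyvec N y" "y (-1) = x0" "\<And>i. i \<in> {1..N} \<Longrightarrow> (y has_vector_derivative f (y (?\<tau> i)) (v i)) (at (?\<tau> i))"
          and yn: "\<And>t. t \<in> {-1..1} \<Longrightarrow> norm (y t - xN t) < e / 2" and vn: "\<And>i. i \<in> {1..N} \<Longrightarrow> norm (v i - uN i) < e / 2"
          unfolding feasible_D_def by auto
        define a' where "a' i = f (y (?\<tau> i)) (v i)" for i
        \<comment> \<open>The first component stands for a costate derivative, which feasibility
          does not see; 0 is a placeholder.\<close>
        define p' where "p' i = pack (0 :: real^'n) (v i)" for i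
        have y: "y t = x0 + primal N a' t" for t
          using polyvec_eq_primal[OF F(1) N(1), of a' t] F(2,3) unfolding a'_def by simp
        have "C (O.x1 N a) \<le> C (O.x1 N a')"
        proof (rule em[of a' p'], intro ballI conjI)
          fix j assume j: "j \<in> {1..N}"
          have t: "?\<tau> j \<in> {-1..1}" using gauss_node_bounds[OF j] by auto
          show "O.res1 N a' p' j = 0"
            unfolding O.res1_def wt fW_def y[symmetric] by (simp add: p'_def a'_def)
          have "norm (pack (y (?\<tau> j) - xN (?\<tau> j)) (v j - uN j)) \<le> norm (y (?\<tau> j) - xN (?\<tau> j)) + norm (v j - uN j)"
            by (rule norm_pack_le)
          thus "norm (O.wt N a' p' j - O.wt N a p j) < e"
            unfolding wt y[symmetric] xN_def[symmetric] pack_diff using yn[OF t] vn[OF j] by (simp add: p'_def uN_def)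
        next
          show "norm (O.x1 N a' - O.x1 N a) < e"
            unfolding x1 y[symmetric] xN_def[symmetric] using yn[of 1] e by simp
        qed
        thus ?case unfolding x1 y[symmetric] xN_def[symmetric] .
      qed (use e in simp)
    qed
    show "\<exists>(xN :: real \<Rightarrow> real^'n) (uN :: nat \<Rightarrow> real^'m) (lN :: real \<Rightarrow> real^'n).
              local_min_D f C x0 N xN uN \<and>
              polyvec N lN \<and>
              (\<forall>i\<in>{1..N}. (lN has_vector_derivative
                   - gradxH Df (xN (gauss_node N i)) (uN i) (lN (gauss_node N i))) (at (gauss_node N i))) \<and>
              lN 1 = gradC DC (xN 1) \<and>
              (\<forall>i\<in>{1..N}. graduH Df (xN (gauss_node N i)) (uN i) (lN (gauss_node N i)) = 0) \<and>
              (\<forall>i\<in>{0..N+1}. norm (xN (gauss_node N i) - xs (gauss_node N i)) \<le> c * b * real N powr (2 - real \<eta>)) \<and>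
              (\<forall>i\<in>{1..N}. norm (uN i - us (gauss_node N i)) \<le> c * b * real N powr (2 - real \<eta>)) \<and>
              (\<forall>i\<in>{0..N+1}. norm (lN (gauss_node N i) - ls (gauss_node N i)) \<le> c * b * real N powr (2 - real \<eta>))"
    proof (rule exI[of _ xN], rule exI[of _ uN], rule exI[of _ lN], intro conjI ballI lmin)
      show "polyvec N lN" unfolding lN_eq by (rule polyvec_primal)
      show "lN 1 = gradC DC (xN 1)" unfolding lN_eq by simp
      fix i assume i: "i \<in> {1..N}"
      have "(lN has_vector_derivative 0 + fstw (p i)) (at (?\<tau> i))"
        unfolding lN_eq by (intro has_vector_derivative_add has_vector_derivative_const primal_has_derivative i)
      thus "(lN has_vector_derivative - gradxH Df (xN (?\<tau> i)) (uN i) (lN (?\<tau> i))) (at (?\<tau> i))"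
        using adjj(1)[OF i] by simp
      show "graduH Df (xN (?\<tau> i)) (uN i) (lN (?\<tau> i)) = 0" by (rule adjj(2)[OF i])
      have "sndw (p i - O.pst (?\<tau> i)) = uN i - us (?\<tau> i)"
        unfolding O.pst_def pu_pack injw_def pack_add sndw_diff by (simp add: uN_def)
      hence "norm (uN i - us (?\<tau> i)) \<le> norm (p i - O.pst (?\<tau> i))" by (metis norm_sndw_le)
      thus "norm (uN i - us (?\<tau> i)) \<le> c * b * real N powr (2 - real \<eta>)" using res[OF i] ce by linarith
    next
      fix i assume i: "i \<in> {0..N+1}"
      have t: "?\<tau> i \<in> {-1..1}" by (rule gauss_node_Icc[OF N(1) i])
      show "norm (xN (?\<tau> i) - xs (?\<tau> i)) \<le> c * b * real N powr (2 - real \<eta>)"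
        using err[OF t] ce by (simp add: xN_def xs_0)
      show "norm (lN (?\<tau> i) - ls (?\<tau> i)) \<le> c * b * real N powr (2 - real \<eta>)"
        using err[OF t] ce by (simp add: lN_def)
    qed
  qed
qed

end
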